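(* Let $B$ be a discrete abelian group, $\alpha\in\mathrm{Aut}(B)$, $K=\hat B$, $G=B\rtimes_\alpha\mathbb{Z}$, and let $\chi\in K$. (i) The representation $\mathrm{Ind}_B^G(\chi)$ is irreducible if and only if $\chi$ is aperiodic. (ii) If $\chi$ has (finite) minimal period $p\in\mathbb{N}$, then the commutant of $\mathrm{Ind}_B^G(\chi)$ is isomorphic to the abelian algebra of multiplication operators $\{f(z^p)\mid f\in L^\infty(\mathbb{T})\}$, i.e. the algebra of all operators on $L^2(\mathbb{T})$ of multiplication by a function $z\mapsto f(z^p)$ with $f\in L^\infty(\mathbb{T})$.
   Context: $\mathbb{T}=\{z\in\mathbb{C}:|z|=1\}\cong\mathbb{R}/\mathbb{Z}$ with Haar measure. $K=\hat B$ is the compact Pontryagin dual of $B$ (all characters $\chi:B\to\mathbb{T}$); the dual automorphism $\hat\alpha$ of $K$ is $(\hat\alpha\chi)(b)=\chi(\alpha(b))$. The discrete group $G=B\rtimes_\alpha\mathbb{Z}$ is the set $\mathbb{Z}\times B$ with product $(j,b)(k,c)=(j+k,\alpha^j(c)+b)$; $B$ is identified with $\{(0,b):b\in B\}$. For $\chi\in K$, $\mathcal{H}(\chi)$ is the Hilbert space of all functions $F:G\to\mathbb{C}$ with $F(j,b)=\chi(b)F(j,0)$ for all $j\in\mathbb{Z},b\in B$, and $\|F\|_\chi^2=\sum_{j\in\mathbb{Z}}|F(j,0)|^2<\infty$. The unitary representation $\mathrm{Ind}_B^G(\chi)$ of $G$ on $\mathcal{H}(\chi)$ is $(\mathrm{Ind}_B^G(\chi)(g_1)F)(g_2)=F(g_2g_1)$.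 $\chi$ has minimal period $p\in\mathbb{N}=\{1,2,\dots\}$ if $\hat\alpha^p(\chi)=\chi$ and $\hat\alpha^k(\chi)\ne\chi$ for $1\le k<p$. $\chi$ is aperiodic if it has no finite period, i.e. the points $\hat\alpha^j(\chi)$, $j\in\mathbb{Z}$, are distinct. The commutant of a representation is the algebra of bounded operators commuting with all its operators. *)

theory Defs
  imports "HOL-Analysis.Analysis"
begin

section \<open>Hilbert spaces and operators on them\<close>

text \<open>
  The space of an induced representation depends on a character, so Hilbert spaces are
  given by carrier sets.  The inner product is linear in the first argument.
\<close>

record 'v hilbert =
  hcarrier :: "'v set"
  hzero :: "'v"
  hadd :: "'v \<Rightarrow> 'v \<Rightarrow> 'v"
  hscale :: "complex \<Rightarrow> 'v \<Rightarrow> 'v"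
  hinner :: "'v \<Rightarrow> 'v \<Rightarrow> complex"

definition hnorm :: "('v, 'm) hilbert_scheme \<Rightarrow> 'v \<Rightarrow> real" where
  "hnorm H x = sqrt (Re (hinner H x x))"

definition hdist :: "('v, 'm) hilbert_scheme \<Rightarrow> 'v \<Rightarrow> 'v \<Rightarrow> real" where
  "hdist H x y = hnorm H (hadd H x (hscale H (- 1) y))"

definition closed_subspace :: "('v, 'm) hilbert_scheme \<Rightarrow> 'v set \<Rightarrow> bool" where
  "closed_subspace H M \<longleftrightarrow>
     M \<subseteq> hcarrier H \<and> hzero H \<in> M \<and>
     (\<forall>x\<in>M. \<forall>y\<in>M. hadd H x y \<in> M) \<and>
     (\<forall>c. \<forall>x\<in>M. hscale H c x \<in> M) \<and>
     (\<forall>X x. (\<forall>n::nat. X n \<in> M) \<longrightarrow> x \<in> hcarrier H \<longrightarrow>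
        (\<lambda>n. hdist H (X n) x) \<longlonglongrightarrow> 0 \<longrightarrow> x \<in> M)"

text \<open>Operators are extensional on the carrier, so that HOL equality is equality of operators.\<close>

definition bounded_ops :: "('v, 'm) hilbert_scheme \<Rightarrow> ('v \<Rightarrow> 'v) set" where
  "bounded_ops H =
     {T \<in> hcarrier H \<rightarrow>\<^sub>E hcarrier H.
        (\<forall>x\<in>hcarrier H. \<forall>y\<in>hcarrier H. T (hadd H x y) = hadd H (T x) (T y)) \<and>
        (\<forall>c. \<forall>x\<in>hcarrier H. T (hscale H c x) = hscale H c (T x)) \<and>
        (\<exists>C. \<forall>x\<in>hcarrier H. hnorm H (T x) \<le> C * hnorm H x)}"

definition op_id :: "('v, 'm) hilbert_scheme \<Rightarrow> 'v \<Rightarrow> 'v" where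
  "op_id H = (\<lambda>x\<in>hcarrier H. x)"

definition op_add :: "('v, 'm) hilbert_scheme \<Rightarrow> ('v \<Rightarrow> 'v) \<Rightarrow> ('v \<Rightarrow> 'v) \<Rightarrow> 'v \<Rightarrow> 'v" where
  "op_add H S T = (\<lambda>x\<in>hcarrier H. hadd H (S x) (T x))"

definition op_scale :: "('v, 'm) hilbert_scheme \<Rightarrow> complex \<Rightarrow> ('v \<Rightarrow> 'v) \<Rightarrow> 'v \<Rightarrow> 'v" where
  "op_scale H c T = (\<lambda>x\<in>hcarrier H. hscale H c (T x))"

definition op_mult :: "('v, 'm) hilbert_scheme \<Rightarrow> ('v \<Rightarrow> 'v) \<Rightarrow> ('v \<Rightarrow> 'v) \<Rightarrow> 'v \<Rightarrow> 'v" where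
  "op_mult H S T = compose (hcarrier H) S T"

definition op_adj :: "('v, 'm) hilbert_scheme \<Rightarrow> ('v \<Rightarrow> 'v) \<Rightarrow> 'v \<Rightarrow> 'v" where
  "op_adj H T = (THE S. S \<in> bounded_ops H \<and>
     (\<forall>x\<in>hcarrier H. \<forall>y\<in>hcarrier H. hinner H (T x) y = hinner H x (S y)))"

definition star_algebra :: "('v, 'm) hilbert_scheme \<Rightarrow> ('v \<Rightarrow> 'v) set \<Rightarrow> bool" where
  "star_algebra H A \<longleftrightarrow>
     A \<subseteq> bounded_ops H \<and> op_id H \<in> A \<and>
     (\<forall>S\<in>A. \<forall>T\<in>A. op_add H S T \<in> A \<and> op_mult H S T \<in> A) \<and>
     (\<forall>c. \<forall>T\<in>A. op_scale H c T \<in> A) \<and>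
     (\<forall>T\<in>A. op_adj H T \<in> A)"

definition abelian_algebra :: "('v, 'm) hilbert_scheme \<Rightarrow> ('v \<Rightarrow> 'v) set \<Rightarrow> bool" where
  "abelian_algebra H A \<longleftrightarrow>
     star_algebra H A \<and> (\<forall>S\<in>A. \<forall>T\<in>A. op_mult H S T = op_mult H T S)"

text \<open>Isomorphism is meant in the sense of operator algebras, i.e. it respects adjoints.\<close>

definition star_isomorphic ::
  "('v, 'm) hilbert_scheme \<Rightarrow> ('v \<Rightarrow> 'v) set \<Rightarrow>
   ('w, 'n) hilbert_scheme \<Rightarrow> ('w \<Rightarrow> 'w) set \<Rightarrow> bool" where
  "star_isomorphic H A H' A' \<longleftrightarrow>
     star_algebra H A \<and> star_algebra H' A' \<and>
     (\<exists>\<Phi>. bij_betw \<Phi> A A' \<and>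
        (\<forall>S\<in>A. \<forall>T\<in>A. \<Phi> (op_add H S T) = op_add H' (\<Phi> S) (\<Phi> T)) \<and>
        (\<forall>c. \<forall>T\<in>A. \<Phi> (op_scale H c T) = op_scale H' c (\<Phi> T)) \<and>
        (\<forall>S\<in>A. \<forall>T\<in>A. \<Phi> (op_mult H S T) = op_mult H' (\<Phi> S) (\<Phi> T)) \<and>
        (\<forall>T\<in>A. \<Phi> (op_adj H T) = op_adj H' (\<Phi> T)))"

definition irreducible_rep :: "('v, 'm) hilbert_scheme \<Rightarrow> ('g \<Rightarrow> 'v \<Rightarrow> 'v) \<Rightarrow> bool" where
  "irreducible_rep H \<pi> \<longleftrightarrow>
     hcarrier H \<noteq> {hzero H} \<and>
     (\<forall>M. closed_subspace H M \<and> (\<forall>g. \<forall>x\<in>M. \<pi> g x \<in> M) \<longrightarrow>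
        M = {hzero H} \<or> M = hcarrier H)"

definition commutant :: "('v, 'm) hilbert_scheme \<Rightarrow> ('g \<Rightarrow> 'v \<Rightarrow> 'v) \<Rightarrow> ('v \<Rightarrow> 'v) set" where
  "commutant H \<pi> =
     {T \<in> bounded_ops H. \<forall>g. \<forall>x\<in>hcarrier H. T (\<pi> g x) = \<pi> g (T x)}"


section \<open>The semidirect product and the induced representation\<close>

definition automorphism :: "('b::ab_group_add \<Rightarrow> 'b) \<Rightarrow> bool" where
  "automorphism \<alpha> \<longleftrightarrow> bij \<alpha> \<and> (\<forall>a b. \<alpha> (a + b) = \<alpha> a + \<alpha> b)"

definition int_iter :: "('x \<Rightarrow> 'x) \<Rightarrow> int \<Rightarrow> 'x \<Rightarrow> 'x" where
  "int_iter f j = (if 0 \<le> j then f ^^ nat j else inv f ^^ nat (- j))"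

text \<open>The underlying set of \<open>B \<rtimes>\<^sub>\<alpha> \<int>\<close> is the full type \<open>int \<times> 'b\<close>.\<close>

fun sd_mult ::
  "('b::ab_group_add \<Rightarrow> 'b) \<Rightarrow> int \<times> 'b \<Rightarrow> int \<times> 'b \<Rightarrow> int \<times> 'b" where
  "sd_mult \<alpha> (j, b) (k, c) = (j + k, int_iter \<alpha> j c + b)"

definition characters :: "('b::ab_group_add \<Rightarrow> complex) set" where
  "characters = {chi. (\<forall>b. cmod (chi b) = 1) \<and> (\<forall>b c. chi (b + c) = chi b * chi c)}"

definition dual_aut :: "('b \<Rightarrow> 'b) \<Rightarrow> ('b \<Rightarrow> complex) \<Rightarrow> 'b \<Rightarrow> complex" where
  "dual_aut \<alpha> chi = (\<lambda>b. chi (\<alpha> b))"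

definition has_period :: "('b \<Rightarrow> 'b) \<Rightarrow> ('b \<Rightarrow> complex) \<Rightarrow> nat \<Rightarrow> bool" where
  "has_period \<alpha> chi p \<longleftrightarrow> 1 \<le> p \<and> (dual_aut \<alpha> ^^ p) chi = chi"

definition minimal_period :: "('b \<Rightarrow> 'b) \<Rightarrow> ('b \<Rightarrow> complex) \<Rightarrow> nat \<Rightarrow> bool" where
  "minimal_period \<alpha> chi p \<longleftrightarrow>
     has_period \<alpha> chi p \<and> (\<forall>k. 1 \<le> k \<and> k < p \<longrightarrow> (dual_aut \<alpha> ^^ k) chi \<noteq> chi)"

definition aperiodic :: "('b \<Rightarrow> 'b) \<Rightarrow> ('b \<Rightarrow> complex) \<Rightarrow> bool" where
  "aperiodic \<alpha> chi \<longleftrightarrow> \<not> (\<exists>p. has_period \<alpha> chi p)"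

lemma bij_dual_aut:
  assumes "bij \<alpha>"
  shows "bij (dual_aut \<alpha>)"
proof (rule o_bij[where g = "dual_aut (inv \<alpha>)"])
  show "dual_aut (inv \<alpha>) \<circ> dual_aut \<alpha> = id"
    using assms by (auto simp: dual_aut_def fun_eq_iff bij_is_surj surj_f_inv_f)
  show "dual_aut \<alpha> \<circ> dual_aut (inv \<alpha>) = id"
    using assms by (auto simp: dual_aut_def fun_eq_iff bij_is_inj)
qed

lemma funpow_inv_cancel:
  fixes f :: "'x \<Rightarrow> 'x"
  assumes "bij f"
  shows "(f ^^ n) ((inv f ^^ n) x) = x"
proof (induction n arbitrary: x)
  case (Suc n)
  have "(f ^^ Suc n) ((inv f ^^ Suc n) x) = f ((f ^^ n) ((inv f ^^ n) (inv f x)))"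
    by (simp add: funpow_swap1)
  also have "\<dots> = x"
    using assms by (simp add: Suc.IH bij_is_surj surj_f_inv_f)
  finally show ?case .
qed simp

lemma funpow_int_iter:
  assumes "bij f" and "0 \<le> j + int N"
  shows "(f ^^ N) (int_iter f j x) = (f ^^ nat (j + int N)) x"
proof (cases "0 \<le> j")
  case True
  then have "nat (j + int N) = N + nat j" by simp
  then show ?thesis using True by (simp add: int_iter_def funpow_add)
next
  case False
  then have "N = nat (j + int N) + nat (- j)" using assms(2) by simp
  then have "f ^^ N = f ^^ nat (j + int N) \<circ> f ^^ nat (- j)" by (metis funpow_add)
  then show ?thesis using False assms(1) by (simp add: int_iter_def funpow_inv_cancel)
qed

lemma aperiodic_iff_distinct_orbit:
  assumes "bij \<alpha>"
  shows "aperiodic \<alpha> chi \<longleftrightarrow> inj (\<lambda>j. int_iter (dual_aut \<alpha>) j chi)"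
proof
  let ?f = "dual_aut \<alpha>"
  have bf: "bij ?f" using assms by (rule bij_dual_aut)
  assume ap: "aperiodic \<alpha> chi"
  have neq: "int_iter ?f i chi \<noteq> int_iter ?f j chi" if "i < j" for i j
  proof
    assume eq: "int_iter ?f i chi = int_iter ?f j chi"
    define N where "N = nat \<bar>i\<bar> + nat \<bar>j\<bar>"
    define a where "a = nat (i + int N)"
    define d where "d = nat (j - i)"
    have "nat (j + int N) = a + d" using that by (auto simp: N_def a_def d_def)
    moreover have "0 \<le> i + int N" "0 \<le> j + int N" by (auto simp: N_def)
    ultimately have "(?f ^^ a) chi = (?f ^^ (a + d)) chi"
      using funpow_int_iter[OF bf, of i N chi] funpow_int_iter[OF bf, of j N chi] eq
      by (simp add: a_def)
    then have "(?f ^^ a) chi = (?f ^^ a) ((?f ^^ d) chi)" by (simp add: funpow_add)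
    moreover have "inj (?f ^^ a)" using bf by (simp add: bij_is_inj inj_fn)
    ultimately have "chi = (?f ^^ d) chi" by (rule injD[rotated])
    then have "has_period \<alpha> chi d" using that by (auto simp: has_period_def d_def)
    then show False using ap by (auto simp: aperiodic_def)
  qed
  show "inj (\<lambda>j. int_iter ?f j chi)"
  proof (rule injI)
    fix i j assume "int_iter ?f i chi = int_iter ?f j chi"
    then show "i = j" using neq[of i j] neq[of j i] by (cases i j rule: linorder_cases) auto
  qed
next
  assume inj: "inj (\<lambda>j. int_iter (dual_aut \<alpha>) j chi)"
  show "aperiodic \<alpha> chi"
    unfolding aperiodic_def
  proof
    assume "\<exists>p. has_period \<alpha> chi p"
    then obtain p where p: "1 \<le> p" "(dual_aut \<alpha> ^^ p) chi = chi"
      by (auto simp: has_period_def)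
    then have "int_iter (dual_aut \<alpha>) (int p) chi = int_iter (dual_aut \<alpha>) 0 chi"
      by (simp add: int_iter_def)
    then have "int p = 0" by (rule injD[OF inj])
    then show False using p by simp
  qed
qed

definition ind_space :: "('b::ab_group_add \<Rightarrow> complex) \<Rightarrow> (int \<times> 'b \<Rightarrow> complex) hilbert" where
  "ind_space chi =
     \<lparr> hcarrier = {F. (\<forall>j b. F (j, b) = chi b * F (j, 0)) \<and>
                     (\<lambda>j. (cmod (F (j, 0)))\<^sup>2) summable_on UNIV},
       hzero = (\<lambda>_. 0),
       hadd = (\<lambda>F F' g. F g + F' g),
       hscale = (\<lambda>c F g. c * F g),
       hinner = (\<lambda>F F'. \<Sum>\<^sub>\<infinity>j. F (j, 0) * cnj (F' (j, 0))) \<rparr>"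

definition ind_rep ::
  "('b::ab_group_add \<Rightarrow> 'b) \<Rightarrow> int \<times> 'b \<Rightarrow> (int \<times> 'b \<Rightarrow> complex) \<Rightarrow> int \<times> 'b \<Rightarrow> complex" where
  "ind_rep \<alpha> g F = (\<lambda>g'. F (sd_mult \<alpha> g' g))"


section \<open>Multiplication operators on the circle\<close>

definition circle_haar :: "complex measure" where
  "circle_haar = distr (restrict_space lborel {0..<1::real})
     (restrict_space borel (sphere 0 1)) (\<lambda>t. cis (2 * pi * t))"

text \<open>Elements of \<open>L\<^sup>2\<close> are classes of measurable functions modulo equality almost everywhere.\<close>

definition ae_class :: "'z measure \<Rightarrow> ('z \<Rightarrow> complex) \<Rightarrow> ('z \<Rightarrow> complex) set" where
  "ae_class M f = {g \<in> borel_measurable M. AE z in M. g z = f z}"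

definition ae_rep :: "('z \<Rightarrow> complex) set \<Rightarrow> 'z \<Rightarrow> complex" where
  "ae_rep X = (SOME f. f \<in> X)"

definition L2_space :: "'z measure \<Rightarrow> ('z \<Rightarrow> complex) set hilbert" where
  "L2_space M =
     \<lparr> hcarrier = ae_class M ` {f \<in> borel_measurable M. integrable M (\<lambda>z. (cmod (f z))\<^sup>2)},
       hzero = ae_class M (\<lambda>_. 0),
       hadd = (\<lambda>X Y. ae_class M (\<lambda>z. ae_rep X z + ae_rep Y z)),
       hscale = (\<lambda>c X. ae_class M (\<lambda>z. c * ae_rep X z)),
       hinner = (\<lambda>X Y. LINT z|M. ae_rep X z * cnj (ae_rep Y z)) \<rparr>"

definition Linf_funs :: "'z measure \<Rightarrow> ('z \<Rightarrow> complex) set" where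
  "Linf_funs M = {f \<in> borel_measurable M. \<exists>C. AE z in M. cmod (f z) \<le> C}"

definition mult_operator ::
  "'z measure \<Rightarrow> ('z \<Rightarrow> complex) \<Rightarrow> ('z \<Rightarrow> complex) set \<Rightarrow> ('z \<Rightarrow> complex) set" where
  "mult_operator M \<phi> = (\<lambda>X\<in>hcarrier (L2_space M). ae_class M (\<lambda>z. \<phi> z * ae_rep X z))"

definition power_mult_algebra ::
  "nat \<Rightarrow> ((complex \<Rightarrow> complex) set \<Rightarrow> (complex \<Rightarrow> complex) set) set" where
  "power_mult_algebra p =
     {mult_operator circle_haar (\<lambda>z. f (z ^ p)) | f. f \<in> Linf_funs circle_haar}"

end

theory Submission
  imports Defs
begin

text \<open>
  Restriction to \<open>\<int> \<times> {0}\<close> identifies the space of the induced representation with \<open>l\<^sup>2(\<int>)\<close>. There the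
  element \<open>(k, c)\<close> of the group acts as a shift by \<open>k\<close> followed by multiplication by the sequence
  \<open>chi (\<alpha>\<^sup>j c)\<close>. The basis vectors are thus simultaneous eigenvectors of the abelian group \<open>B\<close>, which
  are permuted transitively by the shift, and everything depends on which of the eigencharacters coincide.

  If \<open>chi\<close> is aperiodic, all of them are different. Averages over the action of single elements of \<open>B\<close>
  converge to projections that separate any two coordinates, so a nonzero closed invariant subspace
  contains a basis vector and, by shifting, all of them (\<open>aperiodic_imp_irreducible\<close>).

  If \<open>chi\<close> has minimal period \<open>p\<close>, the characters at \<open>i\<close> and \<open>j\<close> coincide exactly for \<open>i\<close> and \<open>j\<close>
  congruent modulo \<open>p\<close>. The Fourier transform \<open>fourier_map\<close> is a unitary from \<open>L\<^sup>2\<close> of the circle to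
  the induced space, and it turns the shift into multiplication by a power of \<open>z\<close>. An operator commuting with
  the shift is multiplication by a bounded function \<open>\<phi>\<close> (\<open>bounded_op_is_mult_operator\<close>); commuting with \<open>B\<close> means
  that the Fourier coefficients of \<open>\<phi>\<close> are supported on the multiples of \<open>p\<close>, that is, \<open>\<phi>\<close> is a bounded function
  of \<open>z ^ p\<close> (\<open>Linf_function_of_power\<close>). So the unitary carries the algebra of these multiplications onto
  the commutant (\<open>commutant_eq\<close>), and conjugation by it is the isomorphism
  (\<open>star_isomorphic_transport\<close>). The algebra contains nontrivial projections, whose kernels are invariant
  subspaces; this also settles the periodic half of the criterion for irreducibility
  (\<open>periodic_imp_reducible\<close>).

  The Fourier analysis needed is completeness of the monomials and the Riesz-Fischer theorem. The former
  rests on the fact that a finite measure on the circle is determined by its moments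
  (\<open>circle_measure_eqI\<close>), which also shows that rotations and the map \<open>z \<mapsto> z ^ p\<close> preserve Haar measure;
  the latter rests on completeness of \<open>L\<^sup>2\<close> (\<open>L2_complete\<close>).
\<close>

section \<open>Measures on the circle and their moments\<close>

abbreviation circle_borel :: "complex measure" where
  "circle_borel \<equiv> restrict_space borel (sphere 0 1)"

lemma sets_circle_haar [measurable_cong]: "sets circle_haar = sets circle_borel"
  by (simp add: circle_haar_def)

lemma space_circle_haar: "space circle_haar = sphere 0 1"
  by (simp add: circle_haar_def space_restrict_space)

lemma cis_measurable_circle:
  "(\<lambda>t. cis (2 * pi * t)) \<in> measurable (restrict_space lborel {0..<1::real}) circle_borel"
proof (rule measurable_restrict_space2)
  have "(\<lambda>t. cis (2 * pi * t)) \<in> borel_measurable borel"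
    by (intro borel_measurable_continuous_onI continuous_intros)
  then show "(\<lambda>t. cis (2 * pi * t)) \<in> borel_measurable (restrict_space lborel {0..<1::real})"
    by (intro measurable_restrict_space1) simp
qed auto

lemma finite_circle_haar: "finite_measure circle_haar"
  and measure_circle_haar: "measure circle_haar (sphere 0 1) = 1"
proof -
  have "emeasure circle_haar (sphere 0 1) = emeasure (restrict_space lborel {0..<1::real}) {0..<1}"
    unfolding circle_haar_def
    by (subst emeasure_distr[OF cis_measurable_circle])
       (auto simp: space_restrict_space sets_restrict_space intro!: arg_cong[where f="emeasure _"])
  also have "\<dots> = 1"
    by (subst emeasure_restrict_space) auto
  finally have e: "emeasure circle_haar (sphere 0 1) = 1" .
  show "finite_measure circle_haar"
    by (rule finite_measureI) (simp add: space_circle_haar e)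
  show "measure circle_haar (sphere 0 1) = 1"
    by (simp add: measure_def e)
qed

lemma circle_integrable:
  fixes f :: "complex \<Rightarrow> 'a::{banach, second_countable_topology}"
  assumes "finite_measure M" and "sets M = sets circle_borel"
    and "continuous_on (sphere 0 1) f"
  shows "integrable M f"
proof -
  have sp: "space M = sphere 0 1"
    using sets_eq_imp_space_eq[OF assms(2)] by (simp add: space_restrict_space)
  have "compact (f ` sphere 0 1)"
    using assms(3) by (intro compact_continuous_image) auto
  then have "bounded (f ` sphere 0 1)" by (rule compact_imp_bounded)
  then obtain C where C: "\<And>z. z \<in> sphere 0 1 \<Longrightarrow> norm (f z) \<le> C"
    unfolding bounded_iff by (metis image_eqI)
  have "f \<in> borel_measurable circle_borel"
    by (rule borel_measurable_continuous_on_restrict) (rule assms(3))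
  then have "f \<in> borel_measurable M" by (simp cong: measurable_cong_sets add: assms(2))
  then show ?thesis
    by (rule finite_measure.integrable_const_bound[OF assms(1), rotated])
       (rule AE_I2, simp add: sp, use C in simp)
qed

lemma continuous_on_circle_powi: "continuous_on (sphere 0 1) (\<lambda>z::complex. z powi n)"
  by (intro continuous_intros) auto

lemma powi_measurable_circle [measurable]: "(\<lambda>z::complex. z powi n) \<in> borel_measurable circle_haar"
  by (rule borel_measurable_integrable[OF circle_integrable[OF finite_circle_haar sets_circle_haar continuous_on_circle_powi]])

lemma cnj_powi_circle:
  assumes "z \<in> sphere 0 1"
  shows "cnj (z powi n) = z powi (- n)"
proof -
  have "inverse z = cnj z"
    using assms by (intro inverse_unique) (simp add: complex_norm_square[symmetric])
  then show ?thesis by (metis complex_cnj_power_int power_int_inverse power_int_minus)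
qed

lemma circle_haar_moment: "(LINT z|circle_haar. z powi n) = (if n = 0 then 1 else 0)"
proof (cases "n = 0")
  case True
  then show ?thesis by (simp add: space_circle_haar measure_circle_haar)
next
  case False
  define w where "w = 2 * pi * \<i> * of_int n"
  have w: "w \<noteq> 0" using False by (simp add: w_def)
  define F where "F t = exp (w * of_real t) / w" for t :: real
  have "((\<lambda>z. exp (w * z) / w) has_field_derivative exp (w * of_real x)) (at (of_real x))" for x
    using w by (auto intro!: derivative_eq_intros)
  from has_vector_derivative_real_field[OF this]
  have "(F has_vector_derivative exp (w * of_real x)) (at x within {0..1})" for x
    by (simp only: F_def[abs_def])
  moreover have "exp (w * of_real x) = cis (2 * pi * of_int n * x)" for x
    by (simp add: cis_conv_exp w_def mult_ac)
  ultimately have d: "(F has_vector_derivative cis (2 * pi * of_int n * x)) (at x within {0..1})" for x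
    by simp
  have "(LINT z|circle_haar. z powi n) = (LINT t|restrict_space lborel {0..<1::real}. cis (2 * pi * t) powi n)"
    unfolding circle_haar_def
    by (rule integral_distr[OF cis_measurable_circle])
       (rule borel_measurable_continuous_on_restrict[OF continuous_on_circle_powi])
  also have "\<dots> = (LINT t|lborel. indicator {0..<1} t *\<^sub>R cis (2 * pi * t) powi n)"
    by (rule integral_restrict_space) simp
  also have "\<dots> = (LINT t|lborel. indicator {0..1} t *\<^sub>R cis (2 * pi * of_int n * t))"
  proof (rule integral_cong_AE)
    have "AE t in lborel. t \<noteq> (1::real)" by (rule AE_lborel_singleton)
    then show "AE t in lborel. indicator {0..<1} t *\<^sub>R cis (2 * pi * t) powi n
        = indicator {0..1::real} t *\<^sub>R cis (2 * pi * of_int n * t)"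
      by eventually_elim (auto simp: indicator_def cis_power_int mult_ac)
    have 1: "(\<lambda>t. cis (c * t)) \<in> borel_measurable borel" for c
      by (intro borel_measurable_continuous_onI continuous_intros)
    show "(\<lambda>t. indicator {0..<1::real} t *\<^sub>R cis (2 * pi * t) powi n) \<in> borel_measurable lborel"
      using 1[of "of_int n * (2 * pi)"] by (simp add: cis_power_int mult.assoc)
    show "(\<lambda>t. indicator {0..1::real} t *\<^sub>R cis (2 * pi * of_int n * t)) \<in> borel_measurable lborel"
      using 1[of "2 * pi * of_int n"] by simp
  qed
  also have "\<dots> = F 1 - F 0"
    using d by (intro integral_FTC_atLeastAtMost continuous_intros) auto
  also have "\<dots> = 0"
    using exp_integer_2pi[of "of_int n"] by (simp add: F_def w_def mult_ac)
  finally show ?thesis using False by simp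
qed

text \<open>
  On the circle \<open>Re z\<close> and \<open>Im z\<close> are combinations of \<open>z\<close> and \<open>1 / z\<close>, so multiplying
  a function by a linear form only shifts its moments. Hence the functions all of whose moments agree
  for the two measures are stable under multiplication by real polynomials, and Stone-Weierstrass
  extends the equality of integrals to all continuous functions. Closed sets are limits of such
  functions and generate the Borel sets.
\<close>

lemma circle_measure_eqI:
  assumes fin: "finite_measure M" "finite_measure N"
    and sets: "sets M = sets circle_borel" "sets N = sets circle_borel"
    and moments: "\<And>n. (LINT z|M. z powi n) = (LINT z|N. z powi n)"
  shows "M = N"
proof -
  interpret M: finite_measure M by fact
  interpret N: finite_measure N by fact
  note [measurable_cong] = sets
  have sp: "space M = sphere 0 1" "space N = sphere 0 1"
    using sets_eq_imp_space_eq[OF sets(1)] sets_eq_imp_space_eq[OF sets(2)]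
    by (simp_all add: space_restrict_space)
  \<comment> \<open>The factor k is kept general: this makes the induction step for products of polynomials trivial.\<close>
  define K where "K k \<longleftrightarrow> continuous_on (sphere 0 1) k \<and>
      (\<forall>n. (LINT z|M. k z * z powi n) = (LINT z|N. k z * z powi n))" for k :: "complex \<Rightarrow> complex"
  have int: "integrable M (\<lambda>z. k z * z powi n)" "integrable N (\<lambda>z. k z * z powi n)"
    if "continuous_on (sphere 0 1) k" for k and n
    using that fin sets by (intro circle_integrable continuous_intros; force)+
  have poly: "K k \<Longrightarrow> K (\<lambda>z. of_real (h z) * k z)" if "real_polynomial_function h" for h k
    using that
  proof (induction arbitrary: k)
    case (linear h)
    have ck: "continuous_on (sphere 0 1) k" using linear by (simp add: K_def)
    define a b :: complex
      where "a = of_real (h 1) / 2 + of_real (h \<i>) / (2 * \<i>)"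
        and "b = of_real (h 1) / 2 - of_real (h \<i>) / (2 * \<i>)"
    have eq: "of_real (h z) * k z * z powi n = a * (k z * z powi (n + 1)) + b * (k z * z powi (n - 1))"
      if z: "z \<in> sphere 0 1" for z n
    proof -
      interpret h: bounded_linear h by (rule linear)
      have "z = Re z *\<^sub>R 1 + Im z *\<^sub>R \<i>" by (simp add: complex_eq_iff)
      then have hz: "h z = Re z * h 1 + Im z * h \<i>" by (metis h.add h.scaleR real_scaleR_def)
      have z0: "z \<noteq> 0" using z by auto
      have inv: "inverse z = cnj z"
        using z by (intro inverse_unique) (simp add: complex_norm_square[symmetric])
      have p: "z powi (n + 1) = z * z powi n" "z powi (n - 1) = cnj z * z powi n"
        using z0 inv by (simp_all add: power_int_add power_int_diff field_simps)
      have "(of_real (h z) :: complex) = a * z + b * cnj z"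
        unfolding hz a_def b_def by (simp add: complex_eq_iff field_simps)
      then show ?thesis unfolding p by (simp add: algebra_simps)
    qed
    have "(LINT z|L. of_real (h z) * k z * z powi n)
        = a * (LINT z|L. k z * z powi (n + 1)) + b * (LINT z|L. k z * z powi (n - 1))"
      if L: "L = M \<or> L = N" for n L
    proof -
      have "(LINT z|L. of_real (h z) * k z * z powi n)
        = (LINT z|L. a * (k z * z powi (n + 1)) + b * (k z * z powi (n - 1)))"
        by (rule Bochner_Integration.integral_cong[OF refl]) (use L eq sp in auto)
      also have "\<dots> = a * (LINT z|L. k z * z powi (n + 1)) + b * (LINT z|L. k z * z powi (n - 1))"
        using L int[OF ck] by (subst Bochner_Integration.integral_add) auto
      finally show ?thesis .
    qed
    moreover have "continuous_on (sphere 0 1) (\<lambda>z. of_real (h z) * k z)"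
      using ck linear by (intro continuous_intros) (auto intro: linear_continuous_on)
    ultimately show ?case using linear by (simp add: K_def)
  next
    case (const c)
    then show ?case by (auto simp: K_def mult.assoc intro!: continuous_intros)
  next
    case (add f g)
    have K: "K (\<lambda>z. of_real (f z) * k z)" "K (\<lambda>z. of_real (g z) * k z)" using add by auto
    have "(LINT z|L. of_real (f z + g z) * k z * z powi n)
        = (LINT z|L. of_real (f z) * k z * z powi n) + (LINT z|L. of_real (g z) * k z * z powi n)"
      if L: "L = M \<or> L = N" for n L
      using L K int[of "\<lambda>z. of_real (f z) * k z"] int[of "\<lambda>z. of_real (g z) * k z"]
      by (subst Bochner_Integration.integral_add[symmetric]) (auto simp: K_def algebra_simps)
    moreover have "continuous_on (sphere 0 1) (\<lambda>z. of_real (f z + g z) * k z)"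
      using continuous_on_add K by (auto simp: K_def ring_distribs)
    ultimately show ?case using K by (simp add: K_def)
  next
    case (mult f g)
    then show ?case by (simp add: mult.assoc)
  qed
  have "K (\<lambda>_. 1)" using moments by (simp add: K_def)
  then have poly1: "(LINT z|M. g z) = (LINT z|N. g z)" if "real_polynomial_function g" for g :: "complex \<Rightarrow> real"
  proof -
    have "(LINT z|M. complex_of_real (g z)) = (LINT z|N. complex_of_real (g z))"
      using poly[OF that \<open>K (\<lambda>_. 1)\<close>] unfolding K_def by (auto dest: spec[of _ 0])
    then show ?thesis by simp
  qed
  have cont: "(LINT z|M. h z) = (LINT z|N. h z)" if h: "continuous_on (sphere 0 1) h" for h :: "complex \<Rightarrow> real"
  proof -
    define m where "m = measure M (sphere 0 1) + measure N (sphere 0 1)"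
    have m0: "0 \<le> m" by (simp add: m_def)
    have le: "\<bar>(LINT z|M. h z) - (LINT z|N. h z)\<bar> \<le> e" if "0 < e" for e
    proof -
      define d where "d = e / (m + 1)"
      have "0 < d" using that m0 by (simp add: d_def)
      then obtain g where g: "real_polynomial_function g" "\<And>z. z \<in> sphere 0 1 \<Longrightarrow> \<bar>h z - g z\<bar> < d"
        using Stone_Weierstrass_real_polynomial_function[OF compact_sphere h] by blast
      have cg: "continuous_on (sphere 0 1) g"
        using g(1) by (intro continuous_at_imp_continuous_on ballI continuous_real_polymonial_function)
      have b: "\<bar>(LINT z|L. h z) - (LINT z|L. g z)\<bar> \<le> d * measure L (sphere 0 1)"
        if L: "L = M \<or> L = N" for L
      proof -
        have iL: "integrable L h" "integrable L g" "finite_measure L" "space L = sphere 0 1"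
          using L fin sets sp circle_integrable h cg by blast+
        interpret L: finite_measure L by fact
        have "\<bar>(LINT z|L. h z) - (LINT z|L. g z)\<bar> = \<bar>LINT z|L. h z - g z\<bar>"
          using iL by simp
        also have "\<dots> \<le> (LINT z|L. \<bar>h z - g z\<bar>)" by (rule integral_abs_bound)
        also have "\<dots> \<le> (LINT z|L. d)"
        proof (rule integral_mono)
          fix z assume "z \<in> space L"
          then show "\<bar>h z - g z\<bar> \<le> d" using g(2)[of z] iL(4) by simp
        qed (use iL in auto)
        finally show ?thesis by (simp add: iL(4) mult.commute)
      qed
      have "\<bar>(LINT z|M. h z) - (LINT z|N. h z)\<bar> \<le> d * m"
        using b[of M] b[of N] poly1[OF g(1)] by (simp add: m_def algebra_simps)
      also have "\<dots> \<le> e" using that m0 by (simp add: d_def divide_simps)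
      finally show ?thesis .
    qed
    show ?thesis using field_le_epsilon[of "\<bar>(LINT z|M. h z) - (LINT z|N. h z)\<bar>" 0] le by simp
  qed
  have closed: "measure M (C \<inter> sphere 0 1) = measure N (C \<inter> sphere 0 1)" if C: "closed C" for C :: "complex set"
  proof (cases "C = {}")
    case False
    \<comment> \<open>These continuous functions decrease to the indicator of C.\<close>
    define h where "h n z = max 0 (1 - real n * infdist z C)" for n z
    have ch: "continuous_on (sphere 0 1) (h n)" for n
      unfolding h_def by (intro continuous_intros)
    have lim: "(\<lambda>n. LINT z|L. h n z) \<longlonglongrightarrow> measure L (C \<inter> sphere 0 1)" if L: "L = M \<or> L = N" for L
    proof -
      have iL: "finite_measure L" "space L = sphere 0 1" "sets L = sets circle_borel"
        using L fin sp sets by auto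
      interpret L: finite_measure L by fact
      have CS: "C \<inter> sphere 0 1 \<in> sets L"
        using C by (auto simp: iL(3) sets_restrict_space)
      have "(\<lambda>n. LINT z|L. h n z) \<longlonglongrightarrow> (LINT z|L. indicator (C \<inter> sphere 0 1) z)"
      proof (rule integral_dominated_convergence[where w="\<lambda>_. 1"])
        show "(indicator (C \<inter> sphere 0 1) :: _ \<Rightarrow> real) \<in> borel_measurable L" using CS by simp
        show "h n \<in> borel_measurable L" for n
          using circle_integrable[OF iL(1,3) ch] by blast
        show "AE z in L. (\<lambda>n. h n z) \<longlonglongrightarrow> indicator (C \<inter> sphere 0 1) z"
        proof (rule AE_I2)
          fix z assume "z \<in> space L"
          then have z: "z \<in> sphere 0 1" by (simp add: iL)
          show "(\<lambda>n. h n z) \<longlonglongrightarrow> indicator (C \<inter> sphere 0 1) z"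
          proof (cases "z \<in> C")
            case True
            then show ?thesis using z by (simp add: h_def)
          next
            case zC: False
            then have "0 < infdist z C"
              using in_closed_iff_infdist_zero[OF C False, of z] infdist_nonneg[of z C] by linarith
            then have "eventually (\<lambda>n. 1 / infdist z C \<le> real n) sequentially"
              by (meson eventually_sequentiallyI le_cSup_finite nat_ceiling_le_eq)
            then have "eventually (\<lambda>n. h n z = 0) sequentially"
              by eventually_elim (use \<open>0 < infdist z C\<close> in \<open>simp add: h_def divide_simps\<close>)
            then show ?thesis using zC by (simp add: tendsto_eventually)
          qed
        qed
        show "AE z in L. norm (h n z) \<le> 1" for n
          by (auto simp: h_def infdist_nonneg)
      qed simp
      then show ?thesis using CS by simp
    qed
    show ?thesis
      using LIMSEQ_unique[of "\<lambda>n. LINT z|M. h n z"] lim[of M] lim[of N] cont[OF ch] by simp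
  qed simp
  have meas_id: "(\<lambda>z. z) \<in> borel_measurable L" if "L = M \<or> L = N" for L
    using that sets by (metis measurable_ident_sets measurable_restrict_space1 measurable_cong_sets measurable_ident id_def)
  have "distr M borel (\<lambda>z. z) = distr N borel (\<lambda>z. z)"
  proof (rule measure_eqI_generator_eq[where E="Collect closed" and \<Omega>=UNIV and A="\<lambda>_. UNIV"])
    show "Int_stable (Collect closed)" by (auto simp: Int_stable_def)
    fix X :: "complex set" assume "X \<in> Collect closed"
    then have X: "closed X" by simp
    have "emeasure (distr L borel (\<lambda>z. z)) X = ennreal (measure L (X \<inter> sphere 0 1))" if "L = M \<or> L = N" for L
      using that X meas_id sp by (auto simp: emeasure_distr M.emeasure_eq_measure N.emeasure_eq_measure Int_commute)
    then show "emeasure (distr M borel (\<lambda>z. z)) X = emeasure (distr N borel (\<lambda>z. z)) X"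
      using closed[OF X] by simp
  next
    show "emeasure (distr M borel (\<lambda>z. z)) UNIV \<noteq> \<infinity>"
      using meas_id by (simp add: emeasure_distr)
  qed (auto simp: borel_eq_closed)
  then have eq: "emeasure (distr M borel (\<lambda>z. z)) A = emeasure (distr N borel (\<lambda>z. z)) A" for A by simp
  show "M = N"
  proof (rule measure_eqI)
    show "sets M = sets N" by (simp add: sets)
    fix A assume A: "A \<in> sets M"
    then have "A \<in> sets borel" "A \<subseteq> sphere 0 1"
      unfolding sets by (auto simp: sets_restrict_space)
    moreover from this have "A \<inter> sphere 0 1 = A" by blast
    ultimately show "emeasure M A = emeasure N A"
      using eq[of A] meas_id sp by (simp add: emeasure_distr)
  qed
qed

text \<open>
  A real function with vanishing moments has positive and negative parts that are densities of two
  finite measures with the same moments, which are therefore equal. A complex function is treated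
  through its real and imaginary parts; their moments vanish because the moments of the conjugate
  are conjugates of moments.
\<close>

lemma circle_integral_unique:
  fixes g :: "complex \<Rightarrow> complex"
  assumes g: "integrable circle_haar g"
    and zero: "\<And>n. (LINT z|circle_haar. g z * z powi n) = 0"
  shows "AE z in circle_haar. g z = 0"
proof -
  interpret finite_measure circle_haar by (rule finite_circle_haar)
  have real: "AE z in circle_haar. u z = 0"
    if u: "integrable circle_haar u" and z: "\<And>n. (LINT z|circle_haar. complex_of_real (u z) * z powi n) = 0"
    for u :: "complex \<Rightarrow> real"
  proof -
    have um[measurable]: "u \<in> borel_measurable circle_haar" using u by simp
    define P where "P = density circle_haar (\<lambda>z. ennreal (max 0 (u z)))"
    define Q where "Q = density circle_haar (\<lambda>z. ennreal (max 0 (- u z)))"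
    have fin: "finite_measure (density circle_haar (\<lambda>z. ennreal (max 0 (v z))))"
      if "integrable circle_haar v" for v :: "complex \<Rightarrow> real"
    proof (rule finite_measureI)
      have [measurable]: "v \<in> borel_measurable circle_haar" using that by simp
      have "integrable circle_haar (\<lambda>z. max 0 (v z))" using that by simp
      then have "(\<integral>\<^sup>+ z. ennreal (max 0 (v z)) \<partial>circle_haar) < \<infinity>"
        by (subst nn_integral_eq_integral) auto
      then show "emeasure (density circle_haar (\<lambda>z. ennreal (max 0 (v z)))) (space (density circle_haar (\<lambda>z. ennreal (max 0 (v z))))) \<noteq> \<infinity>"
        by (simp add: emeasure_density cong: nn_integral_cong)
    qed
    have mom: "(LINT z|density circle_haar (\<lambda>z. ennreal (max 0 (v z))). z powi n)
        = (LINT z|circle_haar. max 0 (v z) *\<^sub>R z powi n)"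
      if "integrable circle_haar v" for v :: "complex \<Rightarrow> real" and n
      using that by (intro integral_density) auto
    have bd: "integrable circle_haar (\<lambda>z. max 0 (v z) *\<^sub>R z powi n)"
      if "integrable circle_haar v" for v :: "complex \<Rightarrow> real" and n
    proof (rule Bochner_Integration.integrable_bound[OF that])
      show "(\<lambda>z. max 0 (v z) *\<^sub>R z powi n) \<in> borel_measurable circle_haar"
        using that by measurable
      show "AE z in circle_haar. norm (max 0 (v z) *\<^sub>R z powi n) \<le> norm (v z)"
        by (rule AE_I2) (auto simp: space_circle_haar norm_power_int)
    qed
    have "P = Q"
    proof (rule circle_measure_eqI)
      fix n
      have "(LINT z|P. z powi n) - (LINT z|Q. z powi n)
        = (LINT z|circle_haar. max 0 (u z) *\<^sub>R z powi n - max 0 (- u z) *\<^sub>R z powi n)"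
        unfolding P_def Q_def using u by (simp add: mom bd)
      also have "\<dots> = (LINT z|circle_haar. complex_of_real (u z) * z powi n)"
        by (rule Bochner_Integration.integral_cong) (auto simp: scaleR_conv_of_real max_def)
      finally show "(LINT z|P. z powi n) = (LINT z|Q. z powi n)" using z by simp
    qed (use u fin in \<open>auto simp: P_def Q_def sets_circle_haar\<close>)
    then have "AE z in circle_haar. ennreal (max 0 (u z)) = ennreal (max 0 (- u z))"
      unfolding P_def Q_def by (subst (asm) density_unique_iff) auto
    then show ?thesis by eventually_elim (auto simp: max_def split: if_splits)
  qed
  have gm[measurable]: "g \<in> borel_measurable circle_haar" using g by simp
  have gi: "integrable circle_haar (\<lambda>z. g z * z powi n)" for n
  proof (rule Bochner_Integration.integrable_bound[OF g])
    show "AE z in circle_haar. norm (g z * z powi n) \<le> norm (g z)"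
      by (rule AE_I2) (auto simp: space_circle_haar norm_power_int norm_mult)
  qed measurable
  have gci: "integrable circle_haar (\<lambda>z. cnj (g z) * z powi n)"
    and gcz: "(LINT z|circle_haar. cnj (g z) * z powi n) = 0" for n
  proof -
    have e: "cnj (g z * z powi (- n)) = cnj (g z) * z powi n" if "z \<in> space circle_haar" for z
      using that cnj_powi_circle[of z "-n"] by (simp add: space_circle_haar)
    have "integrable circle_haar (\<lambda>z. cnj (g z * z powi (- n)))"
      using gi[of "-n"] by (rule integrable_cnj)
    then show "integrable circle_haar (\<lambda>z. cnj (g z) * z powi n)"
      by (subst (asm) Bochner_Integration.integrable_cong[OF refl e])
    have "(LINT z|circle_haar. cnj (g z) * z powi n) = (LINT z|circle_haar. cnj (g z * z powi (- n)))"
      by (rule Bochner_Integration.integral_cong[OF refl e[symmetric]])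
    also have "\<dots> = 0" by (subst Bochner_Integration.integral_cnj) (simp only: zero complex_cnj_zero)
    finally show "(LINT z|circle_haar. cnj (g z) * z powi n) = 0" .
  qed
  have "AE z in circle_haar. Re (g z) = 0"
  proof (rule real)
    show "integrable circle_haar (\<lambda>z. Re (g z))" using g by simp
    fix n
    have "(LINT z|circle_haar. complex_of_real (Re (g z)) * z powi n)
        = (LINT z|circle_haar. (1/2) * (g z * z powi n) + (1/2) * (cnj (g z) * z powi n))"
      by (rule Bochner_Integration.integral_cong) (auto simp: complex_eq_iff field_simps)
    also have "\<dots> = 0" using gi gci by (simp add: zero gcz)
    finally show "(LINT z|circle_haar. complex_of_real (Re (g z)) * z powi n) = 0" .
  qed
  moreover have "AE z in circle_haar. Im (g z) = 0"
  proof (rule real)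
    show "integrable circle_haar (\<lambda>z. Im (g z))" using g by simp
    fix n
    have "(LINT z|circle_haar. complex_of_real (Im (g z)) * z powi n)
        = (LINT z|circle_haar. (- \<i>/2) * (g z * z powi n) + (\<i>/2) * (cnj (g z) * z powi n))"
      by (rule Bochner_Integration.integral_cong) (auto simp: complex_eq_iff field_simps)
    also have "\<dots> = 0" using gi gci by (simp add: zero gcz)
    finally show "(LINT z|circle_haar. complex_of_real (Im (g z)) * z powi n) = 0" .
  qed
  ultimately show ?thesis by eventually_elim (simp add: complex_eq_iff)
qed


text \<open>
  Whether a self-map preserves Haar measure can be read off from the moments. This replaces a
  change of variables on pieces of the parameter interval.
\<close>

lemma distr_circle_haar_eqI:
  assumes f: "f \<in> measurable circle_haar circle_haar"
    and moments: "\<And>n. (LINT z|circle_haar. f z powi n) = (if n = 0 then 1 else 0)"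
  shows "distr circle_haar circle_haar f = circle_haar"
proof (rule circle_measure_eqI)
  show "finite_measure (distr circle_haar circle_haar f)"
    using f by (rule finite_measure.finite_measure_distr[OF finite_circle_haar])
  show "(LINT z|distr circle_haar circle_haar f. z powi n) = (LINT z|circle_haar. z powi n)" for n
    using f by (simp add: integral_distr moments circle_haar_moment)
qed (auto simp: sets_circle_haar finite_circle_haar)

lemma circle_self_map_measurable:
  assumes "continuous_on (sphere 0 1) f" and "f \<in> sphere 0 1 \<rightarrow> sphere 0 1"
  shows "f \<in> measurable circle_haar circle_haar"
  using assms
  by (auto simp: space_restrict_space cong: measurable_cong_sets[OF sets_circle_haar sets_circle_haar]
      intro!: measurable_restrict_space2 borel_measurable_continuous_on_restrict)

lemma power_measurable_circle [measurable]: "(\<lambda>z. z ^ p) \<in> measurable circle_haar circle_haar"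
  by (rule circle_self_map_measurable) (auto intro!: continuous_intros simp: norm_power)

lemma rotation_measurable_circle:
  assumes "cmod w = 1"
  shows "(\<lambda>z. w * z) \<in> measurable circle_haar circle_haar"
  by (rule circle_self_map_measurable) (auto intro!: continuous_intros simp: norm_mult assms)

lemma power_preserves_circle_haar:
  assumes "0 < p"
  shows "distr circle_haar circle_haar (\<lambda>z. z ^ p) = circle_haar"
proof (rule distr_circle_haar_eqI[OF power_measurable_circle])
  fix n :: int
  have "(z ^ p) powi n = z powi (int p * n)" for z :: complex
    by (simp add: power_int_mult)
  then show "(LINT z|circle_haar. (z ^ p) powi n) = (if n = 0 then 1 else 0)"
    using assms by (simp add: circle_haar_moment)
qed

lemma rotation_preserves_circle_haar:
  assumes "cmod w = 1"
  shows "distr circle_haar circle_haar (\<lambda>z. w * z) = circle_haar"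
  by (rule distr_circle_haar_eqI[OF rotation_measurable_circle[OF assms]])
     (simp add: power_int_mult_distrib circle_haar_moment)

section \<open>Square-integrable functions\<close>

definition square_integrable :: "'z measure \<Rightarrow> ('z \<Rightarrow> complex) \<Rightarrow> bool" where
  "square_integrable M f \<longleftrightarrow> f \<in> borel_measurable M \<and> integrable M (\<lambda>z. (cmod (f z))\<^sup>2)"

lemma square_integrable_measurable:
  "square_integrable M f \<Longrightarrow> f \<in> borel_measurable M"
  by (simp add: square_integrable_def)

lemma square_integrable_norm: "square_integrable M f \<Longrightarrow> integrable M (\<lambda>z. (cmod (f z))\<^sup>2)"
  by (simp add: square_integrable_def)

lemma square_integrable_mult_integrable:
  assumes "square_integrable M f" and "square_integrable M g"
  shows "integrable M (\<lambda>z. f z * g z)"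
proof (rule Bochner_Integration.integrable_bound)
  show "integrable M (\<lambda>z. (cmod (f z))\<^sup>2 + (cmod (g z))\<^sup>2)"
    using assms by (simp add: square_integrable_def)
  show "(\<lambda>z. f z * g z) \<in> borel_measurable M"
    using assms by (auto simp: square_integrable_def)
  show "AE z in M. norm (f z * g z) \<le> norm ((cmod (f z))\<^sup>2 + (cmod (g z))\<^sup>2)"
  proof (rule AE_I2)
    fix z
    have "2 * (cmod (f z) * cmod (g z)) \<le> (cmod (f z))\<^sup>2 + (cmod (g z))\<^sup>2"
      using sum_squares_bound[of "cmod (f z)" "cmod (g z)"] by simp
    moreover have "0 \<le> cmod (f z) * cmod (g z)" by simp
    ultimately have "cmod (f z) * cmod (g z) \<le> (cmod (f z))\<^sup>2 + (cmod (g z))\<^sup>2" by linarith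
    then show "norm (f z * g z) \<le> norm ((cmod (f z))\<^sup>2 + (cmod (g z))\<^sup>2)"
      by (simp add: norm_mult)
  qed
qed

lemma square_integrable_cnj: "square_integrable M f \<Longrightarrow> square_integrable M (\<lambda>z. cnj (f z))"
  by (auto simp: square_integrable_def intro: borel_measurable_continuous_on[OF continuous_on_cnj[OF continuous_on_id]])

lemma square_integrable_scale: "square_integrable M f \<Longrightarrow> square_integrable M (\<lambda>z. c * f z)"
  by (auto simp: square_integrable_def norm_mult power_mult_distrib)

lemma cmod_add_power2_le: "(cmod (a + b))\<^sup>2 \<le> 2 * (cmod a)\<^sup>2 + 2 * (cmod b)\<^sup>2"
proof -
  have "(cmod (a + b))\<^sup>2 \<le> (cmod a + cmod b)\<^sup>2"
    by (intro power_mono norm_triangle_ineq) simp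
  also have "\<dots> \<le> 2 * (cmod a)\<^sup>2 + 2 * (cmod b)\<^sup>2"
    using sum_squares_bound[of "cmod a" "cmod b"] by (simp add: power2_sum)
  finally show ?thesis .
qed

lemma square_integrable_add:
  assumes "square_integrable M f" and "square_integrable M g"
  shows "square_integrable M (\<lambda>z. f z + g z)"
proof -
  have "integrable M (\<lambda>z. (cmod (f z + g z))\<^sup>2)"
  proof (rule Bochner_Integration.integrable_bound)
    show "integrable M (\<lambda>z. 2 * (cmod (f z))\<^sup>2 + 2 * (cmod (g z))\<^sup>2)"
      using assms by (simp add: square_integrable_def)
    show "(\<lambda>z. (cmod (f z + g z))\<^sup>2) \<in> borel_measurable M"
      using assms by (auto simp: square_integrable_def)
  qed (auto simp: cmod_add_power2_le)
  then show ?thesis using assms by (auto simp: square_integrable_def)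
qed

lemma square_integrable_diff:
  assumes "square_integrable M f" and "square_integrable M g"
  shows "square_integrable M (\<lambda>z. f z - g z)"
  using square_integrable_add[OF assms(1) square_integrable_scale[OF assms(2), of "-1"]] by simp

lemma square_integrable_cong_AE:
  assumes "square_integrable M f" and "g \<in> borel_measurable M" and "AE z in M. g z = f z"
  shows "square_integrable M g"
proof -
  have "AE z in M. (cmod (g z))\<^sup>2 = (cmod (f z))\<^sup>2" using assms(3) by eventually_elim simp
  then have "integrable M (\<lambda>z. (cmod (g z))\<^sup>2)"
    using assms by (subst integrable_cong_AE[where g = "\<lambda>z. (cmod (f z))\<^sup>2"])
      (auto simp: square_integrable_def)
  then show ?thesis using assms by (auto simp: square_integrable_def)
qed

lemma square_integrable_mult_Linf:
  assumes "\<phi> \<in> Linf_funs M" and "square_integrable M f"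
  shows "square_integrable M (\<lambda>z. \<phi> z * f z)"
proof -
  have m: "\<phi> \<in> borel_measurable M" using assms(1) by (simp add: Linf_funs_def)
  obtain C where C: "AE z in M. cmod (\<phi> z) \<le> C" using assms(1) by (auto simp: Linf_funs_def)
  have "integrable M (\<lambda>z. (cmod (\<phi> z * f z))\<^sup>2)"
  proof (rule Bochner_Integration.integrable_bound)
    show "integrable M (\<lambda>z. C\<^sup>2 * (cmod (f z))\<^sup>2)"
      using assms(2) by (simp add: square_integrable_def)
    show "(\<lambda>z. (cmod (\<phi> z * f z))\<^sup>2) \<in> borel_measurable M"
      using assms(2) m by (auto simp: square_integrable_def)
    show "AE z in M. norm ((cmod (\<phi> z * f z))\<^sup>2) \<le> norm (C\<^sup>2 * (cmod (f z))\<^sup>2)"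
      using C
      by eventually_elim (auto simp: norm_mult power_mult_distrib intro!: mult_right_mono power_mono)
  qed
  then show ?thesis using assms(2) m by (auto simp: square_integrable_def)
qed

lemma Linf_mult_integral_le:
  assumes "\<phi> \<in> Linf_funs M" and "square_integrable M f" and C: "AE z in M. cmod (\<phi> z) \<le> C"
  shows "(LINT z|M. (cmod (\<phi> z * f z))\<^sup>2) \<le> C\<^sup>2 * (LINT z|M. (cmod (f z))\<^sup>2)"
proof -
  have "(LINT z|M. (cmod (\<phi> z * f z))\<^sup>2) \<le> (LINT z|M. C\<^sup>2 * (cmod (f z))\<^sup>2)"
  proof (rule integral_mono_AE)
    show "integrable M (\<lambda>z. (cmod (\<phi> z * f z))\<^sup>2)"
      using square_integrable_mult_Linf[OF assms(1,2)] by (simp add: square_integrable_def)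
    show "integrable M (\<lambda>z. C\<^sup>2 * (cmod (f z))\<^sup>2)"
      using assms(2) by (simp add: square_integrable_def)
    show "AE z in M. (cmod (\<phi> z * f z))\<^sup>2 \<le> C\<^sup>2 * (cmod (f z))\<^sup>2"
      using C by eventually_elim (auto simp: norm_mult power_mult_distrib intro!: mult_right_mono power_mono)
  qed
  then show ?thesis by simp
qed

lemma Cauchy_Schwarz_integral:
  assumes f: "square_integrable M f" and g: "square_integrable M g"
  shows "(LINT z|M. cmod (f z * g z)) \<le> sqrt (LINT z|M. (cmod (f z))\<^sup>2) * sqrt (LINT z|M. (cmod (g z))\<^sup>2)"
proof -
  define A where "A = (LINT z|M. (cmod (f z))\<^sup>2)"
  define B where "B = (LINT z|M. cmod (f z * g z))"
  define C where "C = (LINT z|M. (cmod (g z))\<^sup>2)"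
  have nn: "0 \<le> A" "0 \<le> B" "0 \<le> C" by (auto simp: A_def B_def C_def)
  have i: "integrable M (\<lambda>z. cmod (f z) * cmod (g z))"
    using square_integrable_mult_integrable[OF f g, THEN integrable_norm] by (simp add: norm_mult)
  have q: "0 \<le> A - 2 * t * B + t\<^sup>2 * C" for t
  proof -
    have "0 \<le> (LINT z|M. (cmod (f z) - t * cmod (g z))\<^sup>2)" by simp
    also have "\<dots> = (LINT z|M. (cmod (f z))\<^sup>2 - 2 * t * (cmod (f z) * cmod (g z)) + t\<^sup>2 * (cmod (g z))\<^sup>2)"
      by (rule Bochner_Integration.integral_cong) (auto simp: power2_diff power_mult_distrib algebra_simps)
    also have "\<dots> = A - 2 * t * B + t\<^sup>2 * C"
      using f g i by (simp add: square_integrable_def A_def B_def C_def norm_mult)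
    finally show ?thesis .
  qed
  have "B\<^sup>2 \<le> A * C"
  proof (cases "C = 0")
    case True
    then have "B = 0"
      \<comment> \<open>For C = 0 the polynomial in t is affine, and this t would make it equal to - 1.\<close>
      using q[of "(A + 1) / (2 * B)"] nn by (cases "B = 0") (auto simp: field_simps)
    then show ?thesis using nn by simp
  next
    case False
    \<comment> \<open>The minimum of the quadratic polynomial.\<close>
    then show ?thesis using q[of "B / C"] nn by (simp add: field_simps power2_eq_square)
  qed
  then have "B \<le> sqrt (A * C)" using nn by (simp add: real_le_rsqrt)
  then show ?thesis by (simp add: A_def B_def C_def real_sqrt_mult)
qed

lemma tendsto_L1_of_L2:
  assumes "\<And>n. square_integrable M (f n)" and "square_integrable M g"
    and "(\<lambda>n. LINT z|M. (cmod (f n z))\<^sup>2) \<longlonglongrightarrow> 0"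
  shows "(\<lambda>n. LINT z|M. cmod (f n z * g z)) \<longlonglongrightarrow> 0"
proof (rule tendsto_sandwich)
  show "eventually (\<lambda>n. 0 \<le> (LINT z|M. cmod (f n z * g z))) sequentially" by simp
  show "eventually (\<lambda>n. (LINT z|M. cmod (f n z * g z))
    \<le> sqrt (LINT z|M. (cmod (f n z))\<^sup>2) * sqrt (LINT z|M. (cmod (g z))\<^sup>2)) sequentially"
    using Cauchy_Schwarz_integral[OF assms(1,2)] by simp
  show "(\<lambda>n. sqrt (LINT z|M. (cmod (f n z))\<^sup>2) * sqrt (LINT z|M. (cmod (g z))\<^sup>2)) \<longlonglongrightarrow> 0"
    using tendsto_mult_right[OF tendsto_real_sqrt[OF assms(3)], of "sqrt (LINT z|M. (cmod (g z))\<^sup>2)"] by simp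
qed simp

lemma tendsto_integral_mult_L2:
  assumes f: "\<And>n. square_integrable M (f n)" and h: "square_integrable M h" and g: "square_integrable M g"
    and lim: "(\<lambda>n. LINT z|M. (cmod (f n z - h z))\<^sup>2) \<longlonglongrightarrow> 0"
  shows "(\<lambda>n. LINT z|M. f n z * g z) \<longlonglongrightarrow> (LINT z|M. h z * g z)"
proof -
  have "(\<lambda>n. (LINT z|M. f n z * g z) - (LINT z|M. h z * g z)) \<longlonglongrightarrow> 0"
  proof (rule Lim_null_comparison)
    show "(\<lambda>n. LINT z|M. cmod ((f n z - h z) * g z)) \<longlonglongrightarrow> 0"
      using f h by (intro tendsto_L1_of_L2 g lim square_integrable_diff)
    have "norm ((LINT z|M. f n z * g z) - (LINT z|M. h z * g z)) \<le> (LINT z|M. cmod ((f n z - h z) * g z))" for n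
    proof -
      have "(LINT z|M. f n z * g z) - (LINT z|M. h z * g z) = (LINT z|M. (f n z - h z) * g z)"
        using square_integrable_mult_integrable[OF f g] square_integrable_mult_integrable[OF h g]
        by (simp add: left_diff_distrib)
      then show ?thesis using integral_norm_bound[of M "\<lambda>z. (f n z - h z) * g z"] by simp
    qed
    then show "eventually (\<lambda>n. norm ((LINT z|M. f n z * g z) - (LINT z|M. h z * g z))
      \<le> (LINT z|M. cmod ((f n z - h z) * g z))) sequentially" by simp
  qed
  then show ?thesis by (simp add: LIM_zero_iff)
qed

text \<open>
  A subsequence with differences of \<open>L\<^sup>2\<close> norm at most \<open>2 ^ (- k)\<close> has summable \<open>L\<^sup>1\<close> differences,
  so it converges almost everywhere; Fatou's lemma bounds the distance of the limit to each member
  of the sequence.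
\<close>

lemma L2_complete:
  assumes M: "finite_measure M"
    and s[measurable]: "\<And>n. s n \<in> borel_measurable M"
    and cauchy: "\<And>m n. n \<le> m \<Longrightarrow> (\<integral>\<^sup>+ z. ennreal ((cmod (s m z - s n z))\<^sup>2) \<partial>M) \<le> ennreal (r n)"
    and r: "r \<longlonglongrightarrow> 0"
  obtains f where "f \<in> borel_measurable M"
    and "\<And>n. (\<integral>\<^sup>+ z. ennreal ((cmod (f z - s n z))\<^sup>2) \<partial>M) \<le> ennreal (r n)"
proof -
  interpret finite_measure M by fact
  have "\<exists>N. \<forall>n\<ge>N. r n \<le> (1/4) ^ k" for k
    using order_tendstoD(2)[OF r, of "(1/4)^k"]
    by (auto simp: eventually_sequentially intro: less_imp_le)
  then obtain N where N: "\<And>k n. N k \<le> n \<Longrightarrow> r n \<le> (1/4) ^ k" by metis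
  \<comment> \<open>The sum makes the chosen indices monotone, the summand k makes them unbounded.\<close>
  define L where "L k = (\<Sum>i\<le>k. N i) + k" for k
  have Lk: "N k \<le> L k" "k \<le> L k" "L k \<le> L (Suc k)" for k
    by (auto simp: L_def member_le_sum trans_le_add1)
  define d where "d k z = s (L (Suc k)) z - s (L k) z" for k z
  have dm[measurable]: "d k \<in> borel_measurable M" for k unfolding d_def by measurable
  have d2: "(\<integral>\<^sup>+ z. ennreal ((cmod (d k z))\<^sup>2) \<partial>M) \<le> ennreal ((1/4) ^ k)" for k
    unfolding d_def
    by (rule order_trans[OF cauchy[OF Lk(3)]]) (intro ennreal_leI N Lk)
  have d1: "(\<integral>\<^sup>+ z. ennreal (cmod (d k z)) \<partial>M) \<le> ennreal ((1/2) ^ k * (measure M (space M) + 1))" for k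
  proof -
    \<comment> \<open>Weights for which an integral of the square of order (1/4)^k contributes order (1/2)^k.\<close>
    have "cmod a \<le> (1/2) ^ k + 2 ^ k * (cmod a)\<^sup>2" for a
    proof -
      have "0 \<le> (1/2)^k * (1 - 2 ^ k * cmod a)\<^sup>2" by simp
      also have "\<dots> = (1/2)^k - 2 * cmod a + 2 ^ k * (cmod a)\<^sup>2"
        by (simp add: power2_eq_square algebra_simps power_divide)
      finally show ?thesis by (smt (verit) norm_ge_zero)
    qed
    then have "(\<integral>\<^sup>+ z. ennreal (cmod (d k z)) \<partial>M)
        \<le> (\<integral>\<^sup>+ z. ennreal ((1/2) ^ k) + ennreal (2 ^ k) * ennreal ((cmod (d k z))\<^sup>2) \<partial>M)"
      by (intro nn_integral_mono) (simp add: ennreal_plus[symmetric] ennreal_mult[symmetric] del: ennreal_plus)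
    also have "\<dots> = ennreal ((1/2) ^ k) * emeasure M (space M) + ennreal (2 ^ k) * (\<integral>\<^sup>+ z. ennreal ((cmod (d k z))\<^sup>2) \<partial>M)"
      by (subst nn_integral_add) (auto simp: nn_integral_cmult)
    also have "\<dots> \<le> ennreal ((1/2) ^ k) * emeasure M (space M) + ennreal (2 ^ k) * ennreal ((1/4) ^ k)"
      by (intro add_left_mono mult_left_mono d2) auto
    also have "\<dots> = ennreal ((1/2) ^ k * (measure M (space M) + 1))"
      by (simp add: emeasure_eq_measure ennreal_mult[symmetric] ennreal_plus[symmetric]
          power_mult_distrib[symmetric] algebra_simps del: ennreal_plus)
    finally show ?thesis .
  qed
  have "(\<integral>\<^sup>+ z. (\<Sum>k. ennreal (cmod (d k z))) \<partial>M) = (\<Sum>k. \<integral>\<^sup>+ z. ennreal (cmod (d k z)) \<partial>M)"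
    by (rule nn_integral_suminf) measurable
  also have "\<dots> \<le> (\<Sum>k. ennreal ((1/2) ^ k * (measure M (space M) + 1)))"
    by (intro suminf_le d1) auto
  also have "\<dots> = ennreal (\<Sum>k. (1/2) ^ k * (measure M (space M) + 1))"
    by (intro suminf_ennreal2 summable_mult2 summable_geometric) auto
  finally have "(\<integral>\<^sup>+ z. (\<Sum>k. ennreal (cmod (d k z))) \<partial>M) \<noteq> \<infinity>"
    by (auto simp: top_unique)
  then have "AE z in M. (\<Sum>k. ennreal (cmod (d k z))) \<noteq> \<infinity>"
    by (rule nn_integral_noteq_infinite[rotated]) measurable
  then have conv: "AE z in M. convergent (\<lambda>k. s (L k) z)"
  proof eventually_elim
    fix z assume "(\<Sum>k. ennreal (cmod (d k z))) \<noteq> \<infinity>"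
    then have "summable (\<lambda>k. cmod (d k z))"
      by (intro summable_suminf_not_top) auto
    then have "summable (\<lambda>k. d k z)" by (rule summable_norm_cancel)
    then have "(\<lambda>n. \<Sum>k<n. d k z) \<longlonglongrightarrow> (\<Sum>k. d k z)" by (rule summable_LIMSEQ)
    then have "(\<lambda>n. s (L 0) z + (\<Sum>k<n. d k z)) \<longlonglongrightarrow> s (L 0) z + (\<Sum>k. d k z)"
      by (intro tendsto_intros)
    moreover have "s (L 0) z + (\<Sum>k<n. d k z) = s (L n) z" for n
      using sum_lessThan_telescope[of "\<lambda>k. s (L k) z" n] by (simp add: d_def)
    ultimately show "convergent (\<lambda>k. s (L k) z)" by (auto simp: convergent_def)
  qed
  define f where "f z = lim (\<lambda>k. s (L k) z)" for z
  have fm[measurable]: "f \<in> borel_measurable M"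
    unfolding f_def by (rule borel_measurable_lim_metric) measurable
  show thesis
  proof
    fix n
    have "(\<integral>\<^sup>+ z. ennreal ((cmod (f z - s n z))\<^sup>2) \<partial>M)
        = (\<integral>\<^sup>+ z. liminf (\<lambda>k. ennreal ((cmod (s (L k) z - s n z))\<^sup>2)) \<partial>M)"
    proof (rule nn_integral_cong_AE)
      show "AE z in M. ennreal ((cmod (f z - s n z))\<^sup>2) = liminf (\<lambda>k. ennreal ((cmod (s (L k) z - s n z))\<^sup>2))"
        using conv
      proof eventually_elim
        fix z assume "convergent (\<lambda>k. s (L k) z)"
        then have "(\<lambda>k. s (L k) z) \<longlonglongrightarrow> f z" by (simp add: f_def convergent_LIMSEQ_iff)
        then have "(\<lambda>k. ennreal ((cmod (s (L k) z - s n z))\<^sup>2)) \<longlonglongrightarrow> ennreal ((cmod (f z - s n z))\<^sup>2)"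
          by (intro tendsto_intros tendsto_ennrealI)
        then show "ennreal ((cmod (f z - s n z))\<^sup>2) = liminf (\<lambda>k. ennreal ((cmod (s (L k) z - s n z))\<^sup>2))"
          by (rule lim_imp_Liminf[OF sequentially_bot, symmetric])
      qed
    qed
    also have "\<dots> \<le> liminf (\<lambda>k. \<integral>\<^sup>+ z. ennreal ((cmod (s (L k) z - s n z))\<^sup>2) \<partial>M)"
      by (rule nn_integral_liminf) measurable
    also have "\<dots> \<le> ennreal (r n)"
    proof -
      have "eventually (\<lambda>k. (\<integral>\<^sup>+ z. ennreal ((cmod (s (L k) z - s n z))\<^sup>2) \<partial>M) \<le> ennreal (r n)) sequentially"
        using eventually_ge_at_top[of n] by eventually_elim (rule cauchy, meson Lk(2) le_trans)
      then have "liminf (\<lambda>k. \<integral>\<^sup>+ z. ennreal ((cmod (s (L k) z - s n z))\<^sup>2) \<partial>M) \<le> liminf (\<lambda>k::nat. ennreal (r n))"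
        by (rule Liminf_mono)
      then show ?thesis by (simp add: Liminf_const)
    qed
    finally show "(\<integral>\<^sup>+ z. ennreal ((cmod (f z - s n z))\<^sup>2) \<partial>M) \<le> ennreal (r n)" .
  qed (rule fm)
qed

section \<open>Fourier series of square-integrable functions\<close>

abbreviation L2_circle :: "(complex \<Rightarrow> complex) \<Rightarrow> bool" where
  "L2_circle \<equiv> square_integrable circle_haar"

definition fourier_coeff :: "(complex \<Rightarrow> complex) \<Rightarrow> int \<Rightarrow> complex" where
  "fourier_coeff f n = (LINT z|circle_haar. f z * z powi (- n))"

definition trig_sum :: "int set \<Rightarrow> (int \<Rightarrow> complex) \<Rightarrow> complex \<Rightarrow> complex" where
  "trig_sum S c z = (\<Sum>n\<in>S. c n * z powi n)"

lemma Linf_powi: "(\<lambda>z. z powi n) \<in> Linf_funs circle_haar"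
  by (auto simp: Linf_funs_def space_circle_haar norm_power_int intro!: exI[of _ 1] AE_I2)

lemma L2_circle_const: "L2_circle (\<lambda>_. c)"
  using finite_measure.integrable_const[OF finite_circle_haar] by (simp add: square_integrable_def)

lemma L2_circle_Linf: "\<phi> \<in> Linf_funs circle_haar \<Longrightarrow> L2_circle \<phi>"
  using square_integrable_mult_Linf[OF _ L2_circle_const[of 1]] by simp

lemmas L2_circle_powi = L2_circle_Linf[OF Linf_powi]

lemma L2_circle_integrable: "L2_circle f \<Longrightarrow> integrable circle_haar f"
  using square_integrable_mult_integrable[OF _ L2_circle_const[of 1]] by simp

lemma L2_circle_trig_sum: "finite S \<Longrightarrow> L2_circle (trig_sum S c)"
  unfolding trig_sum_def[abs_def]
proof (induction S rule: finite_induct)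
  case empty
  then show ?case using L2_circle_const[of 0] by simp
next
  case (insert x F)
  then show ?case
    using square_integrable_add[OF square_integrable_scale[OF L2_circle_powi, of "c x" x] insert.IH]
    by (simp add: insert.hyps)
qed

lemma integral_trig_sum_mult:
  assumes "finite S" and "L2_circle h"
  shows "(LINT z|circle_haar. trig_sum S c z * h z) = (\<Sum>n\<in>S. c n * (LINT z|circle_haar. z powi n * h z))"
proof -
  have "(LINT z|circle_haar. trig_sum S c z * h z) = (LINT z|circle_haar. (\<Sum>n\<in>S. c n * (z powi n * h z)))"
    by (simp add: trig_sum_def sum_distrib_right mult.assoc)
  also have "\<dots> = (\<Sum>n\<in>S. (LINT z|circle_haar. c n * (z powi n * h z)))"
    using assms square_integrable_mult_integrable[OF L2_circle_powi]
    by (intro Bochner_Integration.integral_sum) auto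
  finally show ?thesis by simp
qed

lemma fourier_coeff_powi: "fourier_coeff (\<lambda>z. z powi n) m = (if n = m then 1 else 0)"
proof -
  have "fourier_coeff (\<lambda>z. z powi n) m = (LINT z|circle_haar. z powi (n - m))"
    unfolding fourier_coeff_def
  proof (rule Bochner_Integration.integral_cong[OF refl])
    fix z assume "z \<in> space circle_haar"
    then have "z \<noteq> 0" by (auto simp: space_circle_haar)
    then show "z powi n * z powi - m = z powi (n - m)"
      by (simp add: power_int_diff power_int_minus divide_inverse)
  qed
  then show ?thesis by (simp add: circle_haar_moment)
qed

lemma fourier_coeff_trig_sum:
  assumes "finite S"
  shows "fourier_coeff (trig_sum S c) m = (if m \<in> S then c m else 0)"
proof -
  have "fourier_coeff (trig_sum S c) m = (\<Sum>n\<in>S. c n * fourier_coeff (\<lambda>z. z powi n) m)"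
    unfolding fourier_coeff_def using assms by (rule integral_trig_sum_mult) (rule L2_circle_powi)
  then show ?thesis using assms by (simp add: fourier_coeff_powi if_distrib cong: if_cong)
qed

lemma integral_mult_cnj_powi:
  "(LINT z|circle_haar. f z * cnj (z powi n)) = fourier_coeff f n"
  unfolding fourier_coeff_def
  by (rule Bochner_Integration.integral_cong) (simp_all only: space_circle_haar cnj_powi_circle)

lemma integral_powi_mult_cnj:
  "(LINT z|circle_haar. z powi n * cnj (f z)) = cnj (fourier_coeff f n)"
  unfolding integral_mult_cnj_powi[symmetric]
  by (subst Bochner_Integration.integral_cnj[symmetric]) (simp add: mult.commute)

lemma integral_trig_sum_mult_cnj:
  assumes "finite S" and "L2_circle h"
  shows "(LINT z|circle_haar. trig_sum S c z * cnj (h z)) = (\<Sum>n\<in>S. c n * cnj (fourier_coeff h n))"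
  using integral_trig_sum_mult[OF assms(1) square_integrable_cnj[OF assms(2)], of c]
  by (simp add: integral_powi_mult_cnj)

lemma integral_norm_trig_sum:
  assumes "finite S"
  shows "(LINT z|circle_haar. (cmod (trig_sum S c z))\<^sup>2) = (\<Sum>n\<in>S. (cmod (c n))\<^sup>2)"
proof -
  have "complex_of_real (LINT z|circle_haar. (cmod (trig_sum S c z))\<^sup>2)
      = (LINT z|circle_haar. trig_sum S c z * cnj (trig_sum S c z))"
    by (simp only: complex_norm_square[symmetric] integral_complex_of_real)
  also have "\<dots> = (\<Sum>n\<in>S. c n * cnj (c n))"
    by (subst integral_trig_sum_mult_cnj[OF assms L2_circle_trig_sum[OF assms]])
       (simp add: fourier_coeff_trig_sum assms)
  also have "\<dots> = complex_of_real (\<Sum>n\<in>S. (cmod (c n))\<^sup>2)"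
    by (simp only: complex_norm_square of_real_sum)
  finally show ?thesis by (simp only: of_real_eq_iff)
qed

lemma filterlim_int_intervals:
  "filterlim (\<lambda>N::nat. {- int N..int N}) (finite_subsets_at_top UNIV) sequentially"
  unfolding filterlim_finite_subsets_at_top
proof safe
  fix X :: "int set" assume "finite X"
  then have fin: "finite ((\<lambda>x. nat \<bar>x\<bar>) ` X)" by simp
  show "\<forall>\<^sub>F N in sequentially. finite {- int N..int N} \<and> X \<subseteq> {- int N..int N} \<and> {- int N..int N} \<subseteq> UNIV"
    using eventually_ge_at_top[of "Max (insert 0 ((\<lambda>x. nat \<bar>x\<bar>) ` X))"]
  proof eventually_elim
    fix N assume N: "Max (insert 0 ((\<lambda>x. nat \<bar>x\<bar>) ` X)) \<le> N"
    have "nat \<bar>x\<bar> \<le> N" if "x \<in> X" for x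
      using N Max_ge[of "insert 0 ((\<lambda>x. nat \<bar>x\<bar>) ` X)" "nat \<bar>x\<bar>"] fin that by auto
    then show "finite {- int N..int N} \<and> X \<subseteq> {- int N..int N} \<and> {- int N..int N} \<subseteq> UNIV"
      by force
  qed
qed

lemma has_sum_int_tendsto:
  fixes f :: "int \<Rightarrow> 'a::{comm_monoid_add, topological_space}"
  assumes "(f has_sum s) UNIV"
  shows "(\<lambda>N. \<Sum>n\<in>{- int N..int N}. f n) \<longlonglongrightarrow> s"
  using filterlim_compose[OF assms[unfolded has_sum_def] filterlim_int_intervals] .

text \<open>
  The symmetric partial sums are Cauchy, with the tails of the series of squares as rate, and
  \<open>L\<^sup>2\<close> is complete.
\<close>

lemma Riesz_Fischer:
  assumes x: "(\<lambda>n. (cmod (x n))\<^sup>2) summable_on UNIV"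
  obtains f where "L2_circle f"
    and "(\<lambda>N. LINT z|circle_haar. (cmod (trig_sum {- int N..int N} x z - f z))\<^sup>2) \<longlonglongrightarrow> 0"
proof -
  define s where "s N = trig_sum {- int N..int N} x" for N
  define r where "r N = (\<Sum>\<^sub>\<infinity>n. (cmod (x n))\<^sup>2) - (\<Sum>n\<in>{- int N..int N}. (cmod (x n))\<^sup>2)" for N
  have r0: "r \<longlonglongrightarrow> 0"
    using tendsto_diff[OF tendsto_const[of "\<Sum>\<^sub>\<infinity>n. (cmod (x n))\<^sup>2"] has_sum_int_tendsto[OF has_sum_infsum[OF x]]]
    by (simp add: r_def[abs_def])
  have s: "L2_circle (s N)" for N unfolding s_def by (rule L2_circle_trig_sum) simp
  have cauchy: "(\<integral>\<^sup>+ z. ennreal ((cmod (s m z - s n z))\<^sup>2) \<partial>circle_haar) \<le> ennreal (r n)" if "n \<le> m" for m n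
  proof -
    define D where "D = {- int m..int m} - {- int n..int n}"
    have D: "{- int m..int m} = D \<union> {- int n..int n}" "D \<inter> {- int n..int n} = {}" "finite D"
      using that by (auto simp: D_def)
    have "s m z - s n z = trig_sum D x z" for z
      unfolding s_def trig_sum_def D(1) using D by (subst sum.union_disjoint) auto
    then have "(\<integral>\<^sup>+ z. ennreal ((cmod (s m z - s n z))\<^sup>2) \<partial>circle_haar)
        = ennreal (\<Sum>n\<in>D. (cmod (x n))\<^sup>2)"
      using square_integrable_norm[OF L2_circle_trig_sum[OF D(3)], of x] integral_norm_trig_sum[OF D(3), of x]
      by (simp add: nn_integral_eq_integral)
    also have "(\<Sum>n\<in>D. (cmod (x n))\<^sup>2) \<le> r n"
    proof -
      have "(\<Sum>n\<in>D \<union> {- int n..int n}. (cmod (x n))\<^sup>2) \<le> (\<Sum>\<^sub>\<infinity>n. (cmod (x n))\<^sup>2)"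
        using x D by (intro finite_sum_le_infsum) auto
      then show ?thesis unfolding r_def using D by (subst (asm) sum.union_disjoint) auto
    qed
    finally show ?thesis by (simp add: ennreal_leI)
  qed
  obtain f where f: "f \<in> borel_measurable circle_haar"
    and fs: "\<And>n. (\<integral>\<^sup>+ z. ennreal ((cmod (f z - s n z))\<^sup>2) \<partial>circle_haar) \<le> ennreal (r n)"
    using L2_complete[OF finite_circle_haar square_integrable_measurable[OF s] cauchy r0] by metis
  have d: "L2_circle (\<lambda>z. f z - s n z)" for n
  proof -
    have m: "(\<lambda>z. f z - s n z) \<in> borel_measurable circle_haar"
      using f square_integrable_measurable[OF s] by simp
    have "integrable circle_haar (\<lambda>z. (cmod (f z - s n z))\<^sup>2)"
      using m le_less_trans[OF fs[of n]] by (intro integrableI_bounded) auto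
    then show ?thesis using m by (simp add: square_integrable_def)
  qed
  have "L2_circle f" using square_integrable_add[OF d s, of 0 0] by simp
  moreover have "(\<lambda>N. LINT z|circle_haar. (cmod (s N z - f z))\<^sup>2) \<longlonglongrightarrow> 0"
  proof (rule tendsto_sandwich[OF _ _ tendsto_const r0])
    have "(LINT z|circle_haar. (cmod (s N z - f z))\<^sup>2) \<le> r N" for N
    proof -
      have "ennreal (LINT z|circle_haar. (cmod (f z - s N z))\<^sup>2) \<le> ennreal (r N)"
        using fs[of N] square_integrable_norm[OF d, of N] by (subst nn_integral_eq_integral[symmetric]) auto
      moreover have "0 \<le> r N"
        unfolding r_def using finite_sum_le_infsum[OF x, of "{- int N..int N}"] by simp
      ultimately show ?thesis by (simp add: norm_minus_commute)
    qed
    then show "\<forall>\<^sub>F N in sequentially. (LINT z|circle_haar. (cmod (s N z - f z))\<^sup>2) \<le> r N" by simp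
  qed simp
  ultimately show thesis using that by (simp add: s_def)
qed

text \<open>
  Each coefficient is a continuous functional on \<open>L\<^sup>2\<close>, and that of the partial sums is eventually
  constant.
\<close>

lemma fourier_coeff_limit:
  assumes f: "L2_circle f"
    and lim: "(\<lambda>N. LINT z|circle_haar. (cmod (trig_sum {- int N..int N} x z - f z))\<^sup>2) \<longlonglongrightarrow> 0"
  shows "fourier_coeff f = x"
proof
  fix m
  have "(\<lambda>N. fourier_coeff (trig_sum {- int N..int N} x) m) \<longlonglongrightarrow> fourier_coeff f m"
    unfolding fourier_coeff_def
    by (rule tendsto_integral_mult_L2[OF L2_circle_trig_sum f L2_circle_powi lim]) simp
  moreover have "\<forall>\<^sub>F N in sequentially. fourier_coeff (trig_sum {- int N..int N} x) m = x m"
    using eventually_ge_at_top[of "nat \<bar>m\<bar>"] by eventually_elim (auto simp: fourier_coeff_trig_sum)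
  then have "(\<lambda>N. fourier_coeff (trig_sum {- int N..int N} x) m) \<longlonglongrightarrow> x m"
    by (rule tendsto_eventually)
  ultimately show "fourier_coeff f m = x m" by (rule LIMSEQ_unique)
qed

lemma fourier_coeff_unique:
  assumes f: "integrable circle_haar f" and g: "integrable circle_haar g"
    and eq: "\<And>n. fourier_coeff f n = fourier_coeff g n"
  shows "AE z in circle_haar. f z = g z"
proof -
  have i: "integrable circle_haar (\<lambda>z. h z * z powi n)" if h: "integrable circle_haar h" for h n
  proof (rule Bochner_Integration.integrable_bound[OF h])
    show "(\<lambda>z. h z * z powi n) \<in> borel_measurable circle_haar" using h by measurable
    show "AE z in circle_haar. norm (h z * z powi n) \<le> norm (h z)"
      by (rule AE_I2) (auto simp: space_circle_haar norm_power_int norm_mult)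
  qed
  have "AE z in circle_haar. f z - g z = 0"
  proof (rule circle_integral_unique)
    show "integrable circle_haar (\<lambda>z. f z - g z)" using f g by simp
    show "(LINT z|circle_haar. (f z - g z) * z powi n) = 0" for n
      using eq[of "-n"] i[OF f] i[OF g] by (simp add: fourier_coeff_def left_diff_distrib)
  qed
  then show ?thesis by simp
qed

lemma Bessel_summable:
  assumes f: "L2_circle f"
  shows "(\<lambda>n. (cmod (fourier_coeff f n))\<^sup>2) summable_on UNIV"
proof (rule nonneg_bdd_above_summable_on)
  show "bdd_above (sum (\<lambda>n. (cmod (fourier_coeff f n))\<^sup>2) ` {F. F \<subseteq> UNIV \<and> finite F})"
  proof (rule bdd_aboveI2)
    fix S :: "int set" assume "S \<in> {F. F \<subseteq> UNIV \<and> finite F}"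
    then have S: "finite S" by simp
    define s where "s = trig_sum S (fourier_coeff f)"
    have s: "L2_circle s" unfolding s_def using S by (rule L2_circle_trig_sum)
    have i: "integrable circle_haar (\<lambda>z. s z * cnj (f z))"
      by (rule square_integrable_mult_integrable[OF s square_integrable_cnj[OF f]])
    have "(LINT z|circle_haar. s z * cnj (f z)) = of_real (\<Sum>n\<in>S. (cmod (fourier_coeff f n))\<^sup>2)"
      unfolding s_def by (simp only: integral_trig_sum_mult_cnj[OF S f] complex_norm_square of_real_sum)
    then have re: "(LINT z|circle_haar. Re (s z * cnj (f z))) = (\<Sum>n\<in>S. (cmod (fourier_coeff f n))\<^sup>2)"
      using integral_Re[OF i] by (simp only: Re_complex_of_real)
    have "0 \<le> (LINT z|circle_haar. (cmod (f z - s z))\<^sup>2)" by simp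
    also have "\<dots> = (LINT z|circle_haar. (cmod (f z))\<^sup>2 - 2 * Re (s z * cnj (f z)) + (cmod (s z))\<^sup>2)"
      by (rule Bochner_Integration.integral_cong[OF refl])
         (simp only: cmod_power2, simp add: power2_eq_square algebra_simps)
    also have "\<dots> = (LINT z|circle_haar. (cmod (f z))\<^sup>2) - (\<Sum>n\<in>S. (cmod (fourier_coeff f n))\<^sup>2)"
      using square_integrable_norm[OF f] square_integrable_norm[OF s] i integrable_Re[OF i]
      by (simp del: times_complex.simps complex_cnj Re_complex_of_real add: re s_def[symmetric])
         (simp add: s_def integral_norm_trig_sum[OF S])
    finally show "(\<Sum>n\<in>S. (cmod (fourier_coeff f n))\<^sup>2) \<le> (LINT z|circle_haar. (cmod (f z))\<^sup>2)" by simp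
  qed
qed simp

text \<open>
  By Riesz-Fischer the Fourier series has some limit in \<open>L\<^sup>2\<close>. It has the same coefficients as the
  given function, hence equals it.
\<close>

lemma fourier_series_converges:
  assumes f: "L2_circle f"
  shows "(\<lambda>N. LINT z|circle_haar. (cmod (trig_sum {- int N..int N} (fourier_coeff f) z - f z))\<^sup>2) \<longlonglongrightarrow> 0"
proof -
  obtain g where g: "L2_circle g"
    and lim: "(\<lambda>N. LINT z|circle_haar. (cmod (trig_sum {- int N..int N} (fourier_coeff f) z - g z))\<^sup>2) \<longlonglongrightarrow> 0"
    using Riesz_Fischer[OF Bessel_summable[OF f]] by blast
  have ae: "AE z in circle_haar. f z = g z"
    using fourier_coeff_limit[OF g lim]
    by (intro fourier_coeff_unique L2_circle_integrable f g) simp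
  have "(LINT z|circle_haar. (cmod (trig_sum {- int N..int N} (fourier_coeff f) z - f z))\<^sup>2)
      = (LINT z|circle_haar. (cmod (trig_sum {- int N..int N} (fourier_coeff f) z - g z))\<^sup>2)" for N
  proof (rule integral_cong_AE)
    show "AE z in circle_haar. (cmod (trig_sum {- int N..int N} (fourier_coeff f) z - f z))\<^sup>2
      = (cmod (trig_sum {- int N..int N} (fourier_coeff f) z - g z))\<^sup>2"
      using ae by eventually_elim simp
  qed (use square_integrable_measurable[OF f] square_integrable_measurable[OF g]
        square_integrable_measurable[OF L2_circle_trig_sum] in simp_all)
  then show ?thesis using lim by simp
qed

lemma summable_on_mult_l2:
  fixes x y :: "'a \<Rightarrow> complex"
  assumes "(\<lambda>n. (cmod (x n))\<^sup>2) summable_on A" and "(\<lambda>n. (cmod (y n))\<^sup>2) summable_on A"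
  shows "(\<lambda>n. x n * y n) summable_on A"
proof (rule abs_summable_summable, rule summable_on_comparison_test)
  show "(\<lambda>n. (cmod (x n))\<^sup>2 + (cmod (y n))\<^sup>2) summable_on A"
    using assms by (rule summable_on_add)
  fix n
  show "norm (x n * y n) \<le> (cmod (x n))\<^sup>2 + (cmod (y n))\<^sup>2"
  proof -
    have "2 * (cmod (x n) * cmod (y n)) \<le> (cmod (x n))\<^sup>2 + (cmod (y n))\<^sup>2"
      using sum_squares_bound[of "cmod (x n)" "cmod (y n)"] by simp
    moreover have "0 \<le> cmod (x n) * cmod (y n)" by simp
    ultimately show ?thesis unfolding norm_mult by linarith
  qed
qed simp

proposition Parseval:
  assumes f: "L2_circle f" and h: "L2_circle h"
  shows "((\<lambda>n. fourier_coeff f n * cnj (fourier_coeff h n)) has_sum (LINT z|circle_haar. f z * cnj (h z))) UNIV"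
proof -
  have "(\<lambda>n. fourier_coeff f n * cnj (fourier_coeff h n)) summable_on UNIV"
    using Bessel_summable[OF f] Bessel_summable[OF h] by (intro summable_on_mult_l2) auto
  then have hs: "((\<lambda>n. fourier_coeff f n * cnj (fourier_coeff h n)) has_sum
      (\<Sum>\<^sub>\<infinity>n. fourier_coeff f n * cnj (fourier_coeff h n))) UNIV" by (rule has_sum_infsum)
  have "(\<lambda>N. LINT z|circle_haar. trig_sum {- int N..int N} (fourier_coeff f) z * cnj (h z))
      \<longlonglongrightarrow> (LINT z|circle_haar. f z * cnj (h z))"
    by (rule tendsto_integral_mult_L2[OF L2_circle_trig_sum f square_integrable_cnj[OF h] fourier_series_converges[OF f]]) simp
  then have "(\<lambda>N. \<Sum>n\<in>{- int N..int N}. fourier_coeff f n * cnj (fourier_coeff h n))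
      \<longlonglongrightarrow> (LINT z|circle_haar. f z * cnj (h z))"
    by (simp add: integral_trig_sum_mult_cnj[OF _ h])
  then have "(\<Sum>\<^sub>\<infinity>n. fourier_coeff f n * cnj (fourier_coeff h n)) = (LINT z|circle_haar. f z * cnj (h z))"
    using has_sum_int_tendsto[OF hs] by (rule LIMSEQ_unique[rotated])
  then show ?thesis using hs by simp
qed

lemma fourier_coeff_mult_powi:
  "fourier_coeff (\<lambda>z. z powi k * f z) n = fourier_coeff f (n - k)"
  unfolding fourier_coeff_def
proof (rule Bochner_Integration.integral_cong[OF refl])
  fix z assume "z \<in> space circle_haar"
  then have "z \<noteq> 0" by (auto simp: space_circle_haar)
  then show "z powi k * f z * z powi - n = f z * z powi - (n - k)"
    by (simp add: power_int_diff power_int_minus field_simps)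
qed

text \<open>
  This convolution formula is Parseval's identity for \<open>g\<close> and \<open>z\<^sup>n\<close> times the conjugate of \<open>\<phi>\<close>.
  It describes the operator of multiplication by \<open>\<phi>\<close> in the basis of characters of the circle.
\<close>

lemma fourier_coeff_mult_Linf:
  assumes \<phi>: "\<phi> \<in> Linf_funs circle_haar" and g: "L2_circle g"
  shows "((\<lambda>m. fourier_coeff g m * fourier_coeff \<phi> (n - m)) has_sum fourier_coeff (\<lambda>z. \<phi> z * g z) n) UNIV"
proof -
  define h where "h z = z powi n * cnj (\<phi> z)" for z
  have h: "L2_circle h"
    unfolding h_def
    by (rule square_integrable_mult_Linf[OF Linf_powi square_integrable_cnj[OF L2_circle_Linf[OF \<phi>]]])
  have "cnj (fourier_coeff h m) = fourier_coeff \<phi> (n - m)" for m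
  proof -
    have "cnj (fourier_coeff h m) = (LINT z|circle_haar. z powi m * cnj (h z))"
      by (simp only: integral_powi_mult_cnj)
    also have "\<dots> = fourier_coeff \<phi> (n - m)"
      unfolding fourier_coeff_def h_def
    proof (rule Bochner_Integration.integral_cong[OF refl])
      fix z assume "z \<in> space circle_haar"
      then have z: "z \<in> sphere 0 1" by (simp add: space_circle_haar)
      then have "z \<noteq> 0" by auto
      then show "z powi m * cnj (z powi n * cnj (\<phi> z)) = \<phi> z * z powi - (n - m)"
        by (simp only: complex_cnj_mult cnj_powi_circle[OF z] complex_cnj_cnj)
           (simp add: power_int_diff power_int_minus field_simps)
    qed
    finally show ?thesis .
  qed
  moreover have "(LINT z|circle_haar. g z * cnj (h z)) = fourier_coeff (\<lambda>z. \<phi> z * g z) n"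
    unfolding fourier_coeff_def h_def
    by (rule Bochner_Integration.integral_cong[OF refl])
       (simp only: complex_cnj_mult cnj_powi_circle space_circle_haar complex_cnj_cnj mult_ac)
  ultimately show ?thesis using Parseval[OF g h] by simp
qed

section \<open>Functions of a power of the variable\<close>

lemma L2_circle_power:
  assumes "L2_circle f" and "0 < p"
  shows "L2_circle (\<lambda>z. f (z ^ p))"
proof -
  have "integrable (distr circle_haar circle_haar (\<lambda>z. z ^ p)) (\<lambda>z. (cmod (f z))\<^sup>2)"
    using assms by (simp add: power_preserves_circle_haar square_integrable_def)
  then have "integrable circle_haar (\<lambda>z. (cmod (f (z ^ p)))\<^sup>2)"
    by (rule integrable_distr[OF power_measurable_circle])
  moreover have "(\<lambda>z. f (z ^ p)) \<in> borel_measurable circle_haar"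
    using measurable_compose[OF power_measurable_circle square_integrable_measurable[OF assms(1)]] .
  ultimately show ?thesis by (simp add: square_integrable_def)
qed

lemma AE_circle_power_iff:
  assumes "0 < p" and "{z \<in> sphere 0 1. P z} \<in> sets circle_haar"
  shows "(AE z in circle_haar. P (z ^ p)) \<longleftrightarrow> (AE z in circle_haar. P z)"
  using AE_distr_iff[OF power_measurable_circle, of P p] assms
  unfolding power_preserves_circle_haar[OF assms(1)] by (simp add: space_circle_haar)

lemma Linf_power:
  assumes "f \<in> Linf_funs circle_haar" and "0 < p"
  shows "(\<lambda>z. f (z ^ p)) \<in> Linf_funs circle_haar"
proof -
  have f[measurable]: "f \<in> borel_measurable circle_haar" using assms(1) by (simp add: Linf_funs_def)
  obtain C where C: "AE z in circle_haar. cmod (f z) \<le> C" using assms(1) by (auto simp: Linf_funs_def)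
  have "{z \<in> space circle_haar. cmod (f z) \<le> C} \<in> sets circle_haar" by measurable
  then have "AE z in circle_haar. cmod (f (z ^ p)) \<le> C"
    using C AE_circle_power_iff[OF assms(2), of "\<lambda>z. cmod (f z) \<le> C"] by (simp add: space_circle_haar)
  then show ?thesis
    using measurable_compose[OF power_measurable_circle f] by (auto simp: Linf_funs_def)
qed

text \<open>
  For indices divisible by \<open>p\<close> the power map, which preserves Haar measure, transports the integral.
  The function \<open>f (z ^ p)\<close> is invariant under rotation by a primitive \<open>p\<close>-th root of unity \<open>w\<close>, so
  its \<open>n\<close>-th coefficient equals itself times \<open>w ^ (- n)\<close>; this factor differs from 1 for the other
  indices.
\<close>

lemma fourier_coeff_power:
  assumes f: "L2_circle f" and p: "0 < p"
  shows "fourier_coeff (\<lambda>z. f (z ^ p)) n = (if int p dvd n then fourier_coeff f (n div int p) else 0)"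
proof (cases "int p dvd n")
  case True
  then obtain k where k: "n = int p * k" by blast
  have "fourier_coeff f k = (LINT z|distr circle_haar circle_haar (\<lambda>z. z ^ p). f z * z powi (- k))"
    by (simp add: fourier_coeff_def power_preserves_circle_haar p)
  also have "\<dots> = (LINT z|circle_haar. f (z ^ p) * (z ^ p) powi (- k))"
    by (rule integral_distr[OF power_measurable_circle borel_measurable_times[OF square_integrable_measurable[OF f] powi_measurable_circle]])
  also have "\<dots> = fourier_coeff (\<lambda>z. f (z ^ p)) n"
  proof -
    have "(z ^ p) powi (- k) = z powi (- (int p * k))" for z :: complex
      using power_int_mult[of z "int p" "- k"] by simp
    then show ?thesis by (simp only: fourier_coeff_def k)
  qed
  finally show ?thesis using True p k by simp
next
  case False
  define w where "w = cis (2 * pi / real p)"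
  have w: "cmod w = 1" "w ^ p = 1" "w \<noteq> 0"
    using p by (auto simp: w_def Complex.DeMoivre)
  have wn: "w powi (- n) \<noteq> 1"
  proof
    assume "w powi (- n) = 1"
    then have "w powi n = 1" by (simp add: power_int_minus)
    then have "cis (of_int n * (2 * pi / real p)) = 1"
      by (simp only: w_def cis_power_int)
    then have "exp (\<i> * complex_of_real (of_int n * (2 * pi / real p))) = 1"
      by (simp only: cis_conv_exp)
    then have "\<exists>k::int. of_int n * (2 * pi / real p) = of_int (2 * k) * pi"
      unfolding exp_eq_1 by (simp only: Im_i_times Re_complex_of_real)
    then obtain k :: int where "of_int n * (2 * pi / real p) = of_int (2 * k) * pi" ..
    then have "real_of_int n = real_of_int (int p * k)" using p by (simp add: field_simps)
    then have "n = int p * k" by (simp only: of_int_eq_iff)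
    then show False using False by simp
  qed
  note rm = rotation_measurable_circle[OF w(1)]
  have "fourier_coeff (\<lambda>z. f (z ^ p)) n
      = (LINT z|distr circle_haar circle_haar (\<lambda>z. w * z). f (z ^ p) * z powi (- n))"
    by (simp add: fourier_coeff_def rotation_preserves_circle_haar w)
  also have "\<dots> = (LINT z|circle_haar. f ((w * z) ^ p) * (w * z) powi (- n))"
    by (rule integral_distr[OF rm borel_measurable_times[OF square_integrable_measurable[OF L2_circle_power[OF f p]] powi_measurable_circle]])
  also have "\<dots> = (LINT z|circle_haar. w powi (- n) * (f (z ^ p) * z powi (- n)))"
    by (rule Bochner_Integration.integral_cong)
       (simp_all only: power_mult_distrib w mult_1 power_int_mult_distrib mult_ac)
  also have "\<dots> = w powi (- n) * fourier_coeff (\<lambda>z. f (z ^ p)) n"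
    by (simp only: fourier_coeff_def integral_mult_right_zero)
  finally have "fourier_coeff (\<lambda>z. f (z ^ p)) n = 0" using wn by simp
  then show ?thesis using False by simp
qed

text \<open>
  The coefficients on the multiples of \<open>p\<close> are square-summable, so they are the coefficients of some
  \<open>f\<close> in \<open>L\<^sup>2\<close>, and \<open>\<phi>\<close> and \<open>f (z ^ p)\<close> have the same Fourier series. The bound passes from
  \<open>f (z ^ p)\<close> to \<open>f\<close> because the power map preserves Haar measure.
\<close>

lemma Linf_function_of_power:
  assumes \<phi>: "\<phi> \<in> Linf_funs circle_haar" and p: "0 < p"
    and supp: "\<And>n. \<not> int p dvd n \<Longrightarrow> fourier_coeff \<phi> n = 0"
  obtains f where "f \<in> Linf_funs circle_haar" and "AE z in circle_haar. \<phi> z = f (z ^ p)"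
proof -
  have inj: "inj (\<lambda>n. int p * n)" using p by (auto simp: inj_def)
  have "(\<lambda>n. (cmod (fourier_coeff \<phi> n))\<^sup>2) summable_on range (\<lambda>n. int p * n)"
    by (rule summable_on_subset_banach[OF Bessel_summable[OF L2_circle_Linf[OF \<phi>]]]) simp
  then have "(\<lambda>n. (cmod (fourier_coeff \<phi> (int p * n)))\<^sup>2) summable_on UNIV"
    by (subst (asm) summable_on_reindex[OF inj]) (simp add: o_def)
  then obtain f where f: "L2_circle f" and lim: "(\<lambda>N. LINT z|circle_haar.
      (cmod (trig_sum {- int N..int N} (\<lambda>n. fourier_coeff \<phi> (int p * n)) z - f z))\<^sup>2) \<longlonglongrightarrow> 0"
    by (rule Riesz_Fischer)
  have fc: "fourier_coeff f = (\<lambda>n. fourier_coeff \<phi> (int p * n))"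
    by (rule fourier_coeff_limit[OF f lim])
  have ae: "AE z in circle_haar. \<phi> z = f (z ^ p)"
  proof (rule fourier_coeff_unique)
    show "fourier_coeff \<phi> n = fourier_coeff (\<lambda>z. f (z ^ p)) n" for n
      using supp by (auto simp: fourier_coeff_power[OF f p] fc)
  qed (intro L2_circle_integrable L2_circle_Linf L2_circle_power \<phi> f p)+
  obtain C where C: "AE z in circle_haar. cmod (\<phi> z) \<le> C" using \<phi> by (auto simp: Linf_funs_def)
  have [measurable]: "f \<in> borel_measurable circle_haar" by (rule square_integrable_measurable[OF f])
  have m: "{z \<in> space circle_haar. cmod (f z) \<le> C} \<in> sets circle_haar" by measurable
  have "AE z in circle_haar. cmod (f (z ^ p)) \<le> C" using ae C by eventually_elim simp
  then have "AE z in circle_haar. cmod (f z) \<le> C"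
    using AE_circle_power_iff[OF p, of "\<lambda>z. cmod (f z) \<le> C"] m by (simp add: space_circle_haar)
  then have "f \<in> Linf_funs circle_haar" by (auto simp: Linf_funs_def)
  then show thesis using that ae by blast
qed

section \<open>Transport of operators along a unitary\<close>

text \<open>
  The record of a Hilbert space carries no axioms. Closure of the carrier under the linear
  operations is what makes the inverse of a unitary map linear.
\<close>

definition lin_closed :: "('v, 'm) hilbert_scheme \<Rightarrow> bool" where
  "lin_closed H \<longleftrightarrow> (\<forall>x\<in>hcarrier H. \<forall>y\<in>hcarrier H. hadd H x y \<in> hcarrier H) \<and>
     (\<forall>c. \<forall>x\<in>hcarrier H. hscale H c x \<in> hcarrier H)"

definition unitary_map ::
  "('v, 'm) hilbert_scheme \<Rightarrow> ('w, 'n) hilbert_scheme \<Rightarrow> ('v \<Rightarrow> 'w) \<Rightarrow> bool" where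
  "unitary_map H K V \<longleftrightarrow> bij_betw V (hcarrier H) (hcarrier K) \<and>
     (\<forall>x\<in>hcarrier H. \<forall>y\<in>hcarrier H. V (hadd H x y) = hadd K (V x) (V y)) \<and>
     (\<forall>c. \<forall>x\<in>hcarrier H. V (hscale H c x) = hscale K c (V x)) \<and>
     (\<forall>x\<in>hcarrier H. \<forall>y\<in>hcarrier H. hinner K (V x) (V y) = hinner H x y)"

definition transport ::
  "('v, 'm) hilbert_scheme \<Rightarrow> ('w, 'n) hilbert_scheme \<Rightarrow> ('v \<Rightarrow> 'w) \<Rightarrow> ('v \<Rightarrow> 'v) \<Rightarrow> 'w \<Rightarrow> 'w" where
  "transport H K V T = (\<lambda>y\<in>hcarrier K. V (T (inv_into (hcarrier H) V y)))"

text \<open>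
  The adjoint of an operator is a definite description, which can be evaluated only where a
  solution exists and is unique. This predicate separates the two questions.
\<close>

definition is_adjoint :: "('v, 'm) hilbert_scheme \<Rightarrow> ('v \<Rightarrow> 'v) \<Rightarrow> ('v \<Rightarrow> 'v) \<Rightarrow> bool" where
  "is_adjoint H T S \<longleftrightarrow> S \<in> bounded_ops H \<and>
     (\<forall>x\<in>hcarrier H. \<forall>y\<in>hcarrier H. hinner H (T x) y = hinner H x (S y))"

lemma op_adj_eqI:
  assumes "is_adjoint H T S" and "\<And>S'. is_adjoint H T S' \<Longrightarrow> S' = S"
  shows "op_adj H T = S"
  unfolding op_adj_def is_adjoint_def[symmetric] using assms by (rule the_equality)

lemma bounded_ops_closed: "T \<in> bounded_ops H \<Longrightarrow> x \<in> hcarrier H \<Longrightarrow> T x \<in> hcarrier H"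
  by (auto simp: bounded_ops_def)

lemma bounded_ops_ext: "T \<in> bounded_ops H \<Longrightarrow> T \<in> extensional (hcarrier H)"
  by (auto simp: bounded_ops_def PiE_def)

lemma unitary_map_in: "unitary_map H K V \<Longrightarrow> x \<in> hcarrier H \<Longrightarrow> V x \<in> hcarrier K"
  by (auto simp: unitary_map_def bij_betw_def)

lemma unitary_map_hadd:
  "unitary_map H K V \<Longrightarrow> x \<in> hcarrier H \<Longrightarrow> y \<in> hcarrier H \<Longrightarrow> V (hadd H x y) = hadd K (V x) (V y)"
  unfolding unitary_map_def by blast

lemma unitary_map_hscale:
  "unitary_map H K V \<Longrightarrow> x \<in> hcarrier H \<Longrightarrow> V (hscale H c x) = hscale K c (V x)"
  unfolding unitary_map_def by blast

lemma unitary_map_hinner: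
  "unitary_map H K V \<Longrightarrow> x \<in> hcarrier H \<Longrightarrow> y \<in> hcarrier H \<Longrightarrow> hinner K (V x) (V y) = hinner H x y"
  unfolding unitary_map_def by blast

lemma unitary_map_hnorm: "unitary_map H K V \<Longrightarrow> x \<in> hcarrier H \<Longrightarrow> hnorm K (V x) = hnorm H x"
  by (simp add: unitary_map_hinner hnorm_def)

lemma unitary_map_inv_in:
  "unitary_map H K V \<Longrightarrow> y \<in> hcarrier K \<Longrightarrow> inv_into (hcarrier H) V y \<in> hcarrier H"
  by (auto simp: unitary_map_def bij_betw_def intro: inv_into_into)

lemma unitary_map_right_inv:
  "unitary_map H K V \<Longrightarrow> y \<in> hcarrier K \<Longrightarrow> V (inv_into (hcarrier H) V y) = y"
  by (auto simp: unitary_map_def bij_betw_def f_inv_into_f)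

lemma unitary_map_left_inv:
  "unitary_map H K V \<Longrightarrow> x \<in> hcarrier H \<Longrightarrow> inv_into (hcarrier H) V (V x) = x"
  by (auto simp: unitary_map_def bij_betw_def)

lemma unitary_map_inv:
  assumes V: "unitary_map H K V" and H: "lin_closed H"
  shows "unitary_map K H (inv_into (hcarrier H) V)" and "lin_closed K"
proof -
  note inv = unitary_map_inv_in[OF V] unitary_map_right_inv[OF V] unitary_map_left_inv[OF V]
  let ?W = "inv_into (hcarrier H) V"
  have add: "hadd K x y = V (hadd H (?W x) (?W y))" if "x \<in> hcarrier K" "y \<in> hcarrier K" for x y
    using that by (simp add: unitary_map_hadd[OF V] inv)
  have scale: "hscale K c x = V (hscale H c (?W x))" if "x \<in> hcarrier K" for c x
    using that by (simp add: unitary_map_hscale[OF V] inv)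
  have Hc: "x \<in> hcarrier H \<Longrightarrow> y \<in> hcarrier H \<Longrightarrow> hadd H x y \<in> hcarrier H"
    "x \<in> hcarrier H \<Longrightarrow> hscale H c x \<in> hcarrier H" for x y c
    using H by (auto simp: lin_closed_def)
  have Wadd: "?W (hadd K x y) = hadd H (?W x) (?W y)" if "x \<in> hcarrier K" "y \<in> hcarrier K" for x y
    unfolding add[OF that] using that Hc inv by simp
  have Wscale: "?W (hscale K c x) = hscale H c (?W x)" if "x \<in> hcarrier K" for c x
    unfolding scale[OF that] using that Hc inv by simp
  show "lin_closed K"
    using Hc inv unitary_map_in[OF V] unfolding lin_closed_def by (metis add scale)
  have "hinner H (?W x) (?W y) = hinner K x y" if "x \<in> hcarrier K" "y \<in> hcarrier K" for x y
    using that by (metis unitary_map_hinner[OF V] inv(1,2))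
  moreover have "bij_betw ?W (hcarrier K) (hcarrier H)"
    using V by (auto simp: unitary_map_def intro: bij_betw_inv_into)
  ultimately show "unitary_map K H ?W"
    using Wadd Wscale unfolding unitary_map_def by blast
qed

lemma transport_apply:
  assumes "unitary_map H K V" and "x \<in> hcarrier H"
  shows "transport H K V T (V x) = V (T x)"
  using assms by (simp add: transport_def unitary_map_in unitary_map_left_inv)

lemma transport_eqI:
  assumes V: "unitary_map H K V" and "S \<in> extensional (hcarrier K)"
    and "\<And>x. x \<in> hcarrier H \<Longrightarrow> S (V x) = V (T x)"
  shows "transport H K V T = S"
proof (rule extensionalityI[where A = "hcarrier K"])
  fix y assume "y \<in> hcarrier K"
  then show "transport H K V T y = S y"
    using assms(3)[of "inv_into (hcarrier H) V y"] unitary_map_inv_in[OF V] unitary_map_right_inv[OF V]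
    by (simp add: transport_def)
qed (use assms in \<open>auto simp: transport_def\<close>)

lemma transport_bounded_ops:
  assumes V: "unitary_map H K V" and H: "lin_closed H" and T: "T \<in> bounded_ops H"
  shows "transport H K V T \<in> bounded_ops K"
proof -
  note W = unitary_map_inv(1)[OF V H]
  note inv = unitary_map_inv_in[OF V] unitary_map_right_inv[OF V] unitary_map_left_inv[OF V]
  let ?W = "inv_into (hcarrier H) V"
  note Tc = bounded_ops_closed[OF T]
  note K = unitary_map_inv(2)[OF V H]
  obtain C where C: "\<And>x. x \<in> hcarrier H \<Longrightarrow> hnorm H (T x) \<le> C * hnorm H x"
    using T unfolding bounded_ops_def by blast
  have "hnorm K (transport H K V T y) \<le> C * hnorm K y" if "y \<in> hcarrier K" for y
    using C[of "?W y"] that inv Tc unitary_map_hnorm[OF V] unitary_map_hnorm[OF W]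
    by (simp add: transport_def)
  moreover have "transport H K V T \<in> hcarrier K \<rightarrow>\<^sub>E hcarrier K"
    using inv Tc unitary_map_in[OF V] by (auto simp: transport_def)
  moreover have "transport H K V T (hadd K x y) = hadd K (transport H K V T x) (transport H K V T y)"
    if "x \<in> hcarrier K" "y \<in> hcarrier K" for x y
  proof -
    have "hadd K x y \<in> hcarrier K" using K that by (simp add: lin_closed_def)
    then show ?thesis using that T inv Tc
      by (simp add: transport_def unitary_map_hadd[OF W] unitary_map_hadd[OF V] bounded_ops_def)
  qed
  moreover have "transport H K V T (hscale K c x) = hscale K c (transport H K V T x)"
    if "x \<in> hcarrier K" for c x
  proof -
    have "hscale K c x \<in> hcarrier K" using K that by (simp add: lin_closed_def)
    then show ?thesis using that T inv Tc
      by (simp add: transport_def unitary_map_hscale[OF W] unitary_map_hscale[OF V] bounded_ops_def)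
  qed
  ultimately show ?thesis by (auto simp: bounded_ops_def)
qed

lemma transport_inverse:
  assumes V: "unitary_map H K V" and H: "lin_closed H" and T: "T \<in> bounded_ops H"
  shows "transport K H (inv_into (hcarrier H) V) (transport H K V T) = T"
proof (rule transport_eqI[OF unitary_map_inv(1)[OF V H] bounded_ops_ext[OF T]])
  fix y assume "y \<in> hcarrier K"
  then show "T (inv_into (hcarrier H) V y) = inv_into (hcarrier H) V (transport H K V T y)"
    using unitary_map_inv_in[OF V] bounded_ops_closed[OF T] unitary_map_left_inv[OF V]
    by (simp add: transport_def)
qed

lemma transport_inverse':
  assumes V: "unitary_map H K V" and H: "lin_closed H" and T: "T \<in> bounded_ops K"
  shows "transport H K V (transport K H (inv_into (hcarrier H) V) T) = T"
proof (rule transport_eqI[OF V bounded_ops_ext[OF T]])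
  fix x assume x: "x \<in> hcarrier H"
  then show "T (V x) = V (transport K H (inv_into (hcarrier H) V) T x)"
    using transport_apply[OF unitary_map_inv(1)[OF V H] unitary_map_in[OF V x], of T]
    by (simp add: unitary_map_left_inv[OF V] unitary_map_right_inv[OF V] bounded_ops_closed[OF T] unitary_map_in[OF V])
qed

lemma transport_op_id:
  assumes V: "unitary_map H K V"
  shows "transport H K V (op_id H) = op_id K"
  by (rule transport_eqI[OF V]) (auto simp: op_id_def unitary_map_in[OF V])

lemma transport_op_add:
  assumes V: "unitary_map H K V" and "S \<in> bounded_ops H" and "T \<in> bounded_ops H"
  shows "transport H K V (op_add H S T) = op_add K (transport H K V S) (transport H K V T)"
  using assms bounded_ops_closed[of _ H]
  by (intro transport_eqI[OF V]) (auto simp: op_add_def unitary_map_in transport_apply unitary_map_hadd)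

lemma transport_op_scale:
  assumes V: "unitary_map H K V" and "T \<in> bounded_ops H"
  shows "transport H K V (op_scale H c T) = op_scale K c (transport H K V T)"
  using assms bounded_ops_closed[of _ H]
  by (intro transport_eqI[OF V]) (auto simp: op_scale_def unitary_map_in transport_apply unitary_map_hscale)

lemma transport_op_mult:
  assumes V: "unitary_map H K V" and "S \<in> bounded_ops H" and "T \<in> bounded_ops H"
  shows "transport H K V (op_mult H S T) = op_mult K (transport H K V S) (transport H K V T)"
  using assms bounded_ops_closed[of _ H]
  by (intro transport_eqI[OF V])
     (auto simp: op_mult_def compose_def unitary_map_in transport_apply)

lemma transport_is_adjoint:
  assumes V: "unitary_map H K V" and H: "lin_closed H"
    and T: "T \<in> bounded_ops H" and adj: "is_adjoint H T S"
  shows "is_adjoint K (transport H K V T) (transport H K V S)"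
proof -
  have S: "S \<in> bounded_ops H" using adj by (simp add: is_adjoint_def)
  have "hinner K (transport H K V T (V x)) (V y) = hinner K (V x) (transport H K V S (V y))"
    if "x \<in> hcarrier H" "y \<in> hcarrier H" for x y
    using that adj bounded_ops_closed[OF T] bounded_ops_closed[OF S]
    by (simp add: transport_apply[OF V] unitary_map_hinner[OF V] is_adjoint_def)
  then have "hinner K (transport H K V T x) y = hinner K x (transport H K V S y)"
    if "x \<in> hcarrier K" "y \<in> hcarrier K" for x y
    using that by (metis unitary_map_inv_in[OF V] unitary_map_right_inv[OF V])
  then show ?thesis
    using transport_bounded_ops[OF V H S] by (simp add: is_adjoint_def)
qed

lemma transport_op_adj:
  assumes V: "unitary_map H K V" and H: "lin_closed H" and T: "T \<in> bounded_ops H"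
    and adj: "is_adjoint H T S" and uniq: "\<And>S'. is_adjoint H T S' \<Longrightarrow> S' = S"
  shows "transport H K V (op_adj H T) = op_adj K (transport H K V T)"
proof -
  have "op_adj K (transport H K V T) = transport H K V S"
  proof (rule op_adj_eqI)
    show "is_adjoint K (transport H K V T) (transport H K V S)"
      by (rule transport_is_adjoint[OF V H T adj])
    fix S' assume S': "is_adjoint K (transport H K V T) S'"
    let ?W = "inv_into (hcarrier H) V"
    have "is_adjoint H (transport K H ?W (transport H K V T)) (transport K H ?W S')"
      by (rule transport_is_adjoint[OF unitary_map_inv[OF V H] transport_bounded_ops[OF V H T] S'])
    then have "transport K H ?W S' = S"
      using uniq by (simp add: transport_inverse[OF V H T])
    then show "S' = transport H K V S"
      using transport_inverse'[OF V H] S' by (metis is_adjoint_def)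
  qed
  then show ?thesis using op_adj_eqI[OF adj uniq] by simp
qed

text \<open>
  Conjugation by a unitary map respects all operations. It respects adjoints only where they are
  determined, so existence and uniqueness of adjoints are required on one side; conjugation carries
  them to the other side.
\<close>

lemma star_isomorphic_transport:
  assumes V: "unitary_map H K V" and H: "lin_closed H" and A: "star_algebra H A"
    and adj: "\<And>T. T \<in> A \<Longrightarrow> \<exists>S. is_adjoint H T S \<and> (\<forall>S'. is_adjoint H T S' \<longrightarrow> S' = S)"
  shows "star_isomorphic K (transport H K V ` A) H A"
proof -
  let ?c = "transport H K V"
  define d where "d = transport K H (inv_into (hcarrier H) V)"
  have b: "T \<in> bounded_ops H" if "T \<in> A" for T using A that by (auto simp: star_algebra_def)
  have dc: "d (?c T) = T" if "T \<in> A" for T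
    unfolding d_def by (rule transport_inverse[OF V H b[OF that]])
  have c_adj: "?c (op_adj H T) = op_adj K (?c T)" if "T \<in> A" for T
    using adj[OF that] transport_op_adj[OF V H b[OF that]] by blast
  note c = transport_op_id[OF V, symmetric] transport_op_add[OF V b b, symmetric] transport_op_scale[OF V b, symmetric]
    transport_op_mult[OF V b b, symmetric] c_adj[symmetric]
  have A': "op_add H S T \<in> A" "op_mult H S T \<in> A" "op_scale H k S \<in> A" "op_adj H S \<in> A"
    if "S \<in> A" "T \<in> A" for S T k
    using A that by (auto simp: star_algebra_def)
  have "op_id H \<in> A" using A by (simp add: star_algebra_def)
  then have "star_algebra K (?c ` A)"
    unfolding star_algebra_def using A' transport_bounded_ops[OF V H b]
    by (auto simp: c)
  moreover have "bij_betw d (?c ` A) A"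
    by (rule bij_betw_byWitness[where f' = ?c]) (auto simp: dc)
  ultimately show ?thesis
    unfolding star_isomorphic_def using A A'
    by (intro conjI exI[of _ d]) (simp_all add: c dc)
qed

section \<open>Multiplication operators\<close>

text \<open>
  The operations on classes are defined through chosen representatives. The following lemmas
  express them through arbitrary representatives, and no choice is visible afterwards.
\<close>

lemma ae_rep_ae_class:
  assumes "f \<in> borel_measurable M"
  shows "ae_rep (ae_class M f) \<in> borel_measurable M" and "AE z in M. ae_rep (ae_class M f) z = f z"
proof -
  have "f \<in> ae_class M f" using assms by (simp add: ae_class_def)
  then have "ae_rep (ae_class M f) \<in> ae_class M f" unfolding ae_rep_def by (rule someI[where P = "\<lambda>g. g \<in> ae_class M f"])
  then show "ae_rep (ae_class M f) \<in> borel_measurable M" "AE z in M. ae_rep (ae_class M f) z = f z"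
    by (auto simp: ae_class_def)
qed

lemma ae_class_eqI:
  assumes "AE z in M. f z = g z"
  shows "ae_class M f = ae_class M g"
proof -
  have "(AE z in M. h z = f z) \<longleftrightarrow> (AE z in M. h z = g z)" for h
  proof
    assume "AE z in M. h z = f z"
    then show "AE z in M. h z = g z" using assms by eventually_elim simp
  next
    assume "AE z in M. h z = g z"
    then show "AE z in M. h z = f z" using assms by eventually_elim simp
  qed
  then show ?thesis by (simp add: ae_class_def)
qed

lemma L2_carrier_iff: "X \<in> hcarrier (L2_space M) \<longleftrightarrow> (\<exists>f. square_integrable M f \<and> X = ae_class M f)"
  by (auto simp: L2_space_def square_integrable_def)

lemma ae_class_in_L2: "square_integrable M f \<Longrightarrow> ae_class M f \<in> hcarrier (L2_space M)"
  by (auto simp: L2_carrier_iff)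

lemma ae_rep_L2:
  assumes "X \<in> hcarrier (L2_space M)"
  shows "square_integrable M (ae_rep X)" and "ae_class M (ae_rep X) = X"
proof -
  obtain f where f: "square_integrable M f" "X = ae_class M f" using assms by (auto simp: L2_carrier_iff)
  note r = ae_rep_ae_class[OF square_integrable_measurable[OF f(1)]]
  show "square_integrable M (ae_rep X)"
    using square_integrable_cong_AE[OF f(1)] r f(2) by simp
  show "ae_class M (ae_rep X) = X" using ae_class_eqI[OF r(2)] f(2) by simp
qed

lemma L2_hadd:
  assumes "square_integrable M f" and "square_integrable M g"
  shows "hadd (L2_space M) (ae_class M f) (ae_class M g) = ae_class M (\<lambda>z. f z + g z)"
proof -
  have "AE z in M. ae_rep (ae_class M f) z + ae_rep (ae_class M g) z = f z + g z"
    using ae_rep_ae_class(2)[OF square_integrable_measurable[OF assms(1)]]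
      ae_rep_ae_class(2)[OF square_integrable_measurable[OF assms(2)]]
    by eventually_elim simp
  then show ?thesis by (simp add: L2_space_def ae_class_eqI)
qed

lemma L2_hscale:
  assumes "square_integrable M f"
  shows "hscale (L2_space M) c (ae_class M f) = ae_class M (\<lambda>z. c * f z)"
proof -
  have "AE z in M. c * ae_rep (ae_class M f) z = c * f z"
    using ae_rep_ae_class(2)[OF square_integrable_measurable[OF assms(1)]] by eventually_elim simp
  then show ?thesis by (simp add: L2_space_def ae_class_eqI)
qed

lemma L2_hinner:
  assumes f: "square_integrable M f" and g: "square_integrable M g"
  shows "hinner (L2_space M) (ae_class M f) (ae_class M g) = (LINT z|M. f z * cnj (g z))"
proof -
  note rf = ae_rep_ae_class[OF square_integrable_measurable[OF f]]
  note rg = ae_rep_ae_class[OF square_integrable_measurable[OF g]]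
  note sf = ae_rep_L2(1)[OF ae_class_in_L2[OF f]] and sg = ae_rep_L2(1)[OF ae_class_in_L2[OF g]]
  have "(LINT z|M. ae_rep (ae_class M f) z * cnj (ae_rep (ae_class M g) z)) = (LINT z|M. f z * cnj (g z))"
  proof (rule integral_cong_AE)
    show "AE z in M. ae_rep (ae_class M f) z * cnj (ae_rep (ae_class M g) z) = f z * cnj (g z)"
      using rf(2) rg(2) by eventually_elim simp
  qed (rule borel_measurable_integrable square_integrable_mult_integrable square_integrable_cnj sf sg f g)+
  then show ?thesis by (simp add: L2_space_def)
qed

lemma L2_hnorm:
  assumes "square_integrable M f"
  shows "hnorm (L2_space M) (ae_class M f) = sqrt (LINT z|M. (cmod (f z))\<^sup>2)"
proof -
  have "(LINT z|M. f z * cnj (f z)) = complex_of_real (LINT z|M. (cmod (f z))\<^sup>2)"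
    by (simp only: complex_norm_square[symmetric] integral_complex_of_real)
  then show ?thesis by (simp add: hnorm_def L2_hinner[OF assms assms])
qed

lemma lin_closed_L2: "lin_closed (L2_space M)"
  unfolding lin_closed_def
  using square_integrable_add square_integrable_scale
  by (auto simp: L2_carrier_iff L2_hadd L2_hscale) blast+

lemma mult_operator_ae_class:
  assumes "square_integrable M f"
  shows "mult_operator M \<phi> (ae_class M f) = ae_class M (\<lambda>z. \<phi> z * f z)"
proof -
  have "AE z in M. \<phi> z * ae_rep (ae_class M f) z = \<phi> z * f z"
    using ae_rep_ae_class(2)[OF square_integrable_measurable[OF assms(1)]] by eventually_elim simp
  then show ?thesis by (simp add: mult_operator_def ae_class_in_L2[OF assms] ae_class_eqI)
qed

lemma mult_operator_eqI:
  assumes "T \<in> extensional (hcarrier (L2_space M))"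
    and "\<And>f. square_integrable M f \<Longrightarrow> T (ae_class M f) = ae_class M (\<lambda>z. \<phi> z * f z)"
  shows "T = mult_operator M \<phi>"
proof (rule extensionalityI[where A = "hcarrier (L2_space M)"])
  fix X assume "X \<in> hcarrier (L2_space M)"
  then show "T X = mult_operator M \<phi> X"
    using assms(2) by (auto simp: L2_carrier_iff mult_operator_ae_class)
qed (use assms in \<open>auto simp: mult_operator_def\<close>)

lemma mult_operator_cong_AE:
  assumes "AE z in M. \<phi> z = \<psi> z"
  shows "mult_operator M \<phi> = mult_operator M \<psi>"
proof (rule mult_operator_eqI)
  fix f assume f: "square_integrable M f"
  have "AE z in M. \<phi> z * f z = \<psi> z * f z" using assms by eventually_elim simp
  then show "mult_operator M \<phi> (ae_class M f) = ae_class M (\<lambda>z. \<psi> z * f z)"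
    by (simp add: mult_operator_ae_class[OF f] ae_class_eqI)
qed (simp add: mult_operator_def)

lemma mult_operator_bounded:
  assumes \<phi>: "\<phi> \<in> Linf_funs M"
  shows "mult_operator M \<phi> \<in> bounded_ops (L2_space M)"
proof -
  note m = square_integrable_mult_Linf[OF \<phi>]
  obtain C where C: "AE z in M. cmod (\<phi> z) \<le> C" using \<phi> by (auto simp: Linf_funs_def)
  have bd: "hnorm (L2_space M) (mult_operator M \<phi> X) \<le> \<bar>C\<bar> * hnorm (L2_space M) X"
    if "X \<in> hcarrier (L2_space M)" for X
  proof -
    obtain f where f: "square_integrable M f" "X = ae_class M f" using \<open>X \<in> _\<close> by (auto simp: L2_carrier_iff)
    have "sqrt (LINT z|M. (cmod (\<phi> z * f z))\<^sup>2) \<le> sqrt (C\<^sup>2 * (LINT z|M. (cmod (f z))\<^sup>2))"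
      using Linf_mult_integral_le[OF \<phi> f(1) C] by simp
    then show ?thesis
      by (simp add: f(2) mult_operator_ae_class f(1) L2_hnorm m real_sqrt_mult)
  qed
  have "mult_operator M \<phi> \<in> hcarrier (L2_space M) \<rightarrow>\<^sub>E hcarrier (L2_space M)"
  proof (rule PiE_I)
    fix X assume "X \<in> hcarrier (L2_space M)"
    then show "mult_operator M \<phi> X \<in> hcarrier (L2_space M)"
      using m by (auto simp: L2_carrier_iff mult_operator_ae_class) blast
  qed (simp add: mult_operator_def)
  moreover have "mult_operator M \<phi> (hadd (L2_space M) X Y)
      = hadd (L2_space M) (mult_operator M \<phi> X) (mult_operator M \<phi> Y)"
    if "X \<in> hcarrier (L2_space M)" "Y \<in> hcarrier (L2_space M)" for X Y
    using that
    by (auto simp: L2_carrier_iff L2_hadd mult_operator_ae_class square_integrable_add m ring_distribs)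
  moreover have "mult_operator M \<phi> (hscale (L2_space M) c X) = hscale (L2_space M) c (mult_operator M \<phi> X)"
    if "X \<in> hcarrier (L2_space M)" for c X
    using that
    by (auto simp: L2_carrier_iff L2_hscale mult_operator_ae_class square_integrable_scale m mult.left_commute)
  moreover have "\<exists>C. \<forall>X\<in>hcarrier (L2_space M).
      hnorm (L2_space M) (mult_operator M \<phi> X) \<le> C * hnorm (L2_space M) X"
    using bd by blast
  ultimately show ?thesis unfolding bounded_ops_def by simp
qed

lemma Linf_cnj: "\<phi> \<in> Linf_funs M \<Longrightarrow> (\<lambda>z. cnj (\<phi> z)) \<in> Linf_funs M"
  by (auto simp: Linf_funs_def intro: borel_measurable_continuous_on[OF continuous_on_cnj[OF continuous_on_id]])

lemma mult_operator_is_adjoint: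
  assumes \<phi>: "\<phi> \<in> Linf_funs M"
  shows "is_adjoint (L2_space M) (mult_operator M \<phi>) (mult_operator M (\<lambda>z. cnj (\<phi> z)))"
proof -
  have "hinner (L2_space M) (mult_operator M \<phi> X) Y
      = hinner (L2_space M) X (mult_operator M (\<lambda>z. cnj (\<phi> z)) Y)"
    if X: "X \<in> hcarrier (L2_space M)" and Y: "Y \<in> hcarrier (L2_space M)" for X Y
  proof -
    obtain f g where f: "square_integrable M f" "X = ae_class M f"
      and g: "square_integrable M g" "Y = ae_class M g"
      using X Y by (auto simp: L2_carrier_iff)
    show ?thesis
      unfolding f(2) g(2) mult_operator_ae_class[OF f(1)] mult_operator_ae_class[OF g(1)]
        L2_hinner[OF square_integrable_mult_Linf[OF \<phi> f(1)] g(1)]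
        L2_hinner[OF f(1) square_integrable_mult_Linf[OF Linf_cnj[OF \<phi>] g(1)]]
      by (simp add: mult_ac)
  qed
  then show ?thesis
    unfolding is_adjoint_def using mult_operator_bounded[OF Linf_cnj[OF \<phi>]] by blast
qed

text \<open>
  Two candidate values of the adjoint at \<open>Y\<close> have the same inner product with every vector, in
  particular with their difference, which is then of norm zero.
\<close>

lemma L2_is_adjoint_unique:
  assumes "is_adjoint (L2_space M) T S" and "is_adjoint (L2_space M) T S'"
    and T: "T \<in> bounded_ops (L2_space M)"
  shows "S = S'"
proof (rule extensionalityI[where A = "hcarrier (L2_space M)"])
  have b: "S \<in> bounded_ops (L2_space M)" "S' \<in> bounded_ops (L2_space M)"
    using assms by (auto simp: is_adjoint_def)
  then show "S \<in> extensional (hcarrier (L2_space M))" "S' \<in> extensional (hcarrier (L2_space M))"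
    by (auto intro: bounded_ops_ext)
  fix Y assume Y: "Y \<in> hcarrier (L2_space M)"
  obtain f g where f: "square_integrable M f" "S Y = ae_class M f"
    and g: "square_integrable M g" "S' Y = ae_class M g"
    using bounded_ops_closed[OF b(1) Y] bounded_ops_closed[OF b(2) Y] by (auto simp: L2_carrier_iff)
  define h where "h z = f z - g z" for z
  have h: "square_integrable M h" unfolding h_def by (rule square_integrable_diff[OF f(1) g(1)])
  have "hinner (L2_space M) (ae_class M h) (S Y) = hinner (L2_space M) (ae_class M h) (S' Y)"
    using assms Y ae_class_in_L2[OF h] by (simp add: is_adjoint_def)
  then have "(LINT z|M. h z * cnj (f z)) = (LINT z|M. h z * cnj (g z))"
    by (simp add: f g h L2_hinner)
  then have "(LINT z|M. h z * cnj (h z)) = 0"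
    using square_integrable_mult_integrable[OF h square_integrable_cnj[OF f(1)]]
      square_integrable_mult_integrable[OF h square_integrable_cnj[OF g(1)]]
    by (simp add: h_def[of "_"] right_diff_distrib)
  then have "complex_of_real (LINT z|M. (cmod (h z))\<^sup>2) = 0"
    by (simp only: complex_norm_square[symmetric] integral_complex_of_real)
  then have "AE z in M. (cmod (h z))\<^sup>2 = 0"
    using integral_nonneg_eq_0_iff_AE[OF square_integrable_norm[OF h]] by simp
  then have "AE z in M. f z = g z" by (simp add: h_def)
  then show "S Y = S' Y" by (simp add: f g ae_class_eqI)
qed

lemma mult_operator_adjoint_unique:
  assumes "\<phi> \<in> Linf_funs M"
  shows "\<exists>S. is_adjoint (L2_space M) (mult_operator M \<phi>) S \<and>
    (\<forall>S'. is_adjoint (L2_space M) (mult_operator M \<phi>) S' \<longrightarrow> S' = S)"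
  using mult_operator_is_adjoint[OF assms] L2_is_adjoint_unique mult_operator_bounded[OF assms] by blast

lemma op_adj_mult_operator:
  assumes "\<phi> \<in> Linf_funs M"
  shows "op_adj (L2_space M) (mult_operator M \<phi>) = mult_operator M (\<lambda>z. cnj (\<phi> z))"
  by (rule op_adj_eqI[OF mult_operator_is_adjoint[OF assms]])
     (rule L2_is_adjoint_unique[OF _ mult_operator_is_adjoint[OF assms] mult_operator_bounded[OF assms]])

lemma op_add_mult_operator:
  assumes "\<phi> \<in> Linf_funs M" and "\<psi> \<in> Linf_funs M"
  shows "op_add (L2_space M) (mult_operator M \<phi>) (mult_operator M \<psi>) = mult_operator M (\<lambda>z. \<phi> z + \<psi> z)"
  using square_integrable_mult_Linf[OF assms(1)] square_integrable_mult_Linf[OF assms(2)]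
  by (intro mult_operator_eqI)
     (auto simp: op_add_def mult_operator_ae_class ae_class_in_L2 L2_hadd ring_distribs)

lemma op_scale_mult_operator:
  assumes "\<phi> \<in> Linf_funs M"
  shows "op_scale (L2_space M) c (mult_operator M \<phi>) = mult_operator M (\<lambda>z. c * \<phi> z)"
  using square_integrable_mult_Linf[OF assms(1)]
  by (intro mult_operator_eqI)
     (auto simp: op_scale_def mult_operator_ae_class ae_class_in_L2 L2_hscale mult.assoc)

lemma op_mult_mult_operator:
  assumes "\<psi> \<in> Linf_funs M"
  shows "op_mult (L2_space M) (mult_operator M \<phi>) (mult_operator M \<psi>) = mult_operator M (\<lambda>z. \<phi> z * \<psi> z)"
  using square_integrable_mult_Linf[OF assms]
  by (intro mult_operator_eqI)
     (auto simp: op_mult_def compose_def mult_operator_ae_class ae_class_in_L2 mult.assoc)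

lemma op_id_mult_operator: "op_id (L2_space M) = mult_operator M (\<lambda>_. 1)"
  by (rule mult_operator_eqI) (auto simp: op_id_def ae_class_in_L2)

text \<open>
  The operations on multiplication operators are the pointwise operations on the symbols.
\<close>

lemma abelian_algebra_mult_operators:
  assumes F: "F \<subseteq> Linf_funs M" and one: "(\<lambda>_. 1) \<in> F"
    and "\<And>f g. f \<in> F \<Longrightarrow> g \<in> F \<Longrightarrow> (\<lambda>z. f z + g z) \<in> F"
    and "\<And>f g. f \<in> F \<Longrightarrow> g \<in> F \<Longrightarrow> (\<lambda>z. f z * g z) \<in> F"
    and "\<And>c f. f \<in> F \<Longrightarrow> (\<lambda>z. c * f z) \<in> F"
    and "\<And>f. f \<in> F \<Longrightarrow> (\<lambda>z. cnj (f z)) \<in> F"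
  shows "abelian_algebra (L2_space M) (mult_operator M ` F)"
proof -
  have L: "f \<in> Linf_funs M" if "f \<in> F" for f using F that by blast
  have "star_algebra (L2_space M) (mult_operator M ` F)"
    unfolding star_algebra_def using assms
    by (auto simp: L op_id_mult_operator op_add_mult_operator op_scale_mult_operator op_mult_mult_operator
        op_adj_mult_operator intro: mult_operator_bounded)
  then show ?thesis
    unfolding abelian_algebra_def by (auto simp: L op_mult_mult_operator mult.commute)
qed

lemma Linf_const: "(\<lambda>_. c) \<in> Linf_funs M"
  by (auto simp: Linf_funs_def)

lemma Linf_add:
  assumes "f \<in> Linf_funs M" and "g \<in> Linf_funs M"
  shows "(\<lambda>z. f z + g z) \<in> Linf_funs M"
proof -
  obtain C D where C: "AE z in M. cmod (f z) \<le> C" and D: "AE z in M. cmod (g z) \<le> D"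
    using assms by (auto simp: Linf_funs_def)
  have "AE z in M. cmod (f z + g z) \<le> C + D"
    using C D by eventually_elim (metis add_mono norm_triangle_le)
  then show ?thesis using assms by (auto simp: Linf_funs_def)
qed

lemma Linf_mult:
  assumes "f \<in> Linf_funs M" and "g \<in> Linf_funs M"
  shows "(\<lambda>z. f z * g z) \<in> Linf_funs M"
proof -
  obtain C D where C: "AE z in M. cmod (f z) \<le> C" and D: "AE z in M. cmod (g z) \<le> D"
    using assms by (auto simp: Linf_funs_def)
  have "AE z in M. cmod (f z * g z) \<le> C * D"
    using C D
  proof eventually_elim
    fix z assume "cmod (f z) \<le> C" and "cmod (g z) \<le> D"
    then show "cmod (f z * g z) \<le> C * D"
      unfolding norm_mult by (intro mult_mono) (auto intro: order_trans[OF norm_ge_zero])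
  qed
  then show ?thesis using assms by (auto simp: Linf_funs_def)
qed

lemma power_mult_algebra_eq:
  "power_mult_algebra p = mult_operator circle_haar ` {\<lambda>z. f (z ^ p) | f. f \<in> Linf_funs circle_haar}"
  by (auto simp: power_mult_algebra_def)

lemma abelian_algebra_power_mult:
  assumes p: "0 < p"
  shows "abelian_algebra (L2_space circle_haar) (power_mult_algebra p)"
  unfolding power_mult_algebra_eq
proof (rule abelian_algebra_mult_operators)
  show "{\<lambda>z. f (z ^ p) | f. f \<in> Linf_funs circle_haar} \<subseteq> Linf_funs circle_haar"
    using Linf_power[OF _ p] by blast
  show "(\<lambda>_. 1) \<in> {\<lambda>z. f (z ^ p) | f. f \<in> Linf_funs circle_haar}"
    using Linf_const[of 1] by force
  fix f g assume "f \<in> {\<lambda>z. f (z ^ p) | f. f \<in> Linf_funs circle_haar}"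
    and "g \<in> {\<lambda>z. f (z ^ p) | f. f \<in> Linf_funs circle_haar}"
  then obtain f' g' where f: "f' \<in> Linf_funs circle_haar" "f = (\<lambda>z. f' (z ^ p))"
    and g: "g' \<in> Linf_funs circle_haar" "g = (\<lambda>z. g' (z ^ p))" by blast
  show "(\<lambda>z. f z + g z) \<in> {\<lambda>z. f (z ^ p) | f. f \<in> Linf_funs circle_haar}"
    unfolding f g by (intro CollectI exI[of _ "\<lambda>z. f' z + g' z"] conjI refl Linf_add[OF f(1) g(1)])
  show "(\<lambda>z. f z * g z) \<in> {\<lambda>z. f (z ^ p) | f. f \<in> Linf_funs circle_haar}"
    unfolding f g by (intro CollectI exI[of _ "\<lambda>z. f' z * g' z"] conjI refl Linf_mult[OF f(1) g(1)])
next
  fix f c assume "f \<in> {\<lambda>z. f (z ^ p) | f. f \<in> Linf_funs circle_haar}"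
  then obtain f' where f: "f' \<in> Linf_funs circle_haar" "f = (\<lambda>z. f' (z ^ p))" by blast
  show "(\<lambda>z. c * f z) \<in> {\<lambda>z. f (z ^ p) | f. f \<in> Linf_funs circle_haar}"
    unfolding f by (intro CollectI exI[of _ "\<lambda>z. c * f' z"] conjI refl Linf_mult[OF Linf_const f(1)])
  show "(\<lambda>z. cnj (f z)) \<in> {\<lambda>z. f (z ^ p) | f. f \<in> Linf_funs circle_haar}"
    unfolding f by (intro CollectI exI[of _ "\<lambda>z. cnj (f' z)"] conjI refl Linf_cnj[OF f(1)])
qed

section \<open>Iterates of the automorphism\<close>

lemma int_iter_0 [simp]: "int_iter f 0 x = x"
  by (simp add: int_iter_def)

lemma int_iter_add:
  assumes f: "bij f"
  shows "int_iter f (i + j) x = int_iter f i (int_iter f j x)"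
proof -
  define N where "N = nat \<bar>i\<bar> + nat \<bar>j\<bar>"
  have "(f ^^ N) (int_iter f i (int_iter f j x)) = (f ^^ nat (i + int N)) (int_iter f j x)"
    by (rule funpow_int_iter[OF f]) (simp add: N_def)
  also have "\<dots> = (f ^^ nat (j + int (nat (i + int N)))) x"
    by (rule funpow_int_iter[OF f]) (unfold N_def, linarith)
  also have "j + int (nat (i + int N)) = i + j + int N" by (simp add: N_def)
  also have "(f ^^ nat (i + j + int N)) x = (f ^^ N) (int_iter f (i + j) x)"
    by (rule funpow_int_iter[OF f, symmetric]) (simp add: N_def)
  finally have "(f ^^ N) (int_iter f i (int_iter f j x)) = (f ^^ N) (int_iter f (i + j) x)" .
  moreover have "inj (f ^^ N)" using f by (simp add: bij_is_inj inj_fn)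
  ultimately show ?thesis by (metis injD)
qed

lemma automorphism_bij: "automorphism \<alpha> \<Longrightarrow> bij \<alpha>"
  by (simp add: automorphism_def)

lemma int_iter_zero:
  assumes "automorphism \<alpha>"
  shows "int_iter \<alpha> j 0 = 0"
proof -
  have "\<alpha> (0 + 0) = \<alpha> 0 + \<alpha> 0" using assms unfolding automorphism_def by blast
  then have a: "\<alpha> 0 = 0" by simp
  then have i: "inv \<alpha> 0 = 0" using automorphism_bij[OF assms] by (metis bij_is_inj inv_f_f)
  have "(\<alpha> ^^ n) 0 = 0" "(inv \<alpha> ^^ n) 0 = 0" for n
    by (induction n) (simp_all add: a i)
  then show ?thesis by (simp add: int_iter_def)
qed

lemma funpow_dual_aut: "(dual_aut \<alpha> ^^ n) chi = (\<lambda>c. chi ((\<alpha> ^^ n) c))"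
  by (induction n) (simp_all add: dual_aut_def funpow_swap1)

lemma int_period_of_nat:
  "(\<forall>c. chi (int_iter \<alpha> (int n) c) = chi c) \<longleftrightarrow> (dual_aut \<alpha> ^^ n) chi = chi"
  by (auto simp: funpow_dual_aut int_iter_def fun_eq_iff)

lemma int_period_uminus:
  assumes "bij \<alpha>" and "\<forall>c. chi (int_iter \<alpha> j c) = chi c"
  shows "\<forall>c. chi (int_iter \<alpha> (- j) c) = chi c"
  using assms(2) int_iter_add[OF assms(1), of j "- j"] by auto (metis int_iter_0)

text \<open>
  The integers \<open>j\<close> for which the \<open>j\<close>-th iterate fixes the character form a subgroup of \<open>\<int>\<close>. It contains
  \<open>p\<close>, and by minimality no remainder modulo \<open>p\<close> other than 0.
\<close>

lemma minimal_period_iff: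
  assumes \<alpha>: "automorphism \<alpha>" and p: "minimal_period \<alpha> chi p"
  shows "(\<forall>c. chi (int_iter \<alpha> j c) = chi c) \<longleftrightarrow> int p dvd j"
proof -
  define P where "P j \<longleftrightarrow> (\<forall>c. chi (int_iter \<alpha> j c) = chi c)" for j
  note add = int_iter_add[OF automorphism_bij[OF \<alpha>]]
  have p0: "0 < p" using p by (simp add: minimal_period_def has_period_def)
  have nat: "P (int n) \<longleftrightarrow> (dual_aut \<alpha> ^^ n) chi = chi" for n
    unfolding P_def by (rule int_period_of_nat)
  have P_add: "P (i + j)" if "P i" "P j" for i j using that by (simp add: P_def add)
  have P_neg: "P (- j)" if "P j" for j
    using that unfolding P_def by (rule int_period_uminus[OF automorphism_bij[OF \<alpha>]])
  have P_p: "P (int p)" using p by (simp add: nat minimal_period_def has_period_def)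
  have P_pn: "P (int p * int n)" for n
    by (induction n) (auto simp: P_def[of 0] distrib_left intro: P_add P_p)
  have P_pk: "P (int p * k)" for k
    using P_pn[of "nat k"] P_neg[OF P_pn[of "nat (- k)"]] by (cases "0 \<le> k") auto
  have "P j \<longleftrightarrow> int p dvd j"
  proof
    assume "P j"
    then have "P (j mod int p)"
      using P_add[OF _ P_pk[of "- (j div int p)"]] by (simp add: minus_div_mult_eq_mod[symmetric] algebra_simps)
    moreover have r: "0 \<le> j mod int p" "j mod int p < int p" using p0 by simp_all
    ultimately have "(dual_aut \<alpha> ^^ nat (j mod int p)) chi = chi" using nat by (metis int_nat_eq)
    moreover have "nat (j mod int p) < p" using r by linarith
    ultimately have "\<not> 1 \<le> nat (j mod int p)" using p by (auto simp: minimal_period_def)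
    then have "j mod int p = 0" using r by linarith
    then show "int p dvd j" by (simp add: dvd_eq_mod_eq_0)
  qed (auto simp: P_pk)
  then show ?thesis by (simp add: P_def)
qed

lemma period_imp_minimal_period:
  assumes "has_period \<alpha> chi q"
  obtains p where "minimal_period \<alpha> chi p"
proof
  show "minimal_period \<alpha> chi (LEAST p. has_period \<alpha> chi p)"
    unfolding minimal_period_def
  proof (intro conjI allI impI)
    show "has_period \<alpha> chi (LEAST p. has_period \<alpha> chi p)"
      using assms by (rule LeastI)
    fix k assume k: "1 \<le> k \<and> k < (LEAST p. has_period \<alpha> chi p)"
    then have "\<not> has_period \<alpha> chi k" using not_less_Least by blast
    then show "(dual_aut \<alpha> ^^ k) chi \<noteq> chi" using k by (simp add: has_period_def)
  qed
qed

section \<open>The induced representation on sequences\<close>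

definition l2_seq :: "(int \<Rightarrow> complex) \<Rightarrow> bool" where
  "l2_seq x \<longleftrightarrow> (\<lambda>j. (cmod (x j))\<^sup>2) summable_on UNIV"

text \<open>
  The elements of the induced space are determined by their values on \<open>\<int> \<times> {0}\<close>. In these terms
  the space is \<open>l\<^sup>2(\<int>)\<close>, and the element \<open>(k, c)\<close> of the group shifts by \<open>k\<close> and multiplies by the
  sequence of values at \<open>c\<close> of the iterated characters.
\<close>

definition equivariant_ext :: "('b \<Rightarrow> complex) \<Rightarrow> (int \<Rightarrow> complex) \<Rightarrow> int \<times> 'b \<Rightarrow> complex" where
  "equivariant_ext chi x = (\<lambda>(j, b). chi b * x j)"

lemma character_simps:
  assumes "chi \<in> characters"
  shows "chi 0 = 1" and "cmod (chi b) = 1" and "chi (b + c) = chi b * chi c"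
proof -
  have c: "cmod (chi b) = 1" "chi (b + c) = chi b * chi c" for b c
    using assms by (auto simp: characters_def)
  show "cmod (chi b) = 1" "chi (b + c) = chi b * chi c" by (rule c)+
  have "chi (0 + 0) = chi 0 * chi 0" by (rule c)
  moreover have "chi 0 \<noteq> 0" using c(1)[of 0] by auto
  ultimately show "chi 0 = 1" by simp
qed

lemma equivariant_ext_0:
  assumes "chi \<in> characters"
  shows "equivariant_ext chi x (j, 0) = x j"
  by (simp add: equivariant_ext_def character_simps(1)[OF assms])

lemma equivariant_ext_inject:
  assumes "chi \<in> characters"
  shows "equivariant_ext chi x = equivariant_ext chi y \<longleftrightarrow> x = y"
proof
  assume "equivariant_ext chi x = equivariant_ext chi y"
  then have "equivariant_ext chi x (j, 0) = equivariant_ext chi y (j, 0)" for j by simp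
  then show "x = y" by (simp add: equivariant_ext_0[OF assms] fun_eq_iff)
qed simp

lemma ind_carrier_iff:
  assumes "chi \<in> characters"
  shows "F \<in> hcarrier (ind_space chi) \<longleftrightarrow> (\<exists>x. l2_seq x \<and> F = equivariant_ext chi x)"
proof
  assume "F \<in> hcarrier (ind_space chi)"
  then have "(\<forall>j b. F (j, b) = chi b * F (j, 0)) \<and> l2_seq (\<lambda>j. F (j, 0))"
    unfolding ind_space_def l2_seq_def hilbert.select_convs mem_Collect_eq .
  then have F: "F (j, b) = chi b * F (j, 0)" and l2: "l2_seq (\<lambda>j. F (j, 0))" for j b
    by blast+
  have "F = equivariant_ext chi (\<lambda>j. F (j, 0))"
  proof
    fix g
    show "F g = equivariant_ext chi (\<lambda>j. F (j, 0)) g"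
      unfolding equivariant_ext_def case_prod_beta F[of "fst g" "snd g", symmetric] by simp
  qed
  with l2 show "\<exists>x. l2_seq x \<and> F = equivariant_ext chi x" by blast
next
  assume "\<exists>x. l2_seq x \<and> F = equivariant_ext chi x"
  then obtain x where x: "l2_seq x" "F = equivariant_ext chi x" by blast
  then show "F \<in> hcarrier (ind_space chi)"
    by (simp add: ind_space_def l2_seq_def equivariant_ext_0[OF assms]) (simp add: equivariant_ext_def)
qed

lemma equivariant_ext_in: "chi \<in> characters \<Longrightarrow> l2_seq x \<Longrightarrow> equivariant_ext chi x \<in> hcarrier (ind_space chi)"
  using ind_carrier_iff by blast

lemma ind_hadd:
  "hadd (ind_space chi) (equivariant_ext chi x) (equivariant_ext chi y) = equivariant_ext chi (\<lambda>j. x j + y j)"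
  by (auto simp: ind_space_def equivariant_ext_def fun_eq_iff distrib_left)

lemma ind_hscale:
  "hscale (ind_space chi) c (equivariant_ext chi x) = equivariant_ext chi (\<lambda>j. c * x j)"
  by (auto simp: ind_space_def equivariant_ext_def fun_eq_iff mult_ac)

lemma ind_hzero: "hzero (ind_space chi) = equivariant_ext chi (\<lambda>_. 0)"
  by (auto simp: ind_space_def equivariant_ext_def fun_eq_iff)

lemma ind_hinner:
  assumes "chi \<in> characters"
  shows "hinner (ind_space chi) (equivariant_ext chi x) (equivariant_ext chi y)
    = (\<Sum>\<^sub>\<infinity>j. x j * cnj (y j))"
  by (simp add: ind_space_def equivariant_ext_0[OF assms])

lemma ind_rep_equivariant_ext:
  assumes "chi \<in> characters"
  shows "ind_rep \<alpha> (k, c) (equivariant_ext chi x)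
    = equivariant_ext chi (\<lambda>j. chi (int_iter \<alpha> j c) * x (j + k))"
  by (auto simp: ind_rep_def equivariant_ext_def fun_eq_iff character_simps(3)[OF assms])

lemma l2_seq_twist_shift:
  assumes chi: "chi \<in> characters" and x: "l2_seq x"
  shows "l2_seq (\<lambda>j. chi (int_iter \<alpha> j c) * x (j + k))"
proof -
  have b: "bij_betw (\<lambda>j::int. j + k) UNIV UNIV"
    by (rule bij_betwI[where g = "\<lambda>j. j - k"]) auto
  have "(\<lambda>j. (cmod (x (j + k)))\<^sup>2) summable_on UNIV"
    using x summable_on_reindex_bij_betw[OF b, of "\<lambda>j. (cmod (x j))\<^sup>2"] by (simp add: l2_seq_def)
  then show ?thesis by (simp add: l2_seq_def norm_mult character_simps(2)[OF chi])
qed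

section \<open>The Fourier transform as a unitary\<close>

definition fourier_map :: "('b \<Rightarrow> complex) \<Rightarrow> (complex \<Rightarrow> complex) set \<Rightarrow> int \<times> 'b \<Rightarrow> complex" where
  "fourier_map chi X = equivariant_ext chi (fourier_coeff (ae_rep X))"

lemma fourier_coeff_cong_AE:
  assumes "f \<in> borel_measurable circle_haar" and "g \<in> borel_measurable circle_haar"
    and "AE z in circle_haar. f z = g z"
  shows "fourier_coeff f = fourier_coeff g"
proof
  fix n
  show "fourier_coeff f n = fourier_coeff g n"
    unfolding fourier_coeff_def
  proof (rule integral_cong_AE)
    show "AE z in circle_haar. f z * z powi - n = g z * z powi - n"
      using assms(3) by eventually_elim simp
  qed (intro borel_measurable_times assms powi_measurable_circle)+
qed

lemma fourier_map_ae_class: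
  assumes f: "L2_circle f"
  shows "fourier_map chi (ae_class circle_haar f) = equivariant_ext chi (fourier_coeff f)"
proof -
  note r = ae_rep_ae_class[OF square_integrable_measurable[OF f]]
  show ?thesis
    unfolding fourier_map_def
    using fourier_coeff_cong_AE[OF r(1) square_integrable_measurable[OF f] r(2)] by simp
qed

lemma fourier_coeff_add:
  assumes "L2_circle f" and "L2_circle g"
  shows "fourier_coeff (\<lambda>z. f z + g z) n = fourier_coeff f n + fourier_coeff g n"
  using square_integrable_mult_integrable[OF assms(1) L2_circle_powi[of "- n"]]
    square_integrable_mult_integrable[OF assms(2) L2_circle_powi[of "- n"]]
  by (simp add: fourier_coeff_def distrib_right)

lemma fourier_coeff_scale: "fourier_coeff (\<lambda>z. c * f z) n = c * fourier_coeff f n"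
  by (simp add: fourier_coeff_def mult.assoc)

lemma l2_seq_fourier_coeff: "L2_circle f \<Longrightarrow> l2_seq (fourier_coeff f)"
  unfolding l2_seq_def by (rule Bessel_summable)

lemma l2_seq_is_fourier_coeff:
  assumes "l2_seq x"
  obtains f where "L2_circle f" and "fourier_coeff f = x"
proof (rule Riesz_Fischer[OF assms[unfolded l2_seq_def]])
  fix f assume "L2_circle f"
    and "(\<lambda>N. LINT z|circle_haar. (cmod (trig_sum {- int N..int N} x z - f z))\<^sup>2) \<longlonglongrightarrow> 0"
  then show thesis using that fourier_coeff_limit by blast
qed

text \<open>
  Parseval's identity preserves the inner product, uniqueness of Fourier coefficients gives
  injectivity, and Riesz-Fischer gives surjectivity.
\<close>

proposition fourier_map_unitary:
  assumes chi: "chi \<in> characters"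
  shows "unitary_map (L2_space circle_haar) (ind_space chi) (fourier_map chi)"
  unfolding unitary_map_def
proof (intro conjI ballI allI)
  let ?H = "L2_space circle_haar"
  show "bij_betw (fourier_map chi) (hcarrier ?H) (hcarrier (ind_space chi))"
  proof (rule bij_betw_imageI)
    show "inj_on (fourier_map chi) (hcarrier ?H)"
    proof (rule inj_onI)
      fix X Y assume "X \<in> hcarrier ?H" and "Y \<in> hcarrier ?H" and eq: "fourier_map chi X = fourier_map chi Y"
      then obtain f g where f: "L2_circle f" "X = ae_class circle_haar f"
        and g: "L2_circle g" "Y = ae_class circle_haar g" by (auto simp: L2_carrier_iff)
      have "fourier_coeff f = fourier_coeff g"
        using eq by (simp add: f g fourier_map_ae_class equivariant_ext_inject[OF chi])
      then have "AE z in circle_haar. f z = g z"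
        by (intro fourier_coeff_unique L2_circle_integrable f g) simp
      then show "X = Y" unfolding f g by (rule ae_class_eqI)
    qed
    show "fourier_map chi ` hcarrier ?H = hcarrier (ind_space chi)"
    proof (intro equalityI subsetI)
      fix F assume "F \<in> fourier_map chi ` hcarrier ?H"
      then obtain f where "L2_circle f" "F = fourier_map chi (ae_class circle_haar f)"
        by (auto simp: L2_carrier_iff)
      then show "F \<in> hcarrier (ind_space chi)"
        by (simp add: fourier_map_ae_class equivariant_ext_in[OF chi] l2_seq_fourier_coeff)
    next
      fix F assume "F \<in> hcarrier (ind_space chi)"
      then obtain x where x: "l2_seq x" "F = equivariant_ext chi x" by (auto simp: ind_carrier_iff[OF chi])
      obtain f where f: "L2_circle f" "fourier_coeff f = x" using l2_seq_is_fourier_coeff[OF x(1)] .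
      then have "F = fourier_map chi (ae_class circle_haar f)" by (simp add: fourier_map_ae_class x)
      then show "F \<in> fourier_map chi ` hcarrier ?H" using ae_class_in_L2[OF f(1)] by blast
    qed
  qed
  fix X assume "X \<in> hcarrier ?H"
  then obtain f where f: "L2_circle f" "X = ae_class circle_haar f" by (auto simp: L2_carrier_iff)
  {
    fix Y assume "Y \<in> hcarrier ?H"
    then obtain g where g: "L2_circle g" "Y = ae_class circle_haar g" by (auto simp: L2_carrier_iff)
    show "fourier_map chi (hadd ?H X Y) = hadd (ind_space chi) (fourier_map chi X) (fourier_map chi Y)"
      unfolding f g L2_hadd[OF f(1) g(1)] fourier_map_ae_class[OF f(1)] fourier_map_ae_class[OF g(1)]
        fourier_map_ae_class[OF square_integrable_add[OF f(1) g(1)]] ind_hadd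
      by (simp add: fourier_coeff_add[OF f(1) g(1), abs_def])
    show "hinner (ind_space chi) (fourier_map chi X) (fourier_map chi Y) = hinner ?H X Y"
      unfolding f g L2_hinner[OF f(1) g(1)] fourier_map_ae_class[OF f(1)] fourier_map_ae_class[OF g(1)]
        ind_hinner[OF chi]
      by (rule infsumI[OF Parseval[OF f(1) g(1)]])
  }
  fix c
  show "fourier_map chi (hscale ?H c X) = hscale (ind_space chi) c (fourier_map chi X)"
    unfolding f L2_hscale[OF f(1)] fourier_map_ae_class[OF f(1)]
      fourier_map_ae_class[OF square_integrable_scale[OF f(1)]] ind_hscale
    by (simp add: fourier_coeff_scale[abs_def])
qed

section \<open>The commutant\<close>

text \<open>
  If \<open>\<bar>\<phi>\<bar>\<close> exceeded \<open>\<bar>C\<bar> + 1\<close> on a set of positive measure, the indicator function of that set would be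
  stretched by more than the factor \<open>C\<close>.
\<close>

lemma Linf_of_bounded_multiplier:
  assumes M: "finite_measure M" and \<phi>[measurable]: "\<phi> \<in> borel_measurable M"
    and bd: "\<And>h. square_integrable M h \<Longrightarrow> integrable M (\<lambda>z. (cmod (\<phi> z * h z))\<^sup>2) \<and>
      (LINT z|M. (cmod (\<phi> z * h z))\<^sup>2) \<le> C\<^sup>2 * (LINT z|M. (cmod (h z))\<^sup>2)"
  shows "\<phi> \<in> Linf_funs M"
proof -
  interpret finite_measure M by fact
  define A where "A = {z \<in> space M. \<bar>C\<bar> + 1 < cmod (\<phi> z)}"
  have A[measurable]: "A \<in> sets M" unfolding A_def by measurable
  define h :: "_ \<Rightarrow> complex" where "h = indicator A"
  have hm[measurable]: "h \<in> borel_measurable M" unfolding h_def by measurable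
  have h2: "(cmod (h z))\<^sup>2 = indicator A z" for z by (simp add: h_def indicator_def)
  have iA: "integrable M (indicator A :: _ \<Rightarrow> real)"
    by (rule integrable_const_bound[where B = 1]) (auto simp: indicator_def)
  have hs: "square_integrable M h"
    unfolding square_integrable_def h2 using hm iA by simp
  have "(\<bar>C\<bar> + 1)\<^sup>2 * measure M A = (LINT z|M. (\<bar>C\<bar> + 1)\<^sup>2 * indicator A z)"
    using A by simp
  also have "\<dots> \<le> (LINT z|M. (cmod (\<phi> z * h z))\<^sup>2)"
  proof (rule integral_mono)
    show "(\<bar>C\<bar> + 1)\<^sup>2 * indicator A z \<le> (cmod (\<phi> z * h z))\<^sup>2" for z
      unfolding norm_mult power_mult_distrib h2
      by (auto simp: A_def indicator_def intro!: power_mono)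
  qed (use iA bd[OF hs] in auto)
  also have "\<dots> \<le> C\<^sup>2 * measure M A"
    using bd[OF hs] A by (simp add: h2)
  finally have "(1 + 2 * \<bar>C\<bar>) * measure M A \<le> 0" by (simp add: power2_eq_square algebra_simps)
  moreover have "0 < 1 + 2 * \<bar>C\<bar>" by simp
  ultimately have "measure M A \<le> 0" by (simp only: mult_le_0_iff) linarith
  then have "measure M A = 0" by (simp add: order_antisym)
  then have "A \<in> null_sets M" using A by (simp add: null_setsI emeasure_eq_measure)
  then have "AE z in M. z \<notin> A" by (rule AE_not_in)
  then have "AE z in M. cmod (\<phi> z) \<le> \<bar>C\<bar> + 1"
    using AE_space by eventually_elim (auto simp: A_def)
  then show ?thesis using \<phi> by (auto simp: Linf_funs_def)
qed

text \<open>
  The hypothesis says that \<open>S\<close> agrees with multiplication by \<open>\<phi>\<close> on monomials, hence on partial sums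
  of Fourier series. Passing to the limit is legitimate in \<open>L\<^sup>1\<close>, where a product of two
  square-integrable functions depends continuously on its factors; only afterwards does boundedness of
  \<open>S\<close> force \<open>\<phi>\<close> to be bounded.
\<close>

proposition bounded_op_is_mult_operator:
  assumes S: "S \<in> bounded_ops (L2_space circle_haar)" and \<phi>: "L2_circle \<phi>"
    and powi: "\<And>k. S (ae_class circle_haar (\<lambda>z. z powi k)) = ae_class circle_haar (\<lambda>z. z powi k * \<phi> z)"
  shows "\<phi> \<in> Linf_funs circle_haar" and "S = mult_operator circle_haar \<phi>"
proof -
  let ?H = "L2_space circle_haar" and ?c = "ae_class circle_haar"
  have S_add: "X \<in> hcarrier ?H \<Longrightarrow> Y \<in> hcarrier ?H \<Longrightarrow> S (hadd ?H X Y) = hadd ?H (S X) (S Y)"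
    and S_scale: "X \<in> hcarrier ?H \<Longrightarrow> S (hscale ?H c X) = hscale ?H c (S X)" for X Y c
    using S unfolding bounded_ops_def by blast+
  obtain C where C: "\<And>X. X \<in> hcarrier ?H \<Longrightarrow> hnorm ?H (S X) \<le> C * hnorm ?H X"
    using S unfolding bounded_ops_def by blast
  have \<phi>p: "L2_circle (\<lambda>z. z powi k * \<phi> z)" for k
    by (rule square_integrable_mult_Linf[OF Linf_powi \<phi>])
  have trig: "L2_circle (\<lambda>z. trig_sum I c z * \<phi> z) \<and> S (?c (trig_sum I c)) = ?c (\<lambda>z. trig_sum I c z * \<phi> z)"
    if "finite I" for I c
    using that
  proof (induction I rule: finite_induct)
    case empty
    have "S (?c (\<lambda>z. 0 * z powi 0)) = ?c (\<lambda>z. 0 * (z powi 0 * \<phi> z))"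
      unfolding L2_hscale[OF L2_circle_powi, symmetric] L2_hscale[OF \<phi>p, symmetric] powi[symmetric]
      by (rule S_scale[OF ae_class_in_L2[OF L2_circle_powi]])
    then show ?case using L2_circle_const[of 0] by (simp add: trig_sum_def[abs_def])
  next
    case (insert n I)
    have ts: "trig_sum (insert n I) c = (\<lambda>z. c n * z powi n + trig_sum I c z)"
      using insert.hyps by (auto simp: trig_sum_def)
    have tsp: "(\<lambda>z. trig_sum (insert n I) c z * \<phi> z) = (\<lambda>z. c n * (z powi n * \<phi> z) + trig_sum I c z * \<phi> z)"
      unfolding ts by (auto simp: algebra_simps)
    have a: "L2_circle (\<lambda>z. c n * z powi n)" "L2_circle (trig_sum I c)"
      "L2_circle (\<lambda>z. c n * (z powi n * \<phi> z))" "L2_circle (\<lambda>z. trig_sum I c z * \<phi> z)"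
      using insert by (auto intro: square_integrable_scale L2_circle_powi L2_circle_trig_sum \<phi>p)
    have "S (?c (trig_sum (insert n I) c)) = hadd ?H (S (?c (\<lambda>z. c n * z powi n))) (S (?c (trig_sum I c)))"
      unfolding ts L2_hadd[OF a(1,2), symmetric]
      by (rule S_add[OF ae_class_in_L2[OF a(1)] ae_class_in_L2[OF a(2)]])
    also have "S (?c (\<lambda>z. c n * z powi n)) = ?c (\<lambda>z. c n * (z powi n * \<phi> z))"
      unfolding L2_hscale[OF L2_circle_powi, symmetric] L2_hscale[OF \<phi>p, symmetric] powi[symmetric]
      by (rule S_scale[OF ae_class_in_L2[OF L2_circle_powi]])
    also have "hadd ?H (?c (\<lambda>z. c n * (z powi n * \<phi> z))) (S (?c (trig_sum I c)))
        = ?c (\<lambda>z. trig_sum (insert n I) c z * \<phi> z)"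
      unfolding insert.IH[THEN conjunct2] L2_hadd[OF a(3,4)] tsp ..
    finally show ?case unfolding tsp using square_integrable_add[OF a(3,4)] by simp
  qed
  have main: "AE z in circle_haar. g z = \<phi> z * h z" 
    if h: "L2_circle h" and g: "L2_circle g" and Sg: "S (?c h) = ?c g" for h g
  proof -
    define q where "q N = trig_sum {- int N..int N} (fourier_coeff h)" for N
    have q: "L2_circle (q N)" for N unfolding q_def by (rule L2_circle_trig_sum) simp
    have q\<phi>: "L2_circle (\<lambda>z. q N z * \<phi> z)" and Sq: "S (?c (q N)) = ?c (\<lambda>z. q N z * \<phi> z)" for N
      unfolding q_def using trig by auto
    have lim: "(\<lambda>N. LINT z|circle_haar. (cmod (q N z - h z))\<^sup>2) \<longlonglongrightarrow> 0"
      unfolding q_def by (rule fourier_series_converges[OF h])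
    have le: "(LINT z|circle_haar. (cmod (q N z * \<phi> z - g z))\<^sup>2) \<le> C\<^sup>2 * (LINT z|circle_haar. (cmod (q N z - h z))\<^sup>2)" for N
    proof -
      have d: "L2_circle (\<lambda>z. q N z - h z)" "L2_circle (\<lambda>z. q N z * \<phi> z - g z)"
        by (rule square_integrable_diff q h q\<phi> g)+
      have sub: "?c (\<lambda>z. u z - v z) = hadd ?H (?c u) (hscale ?H (-1) (?c v))"
        if "L2_circle u" "L2_circle v" for u v
        by (simp add: L2_hscale that L2_hadd square_integrable_scale[of _ _ "-1", simplified])
      have "S (?c (\<lambda>z. q N z - h z)) = ?c (\<lambda>z. q N z * \<phi> z - g z)"
        unfolding sub[OF q h] sub[OF q\<phi> g] Sq[symmetric] Sg[symmetric]
        using S_add S_scale lin_closed_L2[of circle_haar] ae_class_in_L2[OF q] ae_class_in_L2[OF h]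
        by (simp add: lin_closed_def)
      then have "sqrt (LINT z|circle_haar. (cmod (q N z * \<phi> z - g z))\<^sup>2)
          \<le> C * sqrt (LINT z|circle_haar. (cmod (q N z - h z))\<^sup>2)"
        using C[OF ae_class_in_L2[OF d(1)]] by (simp add: L2_hnorm d)
      then have "(sqrt (LINT z|circle_haar. (cmod (q N z * \<phi> z - g z))\<^sup>2))\<^sup>2
          \<le> (C * sqrt (LINT z|circle_haar. (cmod (q N z - h z))\<^sup>2))\<^sup>2"
        by (rule power_mono) simp
      then show ?thesis by (simp add: power_mult_distrib)
    qed
    have lim2: "(\<lambda>N. LINT z|circle_haar. (cmod (q N z * \<phi> z - g z))\<^sup>2) \<longlonglongrightarrow> 0"
      by (rule tendsto_sandwich[OF _ _ tendsto_const tendsto_mult_right_zero[OF lim, of "C\<^sup>2"]])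
         (use le in auto)
    have l1: "(\<lambda>N. LINT z|circle_haar. cmod ((q N z - h z) * \<phi> z)) \<longlonglongrightarrow> 0"
      by (rule tendsto_L1_of_L2[OF square_integrable_diff[OF q h] \<phi> lim])
    have l2: "(\<lambda>N. LINT z|circle_haar. cmod ((q N z * \<phi> z - g z) * 1)) \<longlonglongrightarrow> 0"
      by (rule tendsto_L1_of_L2[OF square_integrable_diff[OF q\<phi> g] L2_circle_const lim2])
    have i: "integrable circle_haar (\<lambda>z. (q N z - h z) * \<phi> z)" "integrable circle_haar (\<lambda>z. q N z * \<phi> z - g z)"
      "integrable circle_haar (\<lambda>z. g z - \<phi> z * h z)" for N
      using square_integrable_mult_integrable[OF square_integrable_diff[OF q h] \<phi>]
        L2_circle_integrable[OF square_integrable_diff[OF q\<phi> g]]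
        L2_circle_integrable[OF g] square_integrable_mult_integrable[OF \<phi> h] by auto
    have "(LINT z|circle_haar. cmod (g z - \<phi> z * h z)) \<le> 0"
    proof (rule LIMSEQ_le_const[OF tendsto_add_zero[OF l1 l2]], intro exI allI impI)
      fix N
      have "(LINT z|circle_haar. cmod (g z - \<phi> z * h z))
          \<le> (LINT z|circle_haar. cmod ((q N z - h z) * \<phi> z) + cmod ((q N z * \<phi> z - g z) * 1))"
      proof (rule integral_mono)
        fix z
        have "g z - \<phi> z * h z = (q N z - h z) * \<phi> z - (q N z * \<phi> z - g z)" by (simp add: algebra_simps)
        then show "cmod (g z - \<phi> z * h z) \<le> cmod ((q N z - h z) * \<phi> z) + cmod ((q N z * \<phi> z - g z) * 1)"
          by (metis mult.right_neutral norm_triangle_ineq4)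
      qed (use i in simp_all)
      also have "\<dots> = (LINT z|circle_haar. cmod ((q N z - h z) * \<phi> z)) + (LINT z|circle_haar. cmod ((q N z * \<phi> z - g z) * 1))"
        using i by (intro Bochner_Integration.integral_add) simp_all
      finally show "(LINT z|circle_haar. cmod (g z - \<phi> z * h z)) \<le> (LINT z|circle_haar. cmod ((q N z - h z) * \<phi> z))
          + (LINT z|circle_haar. cmod ((q N z * \<phi> z - g z) * 1))" .
    qed
    then have "(LINT z|circle_haar. cmod (g z - \<phi> z * h z)) = 0" by (simp add: order_antisym)
    then have "AE z in circle_haar. cmod (g z - \<phi> z * h z) = 0"
      using integral_nonneg_eq_0_iff_AE[OF integrable_norm[OF i(3)]] by simp
    then show ?thesis by eventually_elim simp
  qed
  have main': "\<exists>g. L2_circle g \<and> S (?c h) = ?c g \<and> (AE z in circle_haar. g z = \<phi> z * h z)" if h: "L2_circle h" for h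
    using bounded_ops_closed[OF S ae_class_in_L2[OF h]] main[OF h] by (auto simp: L2_carrier_iff)
  show "\<phi> \<in> Linf_funs circle_haar"
  proof (rule Linf_of_bounded_multiplier[OF finite_circle_haar square_integrable_measurable[OF \<phi>]])
    fix h assume h: "L2_circle h"
    have m: "(\<lambda>z. (cmod (\<phi> z * h z))\<^sup>2) \<in> borel_measurable circle_haar"
      by (intro borel_measurable_power measurable_compose[OF borel_measurable_times[OF
            square_integrable_measurable[OF \<phi>] square_integrable_measurable[OF h]] borel_measurable_norm])
    obtain g where g: "L2_circle g" "S (?c h) = ?c g" "AE z in circle_haar. g z = \<phi> z * h z"
      using main'[OF h] by blast
    have ae: "AE z in circle_haar. (cmod (\<phi> z * h z))\<^sup>2 = (cmod (g z))\<^sup>2" using g(3) by eventually_elim simp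
    have gm: "(\<lambda>z. (cmod (g z))\<^sup>2) \<in> borel_measurable circle_haar" using square_integrable_norm[OF g(1)] by simp
    have "sqrt (LINT z|circle_haar. (cmod (g z))\<^sup>2) \<le> C * sqrt (LINT z|circle_haar. (cmod (h z))\<^sup>2)"
      using C[OF ae_class_in_L2[OF h]] by (simp add: g L2_hnorm h)
    then have "(sqrt (LINT z|circle_haar. (cmod (g z))\<^sup>2))\<^sup>2 \<le> (C * sqrt (LINT z|circle_haar. (cmod (h z))\<^sup>2))\<^sup>2"
      by (rule power_mono) simp
    then show "integrable circle_haar (\<lambda>z. (cmod (\<phi> z * h z))\<^sup>2) \<and>
      (LINT z|circle_haar. (cmod (\<phi> z * h z))\<^sup>2) \<le> C\<^sup>2 * (LINT z|circle_haar. (cmod (h z))\<^sup>2)"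
      using integral_cong_AE[OF m gm ae] integrable_cong_AE[OF m gm ae] square_integrable_norm[OF g(1)]
      by (simp add: power_mult_distrib)
  qed
  show "S = mult_operator circle_haar \<phi>"
  proof (rule mult_operator_eqI[OF bounded_ops_ext[OF S]])
    fix h assume "L2_circle h"
    then show "S (?c h) = ?c (\<lambda>z. \<phi> z * h z)" using main'[of h] ae_class_eqI by metis
  qed
qed

text \<open>
  On the side of \<open>L\<^sup>2\<close> of the circle the shifts become multiplications by powers of \<open>z\<close>, so an operator
  in the commutant is multiplication by a bounded function \<open>\<phi>\<close>. Its coefficient at \<open>j\<close> is the matrix entry
  between the basis vectors at 0 and \<open>j\<close>, on which an element \<open>b\<close> of the abelian group acts by the scalars
  \<open>chi b\<close> and \<open>chi (\<alpha>\<^sup>j b)\<close>. Commutation therefore means that the coefficient vanishes unless these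
  agree for all \<open>b\<close>, that is unless \<open>p\<close> divides \<open>j\<close>. This says that \<open>\<phi>\<close> is a function of \<open>z ^ p\<close>.
\<close>

proposition commutant_eq:
  assumes \<alpha>: "automorphism \<alpha>" and chi: "chi \<in> characters" and p: "minimal_period \<alpha> chi p"
  shows "commutant (ind_space chi) (ind_rep \<alpha>)
    = transport (L2_space circle_haar) (ind_space chi) (fourier_map chi) ` power_mult_algebra p"
proof -
  let ?H = "L2_space circle_haar" and ?K = "ind_space chi" and ?V = "fourier_map chi"
    and ?c = "ae_class circle_haar" and ?e = "equivariant_ext chi"
  note V = fourier_map_unitary[OF chi]
  note per = minimal_period_iff[OF \<alpha> p]
  have p0: "0 < p" using p by (simp add: minimal_period_def has_period_def)
  note char = character_simps[OF chi] and ext0 = equivariant_ext_0[OF chi]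
  show ?thesis
  proof (intro equalityI subsetI)
    fix T assume "T \<in> transport ?H ?K ?V ` power_mult_algebra p"
    then obtain f where f: "f \<in> Linf_funs circle_haar"
      and T: "T = transport ?H ?K ?V (mult_operator circle_haar (\<lambda>z. f (z ^ p)))"
      by (auto simp: power_mult_algebra_eq)
    define \<phi> where "\<phi> z = f (z ^ p)" for z
    have \<phi>: "\<phi> \<in> Linf_funs circle_haar" unfolding \<phi>_def by (rule Linf_power[OF f p0])
    have supp: "fourier_coeff \<phi> n = 0" if "\<not> int p dvd n" for n
      using that fourier_coeff_power[OF L2_circle_Linf[OF f] p0, of n] by (simp add: \<phi>_def[abs_def])
    have Tb: "T \<in> bounded_ops ?K"
      unfolding T by (rule transport_bounded_ops[OF V lin_closed_L2 mult_operator_bounded[OF \<phi>[unfolded \<phi>_def]]])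
    have Te: "T (?e (fourier_coeff h)) = ?e (fourier_coeff (\<lambda>z. \<phi> z * h z))" if h: "L2_circle h" for h
    proof -
      have "T (?V (?c h)) = ?V (mult_operator circle_haar \<phi> (?c h))"
        unfolding T \<phi>_def by (rule transport_apply[OF V ae_class_in_L2[OF h]])
      then show ?thesis
        by (simp add: mult_operator_ae_class h fourier_map_ae_class square_integrable_mult_Linf[OF \<phi> h])
    qed
    have "T (ind_rep \<alpha> (k, c) F) = ind_rep \<alpha> (k, c) (T F)" if F: "F \<in> hcarrier ?K" for k c F
    proof -
      obtain x where x: "l2_seq x" "F = ?e x" using F by (auto simp: ind_carrier_iff[OF chi])
      obtain h where h: "L2_circle h" "fourier_coeff h = x" using l2_seq_is_fourier_coeff[OF x(1)] .
      obtain h' where h': "L2_circle h'" "fourier_coeff h' = (\<lambda>j. chi (int_iter \<alpha> j c) * x (j + k))"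
        using l2_seq_is_fourier_coeff[OF l2_seq_twist_shift[OF chi x(1)]] .
      \<comment> \<open>Both sides are convolutions with the coefficients of phi; they agree term by term, because the twisting factors at m and n agree where the coefficient of phi at n - m is not zero.\<close>
      have "fourier_coeff (\<lambda>z. \<phi> z * h' z) n = chi (int_iter \<alpha> n c) * fourier_coeff (\<lambda>z. \<phi> z * h z) (n + k)" for n
      proof (rule has_sum_unique)
        show "((\<lambda>m. fourier_coeff h' m * fourier_coeff \<phi> (n - m)) has_sum fourier_coeff (\<lambda>z. \<phi> z * h' z) n) UNIV"
          by (rule fourier_coeff_mult_Linf[OF \<phi> h'(1)])
        have b: "bij_betw (\<lambda>j::int. j + k) UNIV UNIV"
          by (rule bij_betwI[where g = "\<lambda>j. j - k"]) auto
        have "((\<lambda>m. x (m + k) * fourier_coeff \<phi> (n + k - (m + k))) has_sum fourier_coeff (\<lambda>z. \<phi> z * h z) (n + k)) UNIV"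
          using fourier_coeff_mult_Linf[OF \<phi> h(1), of "n + k"]
            has_sum_reindex_bij_betw[OF b, of "\<lambda>m. x m * fourier_coeff \<phi> (n + k - m)"] by (simp add: h(2))
        then have "((\<lambda>m. chi (int_iter \<alpha> n c) * (x (m + k) * fourier_coeff \<phi> (n - m)))
            has_sum chi (int_iter \<alpha> n c) * fourier_coeff (\<lambda>z. \<phi> z * h z) (n + k)) UNIV"
          by (intro has_sum_cmult_right) simp
        moreover have "chi (int_iter \<alpha> n c) * (x (m + k) * fourier_coeff \<phi> (n - m))
            = fourier_coeff h' m * fourier_coeff \<phi> (n - m)" for m
        proof (cases "int p dvd n - m")
          case True
          then have "chi (int_iter \<alpha> (n - m) (int_iter \<alpha> m c)) = chi (int_iter \<alpha> m c)"
            using per by blast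
          then have "chi (int_iter \<alpha> n c) = chi (int_iter \<alpha> m c)"
            by (simp add: int_iter_add[OF automorphism_bij[OF \<alpha>], symmetric])
          then show ?thesis by (simp add: h')
        qed (simp add: supp)
        ultimately show "((\<lambda>m. fourier_coeff h' m * fourier_coeff \<phi> (n - m))
            has_sum chi (int_iter \<alpha> n c) * fourier_coeff (\<lambda>z. \<phi> z * h z) (n + k)) UNIV" by simp
      qed
      then have eq: "fourier_coeff (\<lambda>z. \<phi> z * h' z) = (\<lambda>n. chi (int_iter \<alpha> n c) * fourier_coeff (\<lambda>z. \<phi> z * h z) (n + k))"
        by blast
      have "T (ind_rep \<alpha> (k, c) F) = ?e (fourier_coeff (\<lambda>z. \<phi> z * h' z))"
        using Te[OF h'(1)] by (simp add: x(2) ind_rep_equivariant_ext[OF chi] h'(2))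
      also have "\<dots> = ind_rep \<alpha> (k, c) (T F)"
        using Te[OF h(1)] by (simp add: x(2) h(2) eq ind_rep_equivariant_ext[OF chi])
      finally show ?thesis .
    qed
    then show "T \<in> commutant ?K (ind_rep \<alpha>)" using Tb by (auto simp: commutant_def)
  next
    fix T assume "T \<in> commutant ?K (ind_rep \<alpha>)"
    then have T: "T \<in> bounded_ops ?K" and comm: "\<And>k c F. F \<in> hcarrier ?K \<Longrightarrow> T (ind_rep \<alpha> (k, c) F) = ind_rep \<alpha> (k, c) (T F)"
      by (auto simp: commutant_def)
    define S where "S = transport ?K ?H (inv_into (hcarrier ?H) ?V) T"
    note W = unitary_map_inv[OF V lin_closed_L2]
    have S: "S \<in> bounded_ops ?H" unfolding S_def by (rule transport_bounded_ops[OF W T])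
    have TS: "T = transport ?H ?K ?V S" unfolding S_def by (rule transport_inverse'[OF V lin_closed_L2 T, symmetric])
    have TV: "T (?V X) = ?V (S X)" if "X \<in> hcarrier ?H" for X
      unfolding TS by (rule transport_apply[OF V that])
    have one: "L2_circle (\<lambda>_. 1)" by (rule L2_circle_const)
    obtain \<phi> where \<phi>: "L2_circle \<phi>" "S (?c (\<lambda>_. 1)) = ?c \<phi>"
      using bounded_ops_closed[OF S ae_class_in_L2[OF one]] by (auto simp: L2_carrier_iff)
    have delta: "fourier_coeff (\<lambda>_. 1) = (\<lambda>j. if j = 0 then 1 else 0)"
      using fourier_coeff_powi[of 0] by (auto simp: fun_eq_iff)
    have T1: "T (?e (\<lambda>j. if j = 0 then 1 else 0)) = ?e (fourier_coeff \<phi>)"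
      using TV[OF ae_class_in_L2[OF one]] by (simp add: fourier_map_ae_class one \<phi> delta)
    have d: "?e (\<lambda>j. if j = 0 then 1 else 0) \<in> hcarrier ?K"
      using equivariant_ext_in[OF chi l2_seq_fourier_coeff[OF one]] by (simp add: delta)
    have "S (?c (\<lambda>z. z powi k)) = ?c (\<lambda>z. z powi k * \<phi> z)" for k
    proof -
      have \<phi>k: "L2_circle (\<lambda>z. z powi k * \<phi> z)" by (rule square_integrable_mult_Linf[OF Linf_powi \<phi>(1)])
      note in1 = ae_class_in_L2[OF L2_circle_powi[of k]]
      \<comment> \<open>The monomial is the image of the constant 1 under the shift (- k, 0), with which T commutes.\<close>
      have "?V (S (?c (\<lambda>z. z powi k))) = T (?e (fourier_coeff (\<lambda>z. z powi k)))"
        unfolding TV[OF in1, symmetric] fourier_map_ae_class[OF L2_circle_powi] ..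
      also have "?e (fourier_coeff (\<lambda>z. z powi k)) = ind_rep \<alpha> (- k, 0) (?e (\<lambda>j. if j = 0 then 1 else 0))"
        unfolding ind_rep_equivariant_ext[OF chi] int_iter_zero[OF \<alpha>]
        by (rule arg_cong[where f = ?e]) (auto simp: fun_eq_iff fourier_coeff_powi char(1))
      also have "T \<dots> = ind_rep \<alpha> (- k, 0) (?e (fourier_coeff \<phi>))"
        unfolding comm[OF d] T1 ..
      also have "\<dots> = ?e (fourier_coeff (\<lambda>z. z powi k * \<phi> z))"
        unfolding ind_rep_equivariant_ext[OF chi] int_iter_zero[OF \<alpha>]
        by (rule arg_cong[where f = ?e]) (auto simp: fun_eq_iff fourier_coeff_mult_powi char(1))
      also have "\<dots> = ?V (?c (\<lambda>z. z powi k * \<phi> z))" by (simp only: fourier_map_ae_class[OF \<phi>k])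
      finally show ?thesis
        using V bounded_ops_closed[OF S in1] ae_class_in_L2[OF \<phi>k]
        unfolding unitary_map_def bij_betw_def by (meson inj_onD)
    qed
    note mult = bounded_op_is_mult_operator[OF S \<phi>(1) this]
    have "fourier_coeff \<phi> j = 0" if j: "\<not> int p dvd j" for j
    proof -
      obtain c where c: "chi (int_iter \<alpha> j c) \<noteq> chi c" using per[of j] j by blast
      \<comment> \<open>The basis vector at 0 is an eigenvector of (0, c), so its image under T is one for the same eigenvalue.\<close>
      have "ind_rep \<alpha> (0, c) (?e (\<lambda>j. if j = 0 then 1 else 0)) = hscale ?K (chi c) (?e (\<lambda>j. if j = 0 then 1 else 0))"
        unfolding ind_rep_equivariant_ext[OF chi] ind_hscale
        by (rule arg_cong[where f = ?e]) (auto simp: fun_eq_iff)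
      then have "ind_rep \<alpha> (0, c) (?e (fourier_coeff \<phi>)) = hscale ?K (chi c) (?e (fourier_coeff \<phi>))"
        using comm[OF d, of 0 c] T d by (auto simp: T1 bounded_ops_def)
      then have "(\<lambda>j. chi (int_iter \<alpha> j c) * fourier_coeff \<phi> j) = (\<lambda>j. chi c * fourier_coeff \<phi> j)"
        by (simp add: ind_rep_equivariant_ext[OF chi] ind_hscale equivariant_ext_inject[OF chi])
      then have "chi (int_iter \<alpha> j c) * fourier_coeff \<phi> j = chi c * fourier_coeff \<phi> j" by metis
      then show ?thesis using c by simp
    qed
    then obtain f where f: "f \<in> Linf_funs circle_haar" and ae: "AE z in circle_haar. \<phi> z = f (z ^ p)"
      using Linf_function_of_power[OF mult(1) p0] by blast
    have "S = mult_operator circle_haar (\<lambda>z. f (z ^ p))"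
      unfolding mult(2) by (rule mult_operator_cong_AE[OF ae])
    then have "S \<in> power_mult_algebra p" using f by (auto simp: power_mult_algebra_def)
    then show "T \<in> transport ?H ?K ?V ` power_mult_algebra p" using TS by blast
  qed
qed

proposition commutant_star_isomorphic:
  assumes \<alpha>: "automorphism \<alpha>" and chi: "chi \<in> characters" and p: "minimal_period \<alpha> chi p"
  shows "star_isomorphic (ind_space chi) (commutant (ind_space chi) (ind_rep \<alpha>))
    (L2_space circle_haar) (power_mult_algebra p)"
proof -
  have p0: "0 < p" using p by (simp add: minimal_period_def has_period_def)
  show ?thesis
    unfolding commutant_eq[OF assms]
  proof (rule star_isomorphic_transport[OF fourier_map_unitary[OF chi] lin_closed_L2])
    show "star_algebra (L2_space circle_haar) (power_mult_algebra p)"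
      using abelian_algebra_power_mult[OF p0] by (simp add: abelian_algebra_def)
    fix T assume "T \<in> power_mult_algebra p"
    then obtain f where f: "f \<in> Linf_funs circle_haar" and T: "T = mult_operator circle_haar (\<lambda>z. f (z ^ p))"
      by (auto simp: power_mult_algebra_def)
    show "\<exists>S. is_adjoint (L2_space circle_haar) T S \<and> (\<forall>S'. is_adjoint (L2_space circle_haar) T S' \<longrightarrow> S' = S)"
      unfolding T by (rule mult_operator_adjoint_unique[OF Linf_power[OF f p0]])
  qed
qed

section \<open>Irreducibility\<close>

text \<open>
  Outside a large finite set the sum of the majorant is small; on the finite set the convergence is
  that of a finite sum.
\<close>

lemma infsum_dominated_null:
  fixes a :: "nat \<Rightarrow> 'a \<Rightarrow> real"
  assumes w: "w summable_on UNIV" and a: "\<And>n j. 0 \<le> a n j" "\<And>n j. a n j \<le> w j"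
    and lim: "\<And>j. (\<lambda>n. a n j) \<longlonglongrightarrow> 0"
  shows "(\<lambda>n. \<Sum>\<^sub>\<infinity>j. a n j) \<longlonglongrightarrow> 0"
proof -
  have w0: "0 \<le> w j" for j using a[of 0 j] by linarith
  have sa: "a n summable_on S" for n S
    by (rule summable_on_comparison_test[OF summable_on_subset_banach[OF w]]) (use a in auto)
  have sw: "w summable_on S" for S by (rule summable_on_subset_banach[OF w]) simp
  show ?thesis
  proof (rule LIMSEQ_I)
    fix e :: real assume "0 < e"
    then have e: "0 < e / 2" by simp
    obtain S where S: "finite S" "dist (sum w S) (infsum w UNIV) \<le> e / 4"
      using infsum_finite_approximation[OF w, of "e / 4"] \<open>0 < e\<close> by auto
    have "infsum w UNIV = infsum w S + infsum w (- S)"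
      using infsum_Un_disjoint[OF sw sw, of S "- S"] by simp
    then have tail: "infsum w (- S) \<le> e / 4"
      using S by (simp add: dist_real_def)
    have "(\<lambda>n. \<Sum>j\<in>S. a n j) \<longlonglongrightarrow> (\<Sum>j\<in>S. 0)" by (intro tendsto_sum lim)
    then have "(\<lambda>n. \<Sum>j\<in>S. a n j) \<longlonglongrightarrow> 0" by simp
    from LIMSEQ_D[OF this e] obtain N where N: "\<And>n. N \<le> n \<Longrightarrow> norm ((\<Sum>j\<in>S. a n j) - 0) < e / 2" by blast
    have "norm ((\<Sum>\<^sub>\<infinity>j. a n j) - 0) < e" if "N \<le> n" for n
    proof -
      have "infsum (a n) UNIV = infsum (a n) S + infsum (a n) (- S)"
        using infsum_Un_disjoint[of "a n" S "- S"] sa by simp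
      moreover have "infsum (a n) (- S) \<le> infsum w (- S)" by (rule infsum_mono[OF sa sw a(2)])
      moreover have "0 \<le> infsum (a n) UNIV" by (rule infsum_nonneg) (rule a)
      ultimately show ?thesis using N[OF that] S(1) tail \<open>0 < e\<close> by simp
    qed
    then show "\<exists>N. \<forall>n\<ge>N. norm ((\<Sum>\<^sub>\<infinity>j. a n j) - 0) < e" by blast
  qed
qed

lemma l2_seq_bounded:
  assumes "l2_seq x" and "\<And>j. cmod (y j) \<le> cmod (x j)"
  shows "l2_seq y"
  unfolding l2_seq_def
  by (rule summable_on_comparison_test[OF assms(1)[unfolded l2_seq_def]]) (simp_all add: power_mono assms(2))

lemma l2_seq_add:
  assumes "l2_seq x" and "l2_seq y"
  shows "l2_seq (\<lambda>j. x j + y j)"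
  unfolding l2_seq_def
proof (rule summable_on_comparison_test)
  show "(\<lambda>j. 2 * (cmod (x j))\<^sup>2 + 2 * (cmod (y j))\<^sup>2) summable_on UNIV"
    using assms by (intro summable_on_add summable_on_cmult_right) (auto simp: l2_seq_def)
qed (auto simp: cmod_add_power2_le)

lemma l2_seq_scale: "l2_seq x \<Longrightarrow> l2_seq (\<lambda>j. c * x j)"
  by (simp add: l2_seq_def norm_mult power_mult_distrib summable_on_cmult_right)

lemma l2_seq_finite_support:
  assumes "finite S" and "\<And>j. j \<notin> S \<Longrightarrow> x j = 0"
  shows "l2_seq x"
proof -
  have "(\<lambda>j. (cmod (x j))\<^sup>2) summable_on UNIV \<longleftrightarrow> (\<lambda>j. (cmod (x j))\<^sup>2) summable_on S"
    by (rule summable_on_cong_neutral) (use assms(2) in auto)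
  then show ?thesis using assms(1) by (simp add: l2_seq_def)
qed

lemma ind_hnorm:
  assumes chi: "chi \<in> characters" and x: "l2_seq x"
  shows "hnorm (ind_space chi) (equivariant_ext chi x) = sqrt (\<Sum>\<^sub>\<infinity>j. (cmod (x j))\<^sup>2)"
proof -
  have "((\<lambda>j. complex_of_real ((cmod (x j))\<^sup>2)) has_sum complex_of_real (\<Sum>\<^sub>\<infinity>j. (cmod (x j))\<^sup>2)) UNIV"
    by (rule has_sum_of_real[OF has_sum_infsum[OF x[unfolded l2_seq_def]]])
  then have "(\<Sum>\<^sub>\<infinity>j. x j * cnj (x j)) = complex_of_real (\<Sum>\<^sub>\<infinity>j. (cmod (x j))\<^sup>2)"
    unfolding complex_norm_square by (rule infsumI)
  then show ?thesis by (simp add: hnorm_def ind_hinner[OF chi])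
qed

lemma ind_hdist:
  assumes chi: "chi \<in> characters" and x: "l2_seq x" and y: "l2_seq y"
  shows "hdist (ind_space chi) (equivariant_ext chi x) (equivariant_ext chi y)
    = sqrt (\<Sum>\<^sub>\<infinity>j. (cmod (x j - y j))\<^sup>2)"
  using ind_hnorm[OF chi l2_seq_add[OF x l2_seq_scale[OF y, of "-1"]]]
  by (simp add: hdist_def ind_hscale ind_hadd)

text \<open>
  The midpoint of two different points of the unit circle lies in the open disc. In the next proof the
  powers of such averages converge to a projection.
\<close>

lemma norm_half_one_plus:
  assumes "cmod u = 1"
  shows "cmod ((1 + u) / 2) \<le> 1" and "u \<noteq> 1 \<Longrightarrow> cmod ((1 + u) / 2) < 1"
proof -
  show "cmod ((1 + u) / 2) \<le> 1"
    using norm_triangle_ineq[of 1 u] assms by (simp add: norm_divide)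
  assume "u \<noteq> 1"
  have n: "(Re u)\<^sup>2 + (Im u)\<^sup>2 = 1" using assms by (simp add: cmod_power2[symmetric])
  have "Re u \<le> 1" using complex_Re_le_cmod[of u] assms by simp
  moreover have "Re u \<noteq> 1"
  proof
    assume "Re u = 1"
    then have "u = 1" using n by (simp add: complex_eq_iff)
    then show False using \<open>u \<noteq> 1\<close> by simp
  qed
  ultimately have "Re u < 1" by simp
  moreover have "(cmod ((1 + u) / 2))\<^sup>2 = (2 + 2 * Re u) / 4"
    using n unfolding cmod_power2 by (simp add: power2_eq_square field_simps)
  ultimately have "(cmod ((1 + u) / 2))\<^sup>2 < 1\<^sup>2" by simp
  then show "cmod ((1 + u) / 2) < 1" by (rule power_less_imp_less_base) simp
qed

text \<open>
  For \<open>i \<noteq> 0\<close> some element \<open>c\<close> of the abelian group acts by different scalars on the basis vectors at 0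
  and \<open>i\<close>. The average of the identity and the suitably normalised action of \<open>c\<close> fixes the entry at 0
  and has factors of modulus at most 1 everywhere, strictly less at \<open>i\<close>. Its powers converge
  strongly to a projection onto coordinates which keeps the entry at 0 and kills the one at \<open>i\<close>. So an
  invariant closed subspace with a vector that does not vanish at 0 contains such vectors supported on ever
  smaller sets, hence the basis vector at 0, hence by shifting all basis vectors.
\<close>

proposition aperiodic_imp_irreducible:
  assumes \<alpha>: "automorphism \<alpha>" and chi: "chi \<in> characters" and ap: "aperiodic \<alpha> chi"
  shows "irreducible_rep (ind_space chi) (ind_rep \<alpha>)"
proof -
  let ?H = "ind_space chi" and ?e = "equivariant_ext chi"
  define \<delta> :: "int \<Rightarrow> int \<Rightarrow> complex" where "\<delta> k j = (if j = k then 1 else 0)" for k j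
  have l2_\<delta>: "l2_seq (\<lambda>j. c * \<delta> k j)" for c k
    by (rule l2_seq_finite_support[of "{k}"]) (auto simp: \<delta>_def)
  have sep: "\<exists>c. chi (int_iter \<alpha> i c) \<noteq> chi c" if i: "i \<noteq> 0" for i
  proof (rule ccontr)
    assume "\<nexists>c. chi (int_iter \<alpha> i c) \<noteq> chi c"
    then have "\<forall>c. chi (int_iter \<alpha> (int (nat \<bar>i\<bar>)) c) = chi c"
      using int_period_uminus[OF automorphism_bij[OF \<alpha>], of chi i] by (cases "0 \<le> i") auto
    then have "has_period \<alpha> chi (nat \<bar>i\<bar>)" using i by (simp only: int_period_of_nat has_period_def) auto
    then show False using ap by (auto simp: aperiodic_def)
  qed
  have dichotomy: "M = {hzero ?H} \<or> M = hcarrier ?H"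
    if cl: "closed_subspace ?H M" and inv: "\<forall>g. \<forall>F\<in>M. ind_rep \<alpha> g F \<in> M" for M
  proof (rule disjCI)
    assume ne: "M \<noteq> hcarrier ?H"
    have M_sub: "M \<subseteq> hcarrier ?H" and M_zero: "hzero ?H \<in> M"
      and M_add: "\<And>F F'. F \<in> M \<Longrightarrow> F' \<in> M \<Longrightarrow> hadd ?H F F' \<in> M"
      and M_scale: "\<And>c F. F \<in> M \<Longrightarrow> hscale ?H c F \<in> M"
      and M_closed: "\<And>X F. (\<And>n::nat. X n \<in> M) \<Longrightarrow> F \<in> hcarrier ?H \<Longrightarrow> (\<lambda>n. hdist ?H (X n) F) \<longlonglongrightarrow> 0 \<Longrightarrow> F \<in> M"
      using cl unfolding closed_subspace_def by blast+
    define A where "A = {x. l2_seq x \<and> ?e x \<in> M}"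
    have A_l2: "l2_seq x" if "x \<in> A" for x using that by (simp add: A_def)
    have A_add: "(\<lambda>j. x j + y j) \<in> A" if "x \<in> A" "y \<in> A" for x y
      using M_add[of "?e x" "?e y"] that by (simp add: A_def ind_hadd l2_seq_add)
    have A_scale: "(\<lambda>j. c * x j) \<in> A" if "x \<in> A" for c x
      using M_scale[of "?e x" c] that by (simp add: A_def ind_hscale l2_seq_scale)
    have A_zero: "(\<lambda>_. 0) \<in> A"
      using M_zero l2_seq_finite_support[of "{}" "\<lambda>_. 0"] by (simp add: A_def ind_hzero)
    have A_rep: "(\<lambda>j. chi (int_iter \<alpha> j c) * x (j + k)) \<in> A" if "x \<in> A" for c k x
      using inv[rule_format, of "?e x" "(k, c)"] that l2_seq_twist_shift[OF chi, of x]
      by (simp add: A_def ind_rep_equivariant_ext[OF chi])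
    have A_shift: "(\<lambda>j. x (j + k)) \<in> A" if "x \<in> A" for k x
      using A_rep[OF that, of 0 k] by (simp add: int_iter_zero[OF \<alpha>] character_simps(1)[OF chi])
    have A_lim: "y \<in> A" if x: "\<And>n. x n \<in> A" and w: "l2_seq w" and y: "l2_seq y"
      and le: "\<And>n j. cmod (x n j - y j) \<le> cmod (w j)" and lim: "\<And>j. (\<lambda>n. x n j) \<longlonglongrightarrow> y j"
      for x :: "nat \<Rightarrow> int \<Rightarrow> complex" and y w
    proof -
      have "(\<lambda>n. \<Sum>\<^sub>\<infinity>j. (cmod (x n j - y j))\<^sup>2) \<longlonglongrightarrow> 0"
      proof (rule infsum_dominated_null[OF w[unfolded l2_seq_def]])
        show "(cmod (x n j - y j))\<^sup>2 \<le> (cmod (w j))\<^sup>2" for n j by (intro power_mono le) simp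
        show "(\<lambda>n. (cmod (x n j - y j))\<^sup>2) \<longlonglongrightarrow> 0" for j
          using tendsto_power[OF tendsto_norm[OF tendsto_diff[OF lim[of j] tendsto_const[of "y j"]]], of 2] by simp
      qed simp
      then have "(\<lambda>n. sqrt (\<Sum>\<^sub>\<infinity>j. (cmod (x n j - y j))\<^sup>2)) \<longlonglongrightarrow> 0"
        using tendsto_real_sqrt by fastforce
      then have "(\<lambda>n. hdist ?H (?e (x n)) (?e y)) \<longlonglongrightarrow> 0"
        by (simp add: ind_hdist[OF chi A_l2[OF x] y])
      then have "?e y \<in> M"
        using M_closed[of "\<lambda>n. ?e (x n)" "?e y"] x equivariant_ext_in[OF chi y] by (simp add: A_def)
      then show ?thesis using y by (simp add: A_def)
    qed
    have kill: "\<exists>y\<in>A. y 0 = x 0 \<and> y i = 0 \<and> (\<forall>j. y j = x j \<or> y j = 0)" if x: "x \<in> A" and i: "i \<noteq> 0" for x i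
    proof -
      obtain c where c: "chi (int_iter \<alpha> i c) \<noteq> chi c" using sep[OF i] by blast
      \<comment> \<open>The action of (0, c), normalised to be trivial at 0.\<close>
      define u where "u j = cnj (chi c) * chi (int_iter \<alpha> j c)" for j
      have cc: "cnj (chi c) * chi c = 1"
        using character_simps(2)[OF chi, of c] complex_norm_square[of "chi c"] by (simp add: mult.commute)
      have u: "cmod (u j) = 1" for j by (simp add: u_def norm_mult character_simps(2)[OF chi])
      have u0: "u 0 = 1" by (simp add: u_def cc)
      have ui: "u i \<noteq> 1"
      proof
        assume "u i = 1"
        then have "chi c * (cnj (chi c) * chi (int_iter \<alpha> i c)) = chi c * 1" by (simp add: u_def)
        then have "(cnj (chi c) * chi c) * chi (int_iter \<alpha> i c) = chi c" by (simp add: mult_ac)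
        then show False using c cc by simp
      qed
      define xn where "xn n j = ((1 + u j) / 2) ^ n * x j" for n j
      have xA: "xn n \<in> A" for n
      proof (induction n)
        case 0
        then show ?case using x by (simp add: xn_def[abs_def])
      next
        case (Suc n)
        have "(\<lambda>j. 1/2 * xn n j + cnj (chi c) / 2 * (chi (int_iter \<alpha> j c) * xn n (j + 0))) \<in> A"
          by (rule A_add[OF A_scale[OF Suc] A_scale[OF A_rep[OF Suc]]])
        also have "(\<lambda>j. 1/2 * xn n j + cnj (chi c) / 2 * (chi (int_iter \<alpha> j c) * xn n (j + 0))) = xn (Suc n)"
          by (rule ext) (simp add: xn_def u_def field_simps)
        finally show ?case .
      qed
      define y where "y j = (if u j = 1 then x j else 0)" for j
      have "y \<in> A"
      proof (rule A_lim[OF xA A_l2[OF x]])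
        show "l2_seq y" by (rule l2_seq_bounded[OF A_l2[OF x]]) (simp add: y_def)
        show "cmod (xn n j - y j) \<le> cmod (x j)" for n j
        proof (cases "u j = 1")
          case False
          have "cmod ((1 + u j) / 2) ^ n * cmod (x j) \<le> 1 * cmod (x j)"
            by (intro mult_right_mono power_le_one norm_half_one_plus(1)[OF u]) simp_all
          then show ?thesis using False by (simp add: xn_def y_def norm_mult norm_power)
        qed (simp add: xn_def y_def)
        show "(\<lambda>n. xn n j) \<longlonglongrightarrow> y j" for j
        proof (cases "u j = 1")
          case False
          have "(\<lambda>n. ((1 + u j) / 2) ^ n) \<longlonglongrightarrow> 0"
            by (rule LIMSEQ_power_zero) (rule norm_half_one_plus(2)[OF u False])
          then show ?thesis using False tendsto_mult_left_zero[of "\<lambda>n. ((1 + u j) / 2) ^ n"]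
            by (simp add: xn_def y_def)
        qed (simp add: xn_def y_def)
      qed
      then show ?thesis by (intro bexI[of _ y]) (auto simp: y_def u0 ui)
    qed
    have kill_finite: "\<exists>y\<in>A. y 0 = x 0 \<and> (\<forall>j\<in>S. y j = 0) \<and> (\<forall>j. y j = x j \<or> y j = 0)"
      if x: "x \<in> A" and "finite S" "0 \<notin> S" for x S
      using that(2,3)
    proof (induction S rule: finite_induct)
      case empty
      then show ?case using x by blast
    next
      case (insert i S)
      then obtain y where y: "y \<in> A" "y 0 = x 0" "\<forall>j\<in>S. y j = 0" "\<forall>j. y j = x j \<or> y j = 0" by auto
      obtain y' where y': "y' \<in> A" "y' 0 = y 0" "y' i = 0" "\<forall>j. y' j = y j \<or> y' j = 0"
        using kill[OF y(1), of i] insert by auto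
      show ?case
      proof (intro bexI[OF _ y'(1)] conjI ballI allI)
        show "y' 0 = x 0" using y y' by simp
        show "y' j = 0" if "j \<in> insert i S" for j using that y(3) y'(3,4) by (metis insertE)
        show "y' j = x j \<or> y' j = 0" for j using y(4) y'(4) by metis
      qed
    qed
    have \<delta>A: "(\<lambda>j. x 0 * \<delta> 0 j) \<in> A" if x: "x \<in> A" for x
    proof -
      have "\<exists>y\<in>A. y 0 = x 0 \<and> (\<forall>j\<in>{- int N..int N} - {0}. y j = 0) \<and> (\<forall>j. y j = x j \<or> y j = 0)" for N
        by (rule kill_finite[OF x]) auto
      then obtain y where y: "\<And>N. y N \<in> A" "\<And>N. y N 0 = x 0"
        "\<And>N j. j \<in> {- int N..int N} - {0} \<Longrightarrow> y N j = 0" "\<And>N j. y N j = x j \<or> y N j = 0"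
        by metis
      show ?thesis
      proof (rule A_lim[OF y(1) A_l2[OF x] l2_\<delta>])
        show "cmod (y N j - x 0 * \<delta> 0 j) \<le> cmod (x j)" for N j
          using y(2)[of N] y(4)[of N j] by (cases "j = 0") (auto simp: \<delta>_def)
        show "(\<lambda>N. y N j) \<longlonglongrightarrow> x 0 * \<delta> 0 j" for j
        proof (rule tendsto_eventually)
          show "\<forall>\<^sub>F N in sequentially. y N j = x 0 * \<delta> 0 j"
            using eventually_ge_at_top[of "nat \<bar>j\<bar>"]
          proof eventually_elim
            fix N assume "nat \<bar>j\<bar> \<le> N"
            then have "j \<in> {- int N..int N}" by auto
            then show "y N j = x 0 * \<delta> 0 j" using y(2)[of N] y(3)[of j N] by (cases "j = 0") (auto simp: \<delta>_def)
          qed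
        qed
      qed
    qed
    show "M = {hzero ?H}"
    proof (rule ccontr)
      assume "M \<noteq> {hzero ?H}"
      then obtain F where F: "F \<in> M" "F \<noteq> hzero ?H" using M_zero by blast
      then obtain x where x: "l2_seq x" "F = ?e x" using M_sub ind_carrier_iff[OF chi] by blast
      then have xA: "x \<in> A" using F by (simp add: A_def)
      have "x \<noteq> (\<lambda>_. 0)" using F x by (auto simp: ind_hzero)
      then obtain k where k: "x k \<noteq> 0" by auto
      have "(\<lambda>j. x (0 + k) * \<delta> 0 j) \<in> A" using \<delta>A[OF A_shift[OF xA, of k]] .
      from A_scale[OF this, of "1 / x k"] k have d0: "\<delta> 0 \<in> A" by simp
      have dm: "\<delta> m \<in> A" for m
      proof -
        have "(\<lambda>j. \<delta> 0 (j + (- m))) = \<delta> m" by (rule ext) (simp add: \<delta>_def)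
        then show ?thesis using A_shift[OF d0, of "- m"] by simp
      qed
      have fin: "(\<lambda>j. \<Sum>m\<in>S. y m * \<delta> m j) \<in> A" if "finite S" for S y
        using that
      proof (induction S rule: finite_induct)
        case (insert m S)
        then show ?case using A_add[OF A_scale[OF dm[of m], of "y m"] insert.IH] by simp
      qed (simp add: A_zero)
      have all: "y \<in> A" if y: "l2_seq y" for y
      proof (rule A_lim[OF fin y y])
        show "finite {- int n..int n}" for n :: nat by simp
        have s: "(\<Sum>m\<in>{- int n..int n}. y m * \<delta> m j) = (if j \<in> {- int n..int n} then y j else 0)" for n j
          by (simp add: \<delta>_def if_distrib cong: if_cong)
        show "cmod ((\<Sum>m\<in>{- int n..int n}. y m * \<delta> m j) - y j) \<le> cmod (y j)" for n j
          unfolding s by simp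
        show "(\<lambda>n. \<Sum>m\<in>{- int n..int n}. y m * \<delta> m j) \<longlonglongrightarrow> y j" for j
        proof (rule tendsto_eventually)
          show "\<forall>\<^sub>F n in sequentially. (\<Sum>m\<in>{- int n..int n}. y m * \<delta> m j) = y j"
            using eventually_ge_at_top[of "nat \<bar>j\<bar>"] unfolding s by eventually_elim auto
        qed
      qed
      have "hcarrier ?H \<subseteq> M"
      proof
        fix F' assume "F' \<in> hcarrier ?H"
        then obtain y where y: "l2_seq y" "F' = ?e y" by (auto simp: ind_carrier_iff[OF chi])
        then show "F' \<in> M" using all[OF y(1)] by (simp add: A_def)
      qed
      then show False using M_sub ne by blast
    qed
  qed
  have nontrivial: "hcarrier ?H \<noteq> {hzero ?H}"
  proof
    assume eq: "hcarrier ?H = {hzero ?H}"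
    have "?e (\<lambda>j. 1 * \<delta> 0 j) \<in> hcarrier ?H" by (rule equivariant_ext_in[OF chi l2_\<delta>])
    then have "(\<lambda>j. 1 * \<delta> 0 j) = (\<lambda>_. 0)"
      unfolding eq by (simp add: ind_hzero equivariant_ext_inject[OF chi])
    then have "1 * \<delta> 0 0 = 0" by (rule fun_cong)
    then show False by (simp add: \<delta>_def)
  qed
  show ?thesis
    unfolding irreducible_rep_def by (intro conjI allI impI nontrivial, elim conjE, rule dichotomy)
qed

section \<open>Reducibility in the periodic case\<close>

text \<open>
  For a limit \<open>F\<close> of kernel vectors \<open>X n\<close>, the norm of \<open>T F\<close> is that of \<open>T (X n - F)\<close> and so is bounded by a
  multiple of the distance from \<open>X n\<close> to \<open>F\<close>.
\<close>

lemma kernel_closed_subspace: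
  assumes chi: "chi \<in> characters" and T: "T \<in> bounded_ops (ind_space chi)"
  shows "closed_subspace (ind_space chi) {F \<in> hcarrier (ind_space chi). T F = hzero (ind_space chi)}"
proof -
  let ?H = "ind_space chi" and ?e = "equivariant_ext chi"
  have T_add: "F \<in> hcarrier ?H \<Longrightarrow> F' \<in> hcarrier ?H \<Longrightarrow> T (hadd ?H F F') = hadd ?H (T F) (T F')"
    and T_scale: "F \<in> hcarrier ?H \<Longrightarrow> T (hscale ?H c F) = hscale ?H c (T F)" for F F' c
    using T unfolding bounded_ops_def by blast+
  obtain C where C: "\<And>F. F \<in> hcarrier ?H \<Longrightarrow> hnorm ?H (T F) \<le> C * hnorm ?H F"
    using T unfolding bounded_ops_def by blast
  note K = unitary_map_inv(2)[OF fourier_map_unitary[OF chi] lin_closed_L2]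
  have K_add: "F \<in> hcarrier ?H \<Longrightarrow> F' \<in> hcarrier ?H \<Longrightarrow> hadd ?H F F' \<in> hcarrier ?H"
    and K_scale: "F \<in> hcarrier ?H \<Longrightarrow> hscale ?H c F \<in> hcarrier ?H" for F F' c
    using K unfolding lin_closed_def by blast+
  have z: "hadd ?H (hzero ?H) (hzero ?H) = hzero ?H" "hscale ?H c (hzero ?H) = hzero ?H" for c
    by (simp_all add: ind_hzero ind_hadd ind_hscale)
  have zc: "hzero ?H \<in> hcarrier ?H"
    unfolding ind_hzero by (rule equivariant_ext_in[OF chi l2_seq_finite_support[of "{}"]]) simp_all
  have "hscale ?H 0 (T (hzero ?H)) = hzero ?H"
  proof -
    obtain y where "T (hzero ?H) = ?e y"
      using bounded_ops_closed[OF T zc] by (auto simp: ind_carrier_iff[OF chi])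
    then show ?thesis by (simp add: ind_hscale ind_hzero)
  qed
  then have Tz: "T (hzero ?H) = hzero ?H" using T_scale[OF zc, of 0] z by simp
  have lim: "T F = hzero ?H"
    if X: "\<And>n::nat. X n \<in> hcarrier ?H" "\<And>n. T (X n) = hzero ?H" and F: "F \<in> hcarrier ?H"
      and lim: "(\<lambda>n. hdist ?H (X n) F) \<longlonglongrightarrow> 0" for X F
  proof -
    obtain y where y: "l2_seq y" "T F = ?e y"
      using bounded_ops_closed[OF T F] by (auto simp: ind_carrier_iff[OF chi])
    have "sqrt (\<Sum>\<^sub>\<infinity>j. (cmod (y j))\<^sup>2) \<le> C * hdist ?H (X n) F" for n
    proof -
      have "T (hadd ?H (X n) (hscale ?H (- 1) F)) = ?e (\<lambda>j. - y j)"
        by (simp add: T_add T_scale K_scale X F y ind_hzero ind_hadd ind_hscale)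
      then have "hnorm ?H (?e (\<lambda>j. - y j)) \<le> C * hdist ?H (X n) F"
        using C[OF K_add[OF X(1) K_scale[OF F]], of n "- 1"] by (simp add: hdist_def)
      then show ?thesis
        using ind_hnorm[OF chi l2_seq_scale[OF y(1), of "- 1"]] by simp
    qed
    then have "sqrt (\<Sum>\<^sub>\<infinity>j. (cmod (y j))\<^sup>2) \<le> 0"
      using LIMSEQ_le_const[OF tendsto_mult_right_zero[OF lim, of C]] by blast
    then have "(\<Sum>\<^sub>\<infinity>j. (cmod (y j))\<^sup>2) \<le> 0" by simp
    then have "(cmod (y j))\<^sup>2 = 0" for j
      by (rule nonneg_infsum_le_0D) (use y(1) in \<open>auto simp: l2_seq_def\<close>)
    then have "y = (\<lambda>_. 0)" by auto
    then show ?thesis by (simp add: y ind_hzero)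
  qed
  show ?thesis
    unfolding closed_subspace_def
  proof (intro conjI ballI allI impI)
    fix X F
    assume X: "\<forall>n. X n \<in> {F \<in> hcarrier ?H. T F = hzero ?H}" and F: "F \<in> hcarrier ?H"
      and lim0: "(\<lambda>n. hdist ?H (X n) F) \<longlonglongrightarrow> 0"
    have "T F = hzero ?H" by (rule lim[OF _ _ F lim0]) (use X in blast)+
    then show "F \<in> {F \<in> hcarrier ?H. T F = hzero ?H}" using F by simp
  qed (simp_all add: zc Tz K_add K_scale T_add T_scale z)
qed

lemma ind_rep_in_carrier:
  assumes chi: "chi \<in> characters" and F: "F \<in> hcarrier (ind_space chi)"
  shows "ind_rep \<alpha> g F \<in> hcarrier (ind_space chi)"
proof -
  obtain k c where g: "g = (k, c)" by (cases g)
  obtain x where x: "l2_seq x" "F = equivariant_ext chi x" using F by (auto simp: ind_carrier_iff[OF chi])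
  show ?thesis
    unfolding g x(2) ind_rep_equivariant_ext[OF chi]
    by (rule equivariant_ext_in[OF chi l2_seq_twist_shift[OF chi x(1)]])
qed

definition upper_arc :: "complex \<Rightarrow> complex" where
  "upper_arc z = (if 0 < Im z then 1 else 0)"

lemma upper_arc_Linf: "upper_arc \<in> Linf_funs circle_haar"
proof -
  have "integrable circle_haar (\<lambda>z. Im z)"
    by (rule circle_integrable[OF finite_circle_haar sets_circle_haar]) (intro continuous_intros)
  then have [measurable]: "(\<lambda>z. Im z) \<in> borel_measurable circle_haar" by simp
  have "upper_arc \<in> borel_measurable circle_haar"
    unfolding upper_arc_def[abs_def] by measurable
  moreover have "AE z in circle_haar. cmod (upper_arc z) \<le> 1"
    by (rule AE_I2) (simp add: upper_arc_def)
  ultimately show ?thesis by (auto simp: Linf_funs_def)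
qed

text \<open>
  If \<open>Im z\<close> had constant sign it would vanish almost everywhere, because its integral is zero; then
  \<open>z\<^sup>2 = 1\<close> almost everywhere, against the vanishing of the second moment.
\<close>

lemma not_AE_Im_sign:
  assumes "s = 1 \<or> s = - 1"
  shows "\<not> (AE z in circle_haar. 0 \<le> s * Im z)"
proof
  assume nn: "AE z in circle_haar. 0 \<le> s * Im z"
  have i: "integrable circle_haar (\<lambda>z. z powi n)" for n
    by (rule L2_circle_integrable[OF L2_circle_powi])
  have "(LINT z|circle_haar. Im (z powi 1)) = Im (LINT z|circle_haar. z powi 1)"
    by (rule integral_Im[OF i])
  then have "(LINT z|circle_haar. Im z) = 0" by (simp add: circle_haar_moment[of 1, simplified])
  then have "(LINT z|circle_haar. s * Im z) = 0" by simp
  moreover have "integrable circle_haar (\<lambda>z. s * Im z)"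
    using integrable_Im[OF i[of 1]] by simp
  ultimately have "AE z in circle_haar. s * Im z = 0"
    using integral_nonneg_eq_0_iff_AE[OF _ nn] by blast
  then have "AE z in circle_haar. z powi 2 = z powi 0"
    using AE_space
  proof eventually_elim
    fix z assume "s * Im z = 0" and "z \<in> space circle_haar"
    then have "Im z = 0" "(Re z)\<^sup>2 = 1"
      using assms by (auto simp: space_circle_haar cmod_def)
    then show "z powi 2 = z powi 0" by (simp add: complex_eq_iff power2_eq_square)
  qed
  then have "(LINT z|circle_haar. z powi 2) = (LINT z|circle_haar. z powi 0)"
    by (intro integral_cong_AE powi_measurable_circle)
  then show False unfolding circle_haar_moment by simp
qed

text \<open>
  The commutant contains the projection that corresponds to multiplication by the indicator function
  of the set where \<open>z ^ p\<close> lies in the upper half-plane. It is neither 0 nor the identity, so its kernel is a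
  proper nonzero invariant subspace.
\<close>

proposition periodic_imp_reducible:
  assumes \<alpha>: "automorphism \<alpha>" and chi: "chi \<in> characters" and p: "minimal_period \<alpha> chi p"
  shows "\<not> irreducible_rep (ind_space chi) (ind_rep \<alpha>)"
proof
  let ?H = "L2_space circle_haar" and ?K = "ind_space chi" and ?V = "fourier_map chi"
    and ?c = "ae_class circle_haar"
  note V = fourier_map_unitary[OF chi]
  have p0: "0 < p" using p by (simp add: minimal_period_def has_period_def)
  define \<phi> where "\<phi> z = upper_arc (z ^ p)" for z
  have \<phi>: "\<phi> \<in> Linf_funs circle_haar" unfolding \<phi>_def by (rule Linf_power[OF upper_arc_Linf p0])
  define T where "T = transport ?H ?K ?V (mult_operator circle_haar \<phi>)"
  have "mult_operator circle_haar \<phi> \<in> power_mult_algebra p"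
    using upper_arc_Linf unfolding power_mult_algebra_def \<phi>_def by blast
  then have "T \<in> commutant ?K (ind_rep \<alpha>)"
    unfolding commutant_eq[OF \<alpha> chi p] T_def by blast
  then have Tb: "T \<in> bounded_ops ?K" and comm: "\<And>g F. F \<in> hcarrier ?K \<Longrightarrow> T (ind_rep \<alpha> g F) = ind_rep \<alpha> g (T F)"
    by (auto simp: commutant_def)
  have TV: "T (?V (?c h)) = ?V (?c (\<lambda>z. \<phi> z * h z))" if h: "L2_circle h" for h
    unfolding T_def transport_apply[OF V ae_class_in_L2[OF h]] mult_operator_ae_class[OF h] ..
  define N where "N = {F \<in> hcarrier ?K. T F = hzero ?K}"
  have V0: "?V (?c h) = hzero ?K \<longleftrightarrow> (AE z in circle_haar. h z = 0)" if h: "L2_circle h" for h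
  proof -
    have z: "fourier_coeff (\<lambda>_. 0) = (\<lambda>_. 0)" by (auto simp: fourier_coeff_def)
    have "?V (?c h) = hzero ?K \<longleftrightarrow> fourier_coeff h = fourier_coeff (\<lambda>_. 0)"
      by (simp add: fourier_map_ae_class[OF h] ind_hzero equivariant_ext_inject[OF chi] z)
    also have "\<dots> \<longleftrightarrow> (AE z in circle_haar. h z = 0)"
    proof
      assume "fourier_coeff h = fourier_coeff (\<lambda>_. 0)"
      then show "AE z in circle_haar. h z = 0"
        by (intro fourier_coeff_unique[of h "\<lambda>_. 0"] L2_circle_integrable[OF h]) simp_all
    next
      assume "AE z in circle_haar. h z = 0"
      then show "fourier_coeff h = fourier_coeff (\<lambda>_. 0)"
        by (intro fourier_coeff_cong_AE square_integrable_measurable[OF h]) simp_all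
    qed
    finally show ?thesis .
  qed
  have um: "upper_arc \<in> borel_measurable circle_haar"
    using upper_arc_Linf by (simp add: Linf_funs_def)
  have not_AE: "\<not> (AE z in circle_haar. \<phi> z = c)" if c: "c = 0 \<or> c = 1" for c
  proof
    assume "AE z in circle_haar. \<phi> z = c"
    moreover have "{z \<in> space circle_haar. upper_arc z = c} \<in> sets circle_haar"
      using um by measurable
    ultimately have "AE z in circle_haar. upper_arc z = c"
      using AE_circle_power_iff[OF p0, of "\<lambda>z. upper_arc z = c"] by (simp add: \<phi>_def space_circle_haar)
    then have "AE z in circle_haar. 0 \<le> (if c = 0 then - 1 else 1) * Im z"
      by eventually_elim (use c in \<open>auto simp: upper_arc_def split: if_splits\<close>)
    then show False using not_AE_Im_sign[of "if c = 0 then - 1 else 1"] by simp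
  qed
  have idem: "\<phi> z * \<phi> z = \<phi> z" for z by (simp add: \<phi>_def upper_arc_def)
  have \<phi>2: "L2_circle \<phi>" by (rule L2_circle_Linf[OF \<phi>])
  have \<psi>2: "L2_circle (\<lambda>z. 1 - \<phi> z)" by (rule square_integrable_diff[OF L2_circle_const \<phi>2])
  assume irr: "irreducible_rep ?K (ind_rep \<alpha>)"
  have "closed_subspace ?K N" unfolding N_def by (rule kernel_closed_subspace[OF chi Tb])
  moreover have "ind_rep \<alpha> g F \<in> N" if "F \<in> N" for g F
  proof -
    have "ind_rep \<alpha> g (hzero ?K) = hzero ?K" by (simp add: ind_rep_def ind_space_def)
    then show ?thesis using that comm ind_rep_in_carrier[OF chi] by (simp add: N_def)
  qed
  ultimately consider "N = {hzero ?K}" | "N = hcarrier ?K"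
    using irr unfolding irreducible_rep_def by blast
  then show False
  proof cases
    case 1
    \<comment> \<open>The complementary projection has its range in the kernel.\<close>
    have "T (?V (?c (\<lambda>z. 1 - \<phi> z))) = hzero ?K"
      unfolding TV[OF \<psi>2] by (subst V0) (simp_all add: right_diff_distrib idem L2_circle_const)
    then have "?V (?c (\<lambda>z. 1 - \<phi> z)) \<in> N"
      using unitary_map_in[OF V ae_class_in_L2[OF \<psi>2]] by (simp add: N_def)
    then have "AE z in circle_haar. 1 - \<phi> z = 0" using 1 V0[OF \<psi>2] by simp
    then have "AE z in circle_haar. \<phi> z = 1" by eventually_elim simp
    then show False using not_AE by blast
  next
    case 2
    have "?V (?c \<phi>) \<in> N" unfolding 2 by (rule unitary_map_in[OF V ae_class_in_L2[OF \<phi>2]])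
    then have "?V (?c \<phi>) = hzero ?K" using TV[OF \<phi>2] by (simp add: N_def idem)
    then show False using V0[OF \<phi>2] not_AE by blast
  qed
qed

theorem theorem4p8:
  fixes \<alpha> :: "'b::ab_group_add \<Rightarrow> 'b" and chi :: "'b \<Rightarrow> complex"
  assumes "automorphism \<alpha>" and "chi \<in> characters"
  shows "(irreducible_rep (ind_space chi) (ind_rep \<alpha>) \<longleftrightarrow> aperiodic \<alpha> chi) \<and>
    (\<forall>p. minimal_period \<alpha> chi p \<longrightarrow>
      abelian_algebra (L2_space circle_haar) (power_mult_algebra p) \<and>
      star_isomorphic (ind_space chi) (commutant (ind_space chi) (ind_rep \<alpha>))
        (L2_space circle_haar) (power_mult_algebra p))"
proof (intro conjI allI impI iffI)
  assume irr: "irreducible_rep (ind_space chi) (ind_rep \<alpha>)"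
  show "aperiodic \<alpha> chi"
    unfolding aperiodic_def
  proof
    assume "\<exists>p. has_period \<alpha> chi p"
    then obtain q where "has_period \<alpha> chi q" ..
    then obtain p where "minimal_period \<alpha> chi p" by (rule period_imp_minimal_period)
    then show False using periodic_imp_reducible[OF assms] irr by simp
  qed
next
  assume "aperiodic \<alpha> chi"
  then show "irreducible_rep (ind_space chi) (ind_rep \<alpha>)" by (rule aperiodic_imp_irreducible[OF assms])
next
  fix p assume p: "minimal_period \<alpha> chi p"
  then have "0 < p" by (simp add: minimal_period_def has_period_def)
  then show "abelian_algebra (L2_space circle_haar) (power_mult_algebra p)" by (rule abelian_algebra_power_mult)
  show "star_isomorphic (ind_space chi) (commutant (ind_space chi) (ind_rep \<alpha>))
      (L2_space circle_haar) (power_mult_algebra p)"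
    by (rule commutant_star_isomorphic[OF assms p])
qed

end
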